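(* For $q=d-1$ and, if $d\geq3$, also for $q=d-2$, any local algorithm $\hat V_q$ for the intrinsic volume $V_q$ (as defined in the context, for any $n\in\mathbb N$ and any lattice $\mathbb L\subseteq\mathbb R^d$) with homogeneous weights, i.e. $w_l(a)=a^qw_l(1)$ for all $a>0$ and all $l$, is asymptotically biased (and hence not multigrid convergent) on the class of $r$-regular sets: it is not the case that $\lim_{a\to0}E\hat V_q^{a\mathbb L_c}(X)$ exists and equals $V_q(X)$ for every compact set $X\subseteq\mathbb R^d$ that is $r$-regular for some $r>0$.
   Context: Lattice and configurations: $\xi=\{\xi_1,\dots,\xi_d\}$ is a positively oriented basis of $\mathbb R^d$, $\mathbb L$ is the lattice it spans, $C_\xi=\bigoplus_{i=1}^d[0,\xi_i]$ is its unit cell, and $\mathbb L_c=\mathbb L+c$ for $c\in\mathbb R^d$. For $n\in\mathbb N$ let $C^n_{0,0}=\{\sum_i\lambda_i\xi_i:\lambda_i\in\{0,\dots,n-1\}\}$. An $n\times\dots\times n$ configuration is a pair $(B,W)$ of disjoint sets with $B\cup W=C^n_{0,0}$; these are enumerated as $(B_l,W_l)$, $l=0,\dots,2^{n^d}-1$, with $B_0=\emptyset$ and $B_{2^{n^d}-1}=C^n_{0,0}$. Local algorithm for $V_q$: functions $w_l:(0,\infty)\to\mathbb R$ (weights), $l=1,\dots,2^{n^d}-1$, giving for compact $X\subseteq\mathbb R^d$, $a>0$, $c\in C_\xi$ the estimator $\hat V_q^{a\mathbb L_c}(X)=\sum_{l=1}^{2^{n^d}-1}w_l(a)N_l(X\cap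 a\mathbb L_c)$, where $N_l(X\cap a\mathbb L_c)$ is the number of $z\in\mathbb L$ with $a(z+c)+aB_l\subseteq X$ and $a(z+c)+aW_l\subseteq\mathbb R^d\setminus X$. The weights are motion and reflection invariant: $w_{l_1}=w_{l_2}$ whenever there are a rotation or reflection $R$ preserving $\mathbb L$ and $z_1,z_2\in\mathbb R^d$ with $R(B_{l_1}+z_1)=B_{l_2}+z_2$. $X\subseteq\mathbb R^d$ is $r$-regular if for every $x\in\partial X$ there are two balls $B_1,B_2\subseteq\mathbb R^d$, both of radius $r$ and containing $x$, with $B_1\subseteq X$ and $\operatorname{int}(B_2)\subseteq\mathbb R^d\setminus X$. The intrinsic volumes $V_q(X)$ of such a compact set (which has positive reach) are the coefficients in the Steiner formula $\mathcal H^d(X\oplus B(s))=\sum_{q=0}^d s^{d-q}\kappa_{d-q}V_q(X)$, valid for all sufficiently small $s\geq 0$, with $\mathcal H^d$ the $d$-dimensional Hausdorff measure, $B(s)$ the ball of radius $s$ and $\kappa_j$ the volume of the unit ball in $\mathbb R^j$. $E$ denotes the mean when $c$ is uniformly distributed in $C_\xi$. The algorithm is asymptotically unbiased on a class $\mathcal S$ if $\lim_{a\to0}E\hat V_q^{a\mathbb L_c}(X)=V_q(X)$ for all $X\in\mathcal S$, and asymptotically biased on $\mathcal S$ otherwise. It is multigrid convergent on $\mathcal S$ if $\lim_{a\to0}\hat V_q^{a\mathbb L_0}(X)=V_q(X)$ for all $X\in\mathcal S$.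
   Formalization: The dimension is assumed to satisfy d ≥ 2; for d = 1, q = 0 the claim fails: on the lattice Z with n = 2, weight 1/2 on each of the two mixed configurations gives the number of components of an r-regular set exactly for all small a. *)

theory Defs
  imports "HOL-Analysis.Analysis"
begin

text \<open>Throughout, the ambient space is \<open>real ^ 'd\<close> with \<open>d = CARD('d)\<close>, and a basis
  \<open>\<xi>\<close> is a family of vectors indexed by \<open>'d\<close>.  The matrix below has the same index type for rows
  and columns, so its determinant does not depend on an ordering of \<open>'d\<close>.\<close>

definition positively_oriented_basis :: "('d::finite \<Rightarrow> real ^ 'd) \<Rightarrow> bool" where
  "positively_oriented_basis \<xi> \<longleftrightarrow>
     inj \<xi> \<and> independent (range \<xi>) \<and> span (range \<xi>) = UNIV \<and> det (\<chi> i. \<xi> i) > 0"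

definition lattice_of :: "('d::finite \<Rightarrow> real ^ 'd) \<Rightarrow> (real ^ 'd) set" where
  "lattice_of \<xi> = range (\<lambda>k :: 'd \<Rightarrow> int. \<Sum>i\<in>UNIV. of_int (k i) *\<^sub>R \<xi> i)"

definition unit_cell :: "('d::finite \<Rightarrow> real ^ 'd) \<Rightarrow> (real ^ 'd) set" where
  "unit_cell \<xi> = {(\<Sum>i\<in>UNIV. t i *\<^sub>R \<xi> i) | t. \<forall>i. 0 \<le> t i \<and> t i \<le> 1}"

definition config_cell :: "('d::finite \<Rightarrow> real ^ 'd) \<Rightarrow> nat \<Rightarrow> (real ^ 'd) set" where
  "config_cell \<xi> n = {(\<Sum>i\<in>UNIV. real (k i) *\<^sub>R \<xi> i) | k :: 'd \<Rightarrow> nat. \<forall>i. k i < n}"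

text \<open>A configuration is determined by its black part \<open>B l\<close>; the white part is the complement
  of \<open>B l\<close> in \<^term>\<open>config_cell \<xi> n\<close>.\<close>

definition config_enumeration ::
  "('d::finite \<Rightarrow> real ^ 'd) \<Rightarrow> nat \<Rightarrow> (nat \<Rightarrow> (real ^ 'd) set) \<Rightarrow> bool" where
  "config_enumeration \<xi> n B \<longleftrightarrow>
     bij_betw B {0..2 ^ (n ^ CARD('d)) - 1} (Pow (config_cell \<xi> n)) \<and>
     B 0 = {} \<and> B (2 ^ (n ^ CARD('d)) - 1) = config_cell \<xi> n"

definition white_part ::
  "('d::finite \<Rightarrow> real ^ 'd) \<Rightarrow> nat \<Rightarrow> (nat \<Rightarrow> (real ^ 'd) set) \<Rightarrow> nat \<Rightarrow> (real ^ 'd) set" where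
  "white_part \<xi> n B l = config_cell \<xi> n - B l"

text \<open>For compact \<open>X\<close>, \<open>a > 0\<close> and \<open>B l \<noteq> {}\<close> the set counted below is finite.\<close>

definition config_count ::
  "('d::finite \<Rightarrow> real ^ 'd) \<Rightarrow> nat \<Rightarrow> (nat \<Rightarrow> (real ^ 'd) set) \<Rightarrow> (real ^ 'd) set \<Rightarrow> real
     \<Rightarrow> real ^ 'd \<Rightarrow> nat \<Rightarrow> nat" where
  "config_count \<xi> n B X a c l = card {z \<in> lattice_of \<xi>.
     (\<lambda>b. a *\<^sub>R (z + c) + a *\<^sub>R b) ` B l \<subseteq> X \<and>
     (\<lambda>b. a *\<^sub>R (z + c) + a *\<^sub>R b) ` white_part \<xi> n B l \<subseteq> - X}"

definition local_estimator ::
  "('d::finite \<Rightarrow> real ^ 'd) \<Rightarrow> nat \<Rightarrow> (nat \<Rightarrow> (real ^ 'd) set) \<Rightarrow> (nat \<Rightarrow> real \<Rightarrow> real)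
     \<Rightarrow> (real ^ 'd) set \<Rightarrow> real \<Rightarrow> real ^ 'd \<Rightarrow> real" where
  "local_estimator \<xi> n B w X a c =
     (\<Sum>l = 1..2 ^ (n ^ CARD('d)) - 1. w l a * real (config_count \<xi> n B X a c l))"

definition motion_reflection_invariant ::
  "('d::finite \<Rightarrow> real ^ 'd) \<Rightarrow> nat \<Rightarrow> (nat \<Rightarrow> (real ^ 'd) set) \<Rightarrow> (nat \<Rightarrow> real \<Rightarrow> real) \<Rightarrow> bool" where
  "motion_reflection_invariant \<xi> n B w \<longleftrightarrow>
     (\<forall>l1 \<in> {1..2 ^ (n ^ CARD('d)) - 1}. \<forall>l2 \<in> {1..2 ^ (n ^ CARD('d)) - 1}.
        (\<exists>R z1 z2. orthogonal_transformation R \<and> R ` lattice_of \<xi> = lattice_of \<xi> \<and>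
           R ` ((\<lambda>x. x + z1) ` B l1) = (\<lambda>x. x + z2) ` B l2)
        \<longrightarrow> (\<forall>a>0. w l1 a = w l2 a))"

definition homogeneous_weights ::
  "nat \<Rightarrow> nat \<Rightarrow> nat \<Rightarrow> (nat \<Rightarrow> real \<Rightarrow> real) \<Rightarrow> bool" where
  "homogeneous_weights d n q w \<longleftrightarrow>
     (\<forall>l \<in> {1..2 ^ (n ^ d) - 1}. \<forall>a>0. w l a = a ^ q * w l 1)"

definition r_regular :: "real \<Rightarrow> (real ^ 'd::finite) set \<Rightarrow> bool" where
  "r_regular r X \<longleftrightarrow>
     (\<forall>x \<in> frontier X. \<exists>p1 p2. x \<in> cball p1 r \<and> x \<in> cball p2 r \<and>
        cball p1 r \<subseteq> X \<and> interior (cball p2 r) \<subseteq> - X)"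

definition r_regular_sets :: "(real ^ 'd::finite) set set" where
  "r_regular_sets = {X. compact X \<and> (\<exists>r>0. r_regular r X)}"

text \<open>The \<open>d\<close>-dimensional Hausdorff measure on \<open>real ^ 'd\<close>, in its usual normalisation, is
  Lebesgue measure.\<close>

definition steiner_coefficients :: "(real ^ 'd::finite) set \<Rightarrow> (nat \<Rightarrow> real) \<Rightarrow> bool" where
  "steiner_coefficients X V \<longleftrightarrow>
     (\<exists>\<epsilon>>0. \<forall>s. 0 \<le> s \<and> s < \<epsilon> \<longrightarrow>
        measure lebesgue {x + y | x y. x \<in> X \<and> y \<in> cball 0 s} =
        (\<Sum>q = 0..CARD('d). s ^ (CARD('d) - q) * unit_ball_vol (real (CARD('d) - q)) * V q))"

text \<open>The coefficients with index at most \<open>d\<close> are unique, so this is meaningful for such \<open>q\<close>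
  whenever \<open>X\<close> has a Steiner formula; compact \<open>r\<close>-regular sets do, having positive reach.\<close>

definition intrinsic_volume :: "nat \<Rightarrow> (real ^ 'd::finite) set \<Rightarrow> real" where
  "intrinsic_volume q X = (THE v. \<exists>V. steiner_coefficients X V \<and> V q = v)"

text \<open>For compact \<open>X\<close> and \<open>a > 0\<close> the estimator is a bounded Borel function of \<open>c\<close> on the cell, so
  the Bochner integral is the actual mean and not the default value.\<close>

definition mean_estimator ::
  "('d::finite \<Rightarrow> real ^ 'd) \<Rightarrow> nat \<Rightarrow> (nat \<Rightarrow> (real ^ 'd) set) \<Rightarrow> (nat \<Rightarrow> real \<Rightarrow> real)
     \<Rightarrow> (real ^ 'd) set \<Rightarrow> real \<Rightarrow> real" where
  "mean_estimator \<xi> n B w X a =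
     (\<integral>c. local_estimator \<xi> n B w X a c \<partial>(uniform_measure lborel (unit_cell \<xi>)))"

definition asymptotically_unbiased_on ::
  "(real ^ 'd::finite) set set \<Rightarrow> nat \<Rightarrow> ('d \<Rightarrow> real ^ 'd) \<Rightarrow> nat \<Rightarrow> (nat \<Rightarrow> (real ^ 'd) set)
     \<Rightarrow> (nat \<Rightarrow> real \<Rightarrow> real) \<Rightarrow> bool" where
  "asymptotically_unbiased_on S q \<xi> n B w \<longleftrightarrow>
     (\<forall>X \<in> S. ((\<lambda>a. mean_estimator \<xi> n B w X a) \<longlongrightarrow> intrinsic_volume q X) (at_right 0))"

definition asymptotically_biased_on ::
  "(real ^ 'd::finite) set set \<Rightarrow> nat \<Rightarrow> ('d \<Rightarrow> real ^ 'd) \<Rightarrow> nat \<Rightarrow> (nat \<Rightarrow> (real ^ 'd) set)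
     \<Rightarrow> (nat \<Rightarrow> real \<Rightarrow> real) \<Rightarrow> bool" where
  "asymptotically_biased_on S q \<xi> n B w \<longleftrightarrow> \<not> asymptotically_unbiased_on S q \<xi> n B w"

definition multigrid_convergent_on ::
  "(real ^ 'd::finite) set set \<Rightarrow> nat \<Rightarrow> ('d \<Rightarrow> real ^ 'd) \<Rightarrow> nat \<Rightarrow> (nat \<Rightarrow> (real ^ 'd) set)
     \<Rightarrow> (nat \<Rightarrow> real \<Rightarrow> real) \<Rightarrow> bool" where
  "multigrid_convergent_on S q \<xi> n B w \<longleftrightarrow>
     (\<forall>X \<in> S. ((\<lambda>a. local_estimator \<xi> n B w X a 0) \<longlongrightarrow> intrinsic_volume q X) (at_right 0))"

end

theory Submission
  imports Defs "HOL-Computational_Algebra.Polynomial"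
begin

text \<open>
  Write \<open>e = d - q\<close>, so \<open>e\<close> is 1 or 2. The mean over the unit cell turns the number of occurrences of a
  configuration into the volume of the set of positions at which its black points lie in \<open>X\<close> and
  its white points do not (\<open>mean_estimator_eq_fit_volumes\<close>). Inclusion-exclusion over the black
  points rewrites these volumes as signed sums of volumes of the sets \<open>hit_set X a S\<close> of positions
  at which some point of \<open>S\<close> lies in \<open>X\<close> (\<open>measure_fit_set\<close>). With homogeneous weights and mesh
  \<open>a = 1 / m\<close>, convergence of the mean therefore says that
  \<open>m ^ e * (\<Sum>i. \<mu> i * vol (hit_set X (1 / m) (S i)))\<close> tends to \<open>\<delta> * V\<^sub>q(X)\<close>, with fixed coefficients
  \<open>\<mu> i\<close>, fixed finite sets \<open>S i\<close> and the cell volume \<open>\<delta> > 0\<close>.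

  This is tested on \<open>q\<close>-dimensional boxes, rotated arbitrarily and rounded by the unit ball. Lengthening
  one side of such a box by 1 inserts a slab in which the body is invariant along that side. The
  alternating sum over all boxes with sides 1 and 2 therefore keeps only what happens in an
  infinite cylinder over the \<open>e\<close>-dimensional unit ball: \<open>V\<^sub>q\<close> contributes exactly 1
  (\<open>intrinsic_volume_mixed_difference\<close>), and a hit set contributes the volume of a union of balls
  in dimension \<open>e\<close> (\<open>mixed_difference_hits\<close>). After rescaling, the sums
  \<open>\<Sum>i. \<mu> i * vol (\<Union>p\<in>S i. cball (\<pi> (G p)) m)\<close> tend to \<open>\<delta>\<close> for every orthogonal \<open>G\<close>, where \<open>\<pi>\<close> is the
  projection to dimension \<open>e\<close> (\<open>projected_ball_unions_limit\<close>).

  The volume of a union of balls of large radius \<open>\<rho>\<close> about the points of a finite set \<open>A\<close> in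
  dimension \<open>e\<close> is \<open>V * \<rho> ^ e + P * \<rho> + vol (convex hull A)\<close> up to an error that vanishes in the
  limit (\<open>ball_union_volume_expansion\<close>). Comparing constant terms gives
  \<open>(\<Sum>i. \<mu> i * vol (\<pi> (G (convex hull S i)))) = \<delta>\<close> for every orthogonal \<open>G\<close>
  (\<open>projected_hull_volumes_constant\<close>). Now let \<open>G\<close> rotate by an angle \<open>t\<close> in a coordinate plane. The
  projected length, respectively area, of a polytope is of the form \<open>\<alpha> * cos t + \<beta> * sin t\<close> for all small
  \<open>t > 0\<close>, because the extreme points of the polytope in the rotating direction, or those of its
  slices in the case of an area, stay the same for all those angles. A function of this form is
  constant on an interval only if it is 0, which contradicts \<open>\<delta> > 0\<close>.

  Multigrid convergence is reduced to convergence of the mean along \<open>a = 1 / m\<close>. Applied to all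
  translates of \<open>X\<close>, it is pointwise convergence of functions of the translation vector that are
  periodic under a lattice of mesh \<open>1 / m\<close> and locally constant off a null set. The Baire category
  theorem makes them uniformly bounded for large \<open>m\<close> off these null sets
  (\<open>eventually_uniformly_bounded_of_pointwise_limit\<close>), and dominated convergence gives the
  limit of their averages.
\<close>

abbreviation vol :: "'a::euclidean_space set \<Rightarrow> real" where
  "vol \<equiv> measure lborel"

section \<open>Rotation invariance and projections of slabs\<close>

text \<open>
  A change of variables costs nothing here: by Fubini, the image measure of \<open>A\<close> times the volume of the
  unit ball \<open>U\<close> is a double integral over \<open>A\<close> and translates of \<open>U\<close>. Shifting
  the inner variable exchanges the roles of the two measures, and \<open>U\<close> is itself invariant under
  \<open>T\<close>.
\<close>
lemma lborel_distr_orthogonal: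
  fixes T :: "'a::euclidean_space \<Rightarrow> 'a"
  assumes T: "orthogonal_transformation T"
  shows "distr lborel borel T = lborel"
proof (rule measure_eqI)
  fix A assume "A \<in> sets (distr lborel borel T)"
  then have A[measurable]: "A \<in> sets borel" by simp
  have lin: "linear T" using T by (rule orthogonal_transformation_linear)
  have [measurable]: "T \<in> borel_measurable borel"
    by (intro borel_measurable_continuous_onI linear_continuous_on linear_conv_bounded_linear[THEN iffD1] lin)
  obtain T' where T': "\<And>y. T (T' y) = y"
    using orthogonal_transformation_surj[OF T] by (metis surjD)
  define U where "U = (ball 0 1 :: 'a set)"
  have [measurable]: "U \<in> sets borel" unfolding U_def by simp
  have shift: "(\<integral>\<^sup>+x. f (x + v) \<partial>lborel) = (\<integral>\<^sup>+x. f x \<partial>lborel)"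
    if [measurable]: "f \<in> borel_measurable borel" for f :: "'a \<Rightarrow> ennreal" and v
  proof -
    have "(\<integral>\<^sup>+x. f x \<partial>lborel) = (\<integral>\<^sup>+x. f x \<partial>distr lborel borel ((+) v))"
      by (simp add: lborel_distr_plus)
    also have "\<dots> = (\<integral>\<^sup>+x. f (v + x) \<partial>lborel)"
      by (subst nn_integral_distr) auto
    finally show ?thesis by (simp add: add.commute)
  qed
  have "emeasure (distr lborel borel T) A * emeasure lborel U
      = (\<integral>\<^sup>+x. indicator A (T x) \<partial>lborel) * emeasure lborel U"
    by (subst nn_integral_indicator[symmetric], simp, subst nn_integral_distr) auto
  also have "\<dots> = (\<integral>\<^sup>+x. indicator A (T x) * (\<integral>\<^sup>+y. indicator U (y + - T x) \<partial>lborel) \<partial>lborel)"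
    by (subst shift) (auto simp: nn_integral_multc)
  also have "\<dots> = (\<integral>\<^sup>+x. (\<integral>\<^sup>+y. indicator A (T x) * indicator U (y + - T x) \<partial>lborel) \<partial>lborel)"
    by (subst nn_integral_cmult) auto
  also have "\<dots> = (\<integral>\<^sup>+y. (\<integral>\<^sup>+x. indicator A (T x) * indicator U (y + - T x) \<partial>lborel) \<partial>lborel)"
    by (rule lborel_pair.Fubini') simp
  also have "\<dots> = (\<integral>\<^sup>+y. (\<integral>\<^sup>+x. indicator A (T x + y) * indicator U (- T x) \<partial>lborel) \<partial>lborel)"
  proof (rule nn_integral_cong)
    fix y
    show "(\<integral>\<^sup>+x. indicator A (T x) * indicator U (y + - T x) \<partial>lborel) =
          (\<integral>\<^sup>+x. indicator A (T x + y) * indicator U (- T x) \<partial>lborel :: ennreal)"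
      by (subst shift[symmetric, where v = "T' y"])
         (auto simp: linear_add[OF lin] T')
  qed
  also have "\<dots> = (\<integral>\<^sup>+x. (\<integral>\<^sup>+y. indicator A (T x + y) * indicator U (- T x) \<partial>lborel) \<partial>lborel)"
    by (rule lborel_pair.Fubini') simp
  also have "\<dots> = (\<integral>\<^sup>+x. (\<integral>\<^sup>+y. indicator A (y + T x) \<partial>lborel) * indicator U (- T x) \<partial>lborel)"
    by (subst nn_integral_multc) (auto simp: add.commute)
  also have "\<dots> = (\<integral>\<^sup>+x. emeasure lborel A * indicator U x \<partial>lborel)"
    by (subst shift) (auto simp: U_def indicator_def orthogonal_transformation_norm[OF T])
  also have "\<dots> = emeasure lborel A * emeasure lborel U"
    by (simp add: nn_integral_cmult)
  finally have eq: "emeasure (distr lborel borel T) A * emeasure lborel U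
      = emeasure lborel A * emeasure lborel U" .
  have "emeasure lborel U \<noteq> \<infinity>" "emeasure lborel U \<noteq> 0"
    using content_ball_pos[of 1 "0::'a"] unfolding U_def
    by (auto simp: measure_def emeasure_lborel_ball_finite[THEN less_imp_neq])
  then show "emeasure (distr lborel borel T) A = emeasure lborel A"
    using eq unfolding mult.commute[of _ "emeasure lborel U"] ennreal_mult_cancel_left by auto
qed simp

lemma measure_lborel_orthogonal_image:
  fixes T :: "'a::euclidean_space \<Rightarrow> 'a"
  assumes T: "orthogonal_transformation T" and A: "A \<in> sets borel" "T ` A \<in> sets borel"
  shows "vol (T ` A) = vol A"
proof -
  have lin: "linear T" using T by (rule orthogonal_transformation_linear)
  have [measurable]: "T \<in> borel_measurable borel"
    by (intro borel_measurable_continuous_onI linear_continuous_on linear_conv_bounded_linear[THEN iffD1] lin)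
  have "vol (T ` A) = measure (distr lborel borel T) (T ` A)"
    by (simp add: lborel_distr_orthogonal[OF T])
  also have "\<dots> = vol (T -` (T ` A))"
    using A by (subst measure_distr) auto
  also have "T -` (T ` A) = A"
    using orthogonal_transformation_inj[OF T] by (simp add: inj_vimage_image_eq)
  finally show ?thesis .
qed

text \<open>
  Forgets the coordinates in \<open>K\<close>. The remaining ones are written in the basis of a second Euclidean space
  through \<open>\<beta>\<close>, which is meant to be a bijection from \<open>- K\<close> onto that basis.
\<close>
definition slab_projection :: "('d \<Rightarrow> 'b) \<Rightarrow> 'd set \<Rightarrow> real ^ 'd::finite \<Rightarrow> 'b::euclidean_space" where
  "slab_projection \<beta> K z = (\<Sum>i\<in>-K. z $ i *\<^sub>R \<beta> i)"

definition unit_slab :: "'d set \<Rightarrow> (real ^ 'd::finite) set" where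
  "unit_slab J = {z. \<forall>i\<in>J. 0 \<le> z $ i \<and> z $ i < 1}"

lemma sets_unit_slab [measurable]: "unit_slab (J :: 'd::finite set) \<in> sets borel"
proof -
  have "unit_slab J = (\<Inter>i\<in>J. {z :: real^'d. 0 \<le> z $ i} \<inter> {z. z $ i < 1})"
    by (auto simp: unit_slab_def)
  also have "\<dots> \<in> sets borel"
    by (intro sets.Int sets.countable_INT'' borel_closed borel_open closed_Collect_le open_Collect_less continuous_intros)
       (auto)
  finally show ?thesis .
qed

lemma linear_slab_projection: "linear (slab_projection \<beta> K)"
  unfolding slab_projection_def
  by (intro linearI) (simp_all add: scaleR_add_left sum.distrib scaleR_sum_right)

lemma measurable_slab_projection [measurable]:
  "slab_projection \<beta> K \<in> borel_measurable (borel :: (real^'d::finite) measure)"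
  by (intro borel_measurable_continuous_onI linear_continuous_on linear_conv_bounded_linear[THEN iffD1]
      linear_slab_projection)

lemma slab_projection_inner:
  assumes \<beta>: "bij_betw \<beta> (-K) (Basis :: 'b::euclidean_space set)" and i: "i \<notin> K"
  shows "slab_projection \<beta> K z \<bullet> \<beta> i = z $ i"
proof -
  have "slab_projection \<beta> K z \<bullet> \<beta> i = (\<Sum>j\<in>-K. z $ j * (\<beta> j \<bullet> \<beta> i))"
    by (simp add: slab_projection_def inner_sum_left)
  also have "\<dots> = (\<Sum>j\<in>-K. if j = i then z $ i else 0)"
  proof (rule sum.cong[OF refl])
    fix j assume j: "j \<in> -K"
    have "\<beta> j = \<beta> i \<longleftrightarrow> j = i" using \<beta> i j by (auto simp: bij_betw_def inj_on_def)
    moreover have "\<beta> j \<in> Basis" "\<beta> i \<in> Basis" using \<beta> i j by (auto simp: bij_betw_def)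
    ultimately show "z $ j * (\<beta> j \<bullet> \<beta> i) = (if j = i then z $ i else 0)"
      by (auto simp: inner_Basis)
  qed
  also have "\<dots> = z $ i" using i by simp
  finally show ?thesis .
qed

lemma norm_slab_projection:
  assumes \<beta>: "bij_betw \<beta> (-K) (Basis :: 'b::euclidean_space set)"
  shows "(norm (slab_projection \<beta> K z))\<^sup>2 = (\<Sum>i\<in>-K. (z $ i)\<^sup>2)"
proof -
  have "(norm (slab_projection \<beta> K z))\<^sup>2 = (\<Sum>b\<in>Basis. (slab_projection \<beta> K z \<bullet> b)\<^sup>2)"
    unfolding power2_norm_eq_inner by (subst euclidean_inner) (simp add: power2_eq_square)
  also have "\<dots> = (\<Sum>i\<in>-K. (slab_projection \<beta> K z \<bullet> \<beta> i)\<^sup>2)"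
    by (rule sum.reindex_bij_betw[OF \<beta>, symmetric])
  also have "\<dots> = (\<Sum>i\<in>-K. (z $ i)\<^sup>2)"
    by (rule sum.cong) (auto simp: slab_projection_inner[OF \<beta>])
  finally show ?thesis .
qed

lemma prod_Basis_vec: "(\<Prod>b\<in>(Basis::(real^'d::finite) set). f b) = (\<Prod>i\<in>UNIV. f (axis i 1))"
proof -
  have "bij_betw (\<lambda>i. axis i 1) UNIV (Basis::(real^'d) set)"
    by (auto simp: bij_betw_def inj_on_def axis_eq_axis Basis_vec_def)
  from prod.reindex_bij_betw[OF this, of f] show ?thesis by simp
qed

text \<open>
  Both sides agree on boxes: up to its boundary, the preimage of a box in the slab is a box whose extra sides have
  length 1.
\<close>
lemma distr_slab_projection:
  assumes \<beta>: "bij_betw \<beta> (-K) (Basis :: 'b::euclidean_space set)"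
  shows "lborel = distr (restrict_space lborel (unit_slab K)) borel (slab_projection \<beta> K :: real ^ 'd::finite \<Rightarrow> 'b)"
proof (rule lborel_eqI)
  fix l u :: 'b assume le: "\<And>b. b \<in> Basis \<Longrightarrow> l \<bullet> b \<le> u \<bullet> b"
  define l' u' where "l' = (\<chi> i. if i \<in> K then 0 else l \<bullet> \<beta> i)"
    and "u' = (\<chi> i. if i \<in> K then 1 else u \<bullet> \<beta> i)"
  have B: "\<beta> i \<in> Basis" if "i \<notin> K" for i using \<beta> that by (auto simp: bij_betw_def)
  have le': "l' $ i \<le> u' $ i" for i
    using le B by (auto simp: l'_def u'_def)
  have boxiff: "slab_projection \<beta> K z \<in> box l u \<longleftrightarrow> (\<forall>i\<in>-K. l \<bullet> \<beta> i < z $ i \<and> z $ i < u \<bullet> \<beta> i)" for z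
  proof -
    have "slab_projection \<beta> K z \<in> box l u \<longleftrightarrow>
      (\<forall>b\<in>\<beta> ` (-K). l \<bullet> b < slab_projection \<beta> K z \<bullet> b \<and> slab_projection \<beta> K z \<bullet> b < u \<bullet> b)"
      using \<beta> by (simp add: mem_box bij_betw_def)
    then show ?thesis by (simp add: slab_projection_inner[OF \<beta>])
  qed
  define E where "E = unit_slab K \<inter> slab_projection \<beta> K -` box l u"
  have [measurable]: "E \<in> sets borel"
    unfolding E_def by (intro sets.Int sets_unit_slab measurable_sets_borel[OF measurable_slab_projection]) auto
  have sub: "box l' u' \<subseteq> E" "E \<subseteq> cbox l' u'"
    unfolding E_def by (auto simp: boxiff unit_slab_def mem_box_cart l'_def u'_def less_imp_le split: if_splits)
  have p: "(\<Prod>b\<in>Basis. (u' - l') \<bullet> b) = (\<Prod>b\<in>Basis. (u - l) \<bullet> b)"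
  proof -
    have "(\<Prod>b\<in>Basis. (u' - l') \<bullet> b) = (\<Prod>i\<in>UNIV. u' $ i - l' $ i)"
      by (simp add: prod_Basis_vec cart_eq_inner_axis inner_diff_left)
    also have "\<dots> = (\<Prod>i\<in>-K. u' $ i - l' $ i)"
      by (rule prod.mono_neutral_right) (auto simp: l'_def u'_def)
    also have "\<dots> = (\<Prod>i\<in>-K. (u - l) \<bullet> \<beta> i)"
      by (rule prod.cong) (auto simp: l'_def u'_def inner_diff_left)
    also have "\<dots> = (\<Prod>b\<in>Basis. (u - l) \<bullet> b)"
      by (rule prod.reindex_bij_betw[OF \<beta>])
    finally show ?thesis .
  qed
  have le'': "l' \<bullet> b \<le> u' \<bullet> b" if "b \<in> Basis" for b
    using that le' by (auto simp: Basis_vec_def cart_eq_inner_axis)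
  have "emeasure lborel (box l' u') = ennreal (\<Prod>b\<in>Basis. (u - l) \<bullet> b)"
    unfolding p[symmetric] by (rule emeasure_lborel_box) (rule le'')
  moreover have "emeasure lborel (cbox l' u') = ennreal (\<Prod>b\<in>Basis. (u - l) \<bullet> b)"
    unfolding p[symmetric] by (rule emeasure_lborel_cbox) (rule le'')
  ultimately have "emeasure lborel E = ennreal (\<Prod>b\<in>Basis. (u - l) \<bullet> b)"
    using emeasure_mono[OF sub(1), of lborel] emeasure_mono[OF sub(2), of lborel] by auto
  moreover have "emeasure (distr (restrict_space lborel (unit_slab K)) borel (slab_projection \<beta> K)) (box l u) = emeasure lborel E"
  proof -
    have "emeasure (distr (restrict_space lborel (unit_slab K)) borel (slab_projection \<beta> K)) (box l u)
      = emeasure (restrict_space lborel (unit_slab K)) (slab_projection \<beta> K -` box l u \<inter> space (restrict_space lborel (unit_slab K)))"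
      by (rule emeasure_distr) (auto intro!: measurable_restrict_space1)
    also have "slab_projection \<beta> K -` box l u \<inter> space (restrict_space lborel (unit_slab K)) = E"
      by (auto simp: E_def space_restrict_space)
    also have "emeasure (restrict_space lborel (unit_slab K)) E = emeasure lborel E"
      by (rule emeasure_restrict_space) (auto simp: E_def)
    finally show ?thesis .
  qed
  ultimately show "emeasure (distr (restrict_space lborel (unit_slab K)) borel (slab_projection \<beta> K)) (box l u)
      = ennreal (\<Prod>b\<in>Basis. (u - l) \<bullet> b)" by simp
qed simp

lemma measure_unit_slab_vimage:
  assumes \<beta>: "bij_betw \<beta> (-K) (Basis :: 'b::euclidean_space set)" and E: "E \<in> sets borel"
  shows "vol (unit_slab K \<inter> (slab_projection \<beta> K :: real ^ 'd::finite \<Rightarrow> 'b) -` E) = vol E"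
proof -
  have "vol E
     = measure (distr (restrict_space lborel (unit_slab K)) borel (slab_projection \<beta> K :: real ^ 'd \<Rightarrow> 'b)) E"
    by (simp flip: distr_slab_projection[OF \<beta>])
  also have "\<dots> = measure (restrict_space lborel (unit_slab K))
       ((slab_projection \<beta> K :: real ^ 'd \<Rightarrow> 'b) -` E \<inter> space (restrict_space lborel (unit_slab K)))"
    using E by (intro measure_distr) (auto intro!: measurable_restrict_space1)
  also have "(slab_projection \<beta> K :: real ^ 'd \<Rightarrow> 'b) -` E \<inter> space (restrict_space lborel (unit_slab K))
     = unit_slab K \<inter> (slab_projection \<beta> K) -` E"
    by (auto simp: space_restrict_space)
  also have "measure (restrict_space lborel (unit_slab K)) \<dots> = vol (unit_slab K \<inter> (slab_projection \<beta> K :: real ^ 'd \<Rightarrow> 'b) -` E)"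
    by (rule measure_restrict_space) auto
  finally show ?thesis by simp
qed

section \<open>Rounded boxes and their mixed differences\<close>

text \<open>
  The distance of \<open>u\<close> from the interval from 0 to \<open>s\<close>, for \<open>s \<ge> 0\<close>.
\<close>
definition interval_gap :: "real \<Rightarrow> real \<Rightarrow> real" where
  "interval_gap s u = max 0 (max (- u) (u - s))"

text \<open>
  The points at distance at most \<open>\<rho>\<close> from a box with side lengths \<open>\<tau>\<close>, where the
  directions in \<open>J\<close> count as infinitely long: a cylinder along \<open>J\<close>.
\<close>
definition rounded_box :: "('d \<Rightarrow> real) \<Rightarrow> 'd set \<Rightarrow> real \<Rightarrow> (real ^ 'd::finite) set" where
  "rounded_box \<tau> J \<rho> = {x. (\<Sum>i\<in>-J. (interval_gap (\<tau> i) (x $ i))\<^sup>2) \<le> \<rho>\<^sup>2}"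

text \<open>
  The positions, within one period along the cylinder directions \<open>J\<close>, at which some point of
  \<open>S\<close> falls into the body.
\<close>
definition slab_hits :: "('d \<Rightarrow> real) \<Rightarrow> 'd set \<Rightarrow> real \<Rightarrow> (real ^ 'd::finite) set \<Rightarrow> (real ^ 'd) set" where
  "slab_hits \<tau> J \<rho> S = unit_slab J \<inter> {z. \<exists>p\<in>S. z + p \<in> rounded_box \<tau> J \<rho>}"

lemma continuous_on_interval_gap [continuous_intros]:
  "continuous_on A f \<Longrightarrow> continuous_on A (\<lambda>x. interval_gap s (f x))"
  unfolding interval_gap_def by (intro continuous_intros)

lemma closed_rounded_box: "closed (rounded_box \<tau> J \<rho>)"
  unfolding rounded_box_def by (intro closed_Collect_le continuous_intros)

lemma sets_slab_hits [measurable]: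
  assumes "finite S" shows "slab_hits \<tau> J \<rho> S \<in> sets borel"
proof -
  have "{z. \<exists>p\<in>S. z + p \<in> rounded_box \<tau> J \<rho>} = (\<Union>p\<in>S. (\<lambda>z. z + p) -` rounded_box \<tau> J \<rho>)" by auto
  moreover have "closed ((\<lambda>z. z + p) -` rounded_box \<tau> J \<rho>)" for p
    by (intro continuous_closed_vimage closed_rounded_box) (auto intro: continuous_intros)
  ultimately have "closed {z. \<exists>p\<in>S. z + p \<in> rounded_box \<tau> J \<rho>}" using assms by auto
  then show ?thesis unfolding slab_hits_def by (intro sets.Int sets_unit_slab borel_closed)
qed

lemma interval_gap_bound: "\<bar>u\<bar> \<le> interval_gap s u + \<bar>s\<bar>"
  by (auto simp: interval_gap_def)

lemma rounded_box_gap_le: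
  assumes x: "x \<in> rounded_box \<tau> J \<rho>" and i: "i \<notin> J"
  shows "interval_gap (\<tau> i) (x $ i) \<le> \<bar>\<rho>\<bar>"
proof -
  have "(interval_gap (\<tau> i) (x $ i))\<^sup>2 \<le> (\<Sum>i\<in>-J. (interval_gap (\<tau> i) (x $ i))\<^sup>2)"
    using i by (intro member_le_sum) auto
  also have "\<dots> \<le> \<rho>\<^sup>2" using x by (simp add: rounded_box_def)
  finally show ?thesis using abs_le_square_iff[of "interval_gap (\<tau> i) (x $ i)" \<rho>]
    by (simp add: interval_gap_def)
qed

lemma bounded_cart_componentwise:
  fixes A :: "(real ^ 'd::finite) set"
  assumes "\<And>x i. x \<in> A \<Longrightarrow> \<bar>x $ i\<bar> \<le> C i"
  shows "bounded A"
proof -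
  have "norm x \<le> (\<Sum>i\<in>UNIV. C i)" if "x \<in> A" for x
    using norm_le_l1_cart[of x] sum_mono[of UNIV "\<lambda>i. \<bar>x $ i\<bar>" C] assms[OF that]
    by fastforce
  then show ?thesis by (auto simp: bounded_iff)
qed

lemma bounded_slab_hits:
  assumes "finite S" shows "bounded (slab_hits \<tau> J \<rho> S)"
proof (rule bounded_cart_componentwise)
  fix z i assume z: "z \<in> slab_hits \<tau> J \<rho> S"
  then obtain p where p: "p \<in> S" "z + p \<in> rounded_box \<tau> J \<rho>"
    by (auto simp: slab_hits_def)
  have m: "\<bar>p $ i\<bar> \<le> (\<Sum>p\<in>S. \<bar>p $ i\<bar>)" using p assms by (intro member_le_sum) auto
  show "\<bar>z $ i\<bar> \<le> 1 + \<bar>\<rho>\<bar> + \<bar>\<tau> i\<bar> + (\<Sum>p\<in>S. \<bar>p $ i\<bar>)"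
  proof (cases "i \<in> J")
    case True
    then show ?thesis using z m unfolding slab_hits_def unit_slab_def by force
  next
    case False
    then show ?thesis
      using rounded_box_gap_le[OF p(2) False] interval_gap_bound[of "z $ i + p $ i" "\<tau> i"] m by auto
  qed
qed

lemma emeasure_bounded_not_infinite:
  "bounded (A :: 'a::euclidean_space set) \<Longrightarrow> emeasure lborel A \<noteq> \<infinity>"
  using emeasure_bounded_finite[of A] by auto

lemma measure_lborel_translation:
  fixes A :: "'a::euclidean_space set"
  assumes A: "A \<in> sets borel" 
  shows "vol {z. z - v \<in> A} = vol A"
proof -
  have "vol A = measure (distr lborel borel ((+) (-v))) A"
    by (simp add: lborel_distr_plus)
  also have "\<dots> = vol {z. z - v \<in> A}"
    using A by (subst measure_distr) (auto simp: vimage_def)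
  finally show ?thesis by simp
qed

lemma measure_lborel_dilation:
  fixes A :: "'a::euclidean_space set"
  assumes A: "A \<in> sets borel" and \<rho>: "0 < \<rho>"
  shows "vol {x. (1 / \<rho>) *\<^sub>R (x - p) \<in> A} = \<rho> ^ DIM('a) * vol A"
proof -
  define E where "E = {x. (1 / \<rho>) *\<^sub>R (x - p) \<in> A}"
  define T where "T = (\<lambda>x. p + \<rho> *\<^sub>R x)"
  have "(\<lambda>x. (1 / \<rho>) *\<^sub>R (x - p)) -` A \<in> sets borel"
    by (rule measurable_sets_borel[OF _ A]) measurable
  then have [measurable]: "E \<in> sets borel" by (simp add: E_def vimage_def)
  have [measurable]: "T \<in> borel_measurable borel" unfolding T_def by measurable
  have vim: "T -` E = A" using \<rho> by (auto simp: E_def T_def)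
  have "lborel = density (distr lborel borel T) (\<lambda>_. ennreal (\<rho> ^ DIM('a)))"
    using lborel_affine[of \<rho> p] \<rho> by (simp add: T_def)
  then have "emeasure lborel E = emeasure (density (distr lborel borel T) (\<lambda>_. ennreal (\<rho> ^ DIM('a)))) E" by simp
  also have "\<dots> = ennreal (\<rho> ^ DIM('a)) * emeasure lborel A"
    by (simp add: emeasure_density nn_integral_cmult emeasure_distr vim)
  finally show ?thesis unfolding E_def[symmetric] using \<rho> by (simp add: measure_def enn2real_mult)
qed

text \<open>
  Cut at height \<open>m\<close> in direction \<open>i\<close>. Below the cut the longer box looks the same as the
  shorter one, and above height \<open>m + 1\<close> it is its translate by 1. In between the whole configuration
  stays between the two end faces, so that slab is one period of the cylinder.
\<close>
lemma slab_hits_cut: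
  fixes i :: "'d::finite"
  assumes S: "finite S" and i: "i \<notin> J" and m: "\<And>p. p \<in> S \<Longrightarrow> \<bar>p $ i\<bar> \<le> m" "0 \<le> m" "2 * m \<le> \<tau> i"
  shows "vol (slab_hits (\<tau>(i := \<tau> i + 1)) J \<rho> S)
       = vol (slab_hits \<tau> J \<rho> S) + vol (slab_hits \<tau> (insert i J) \<rho> S)"
proof -
  let ?A = "slab_hits (\<tau>(i := \<tau> i + 1)) J \<rho> S" and ?B = "slab_hits \<tau> J \<rho> S"
    and ?C = "slab_hits \<tau> (insert i J) \<rho> S"
  define e where "e = (axis i 1 :: real ^ 'd)"
  have ei: "e $ j = (if j = i then 1 else 0)" for j by (simp add: e_def axis_def)
  define L where "L c = {z :: real ^ 'd. z $ i < c}" for c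
  have L[measurable]: "L c \<in> sets borel" for c
    unfolding L_def by (intro borel_open open_Collect_less continuous_intros)
  note [measurable] = sets_slab_hits[OF S]
  have mem: "x \<in> rounded_box \<sigma> J \<rho> \<longleftrightarrow> (interval_gap (\<sigma> i) (x $ i))\<^sup>2 + (\<Sum>j\<in>-insert i J. (interval_gap (\<sigma> j) (x $ j))\<^sup>2) \<le> \<rho>\<^sup>2" for x \<sigma>
  proof -
    have "- J = insert i (- insert i J)" using i by auto
    then show ?thesis unfolding rounded_box_def mem_Collect_eq
      by (metis (no_types, lifting) ComplD finite_class.finite_code insertI1 sum.insert)
  qed
  have rest: "(\<Sum>j\<in>-insert i J. (interval_gap ((\<tau>(i := c)) j) (x $ j))\<^sup>2)
      = (\<Sum>j\<in>-insert i J. (interval_gap (\<tau> j) (x $ j))\<^sup>2)" for x :: "real ^ 'd" and c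
    by (rule sum.cong) auto
  have rest_e: "(\<Sum>j\<in>-insert i J. (interval_gap (\<tau> j) (((x :: real ^ 'd) - c *\<^sub>R e) $ j))\<^sup>2)
      = (\<Sum>j\<in>-insert i J. (interval_gap (\<tau> j) (x $ j))\<^sup>2)" for x :: "real ^ 'd" and c
    by (rule sum.cong) (auto simp: ei)
  have slab_e: "z - c *\<^sub>R e \<in> unit_slab J \<longleftrightarrow> z \<in> unit_slab J" for z c
    using i by (auto simp: unit_slab_def ei)
  have 1: "?A \<inter> L m = ?B \<inter> L m"
  proof -
    have "z + p \<in> rounded_box (\<tau>(i := \<tau> i + 1)) J \<rho> \<longleftrightarrow> z + p \<in> rounded_box \<tau> J \<rho>"
      if "z \<in> L m" "p \<in> S" for z p
    proof -
      have "interval_gap (\<tau> i + 1) (z $ i + p $ i) = interval_gap (\<tau> i) (z $ i + p $ i)"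
        using that m(1)[of p] m(2,3) by (auto simp: interval_gap_def L_def)
      then show ?thesis unfolding mem rest by simp
    qed
    then show ?thesis unfolding slab_hits_def by auto
  qed
  have 2: "?A \<inter> (L (m + 1) - L m) = {z. z - m *\<^sub>R e \<in> ?C}"
  proof -
    have "z + p \<in> rounded_box (\<tau>(i := \<tau> i + 1)) J \<rho> \<longleftrightarrow> z - m *\<^sub>R e + p \<in> rounded_box \<tau> (insert i J) \<rho>"
      if "z \<in> L (m + 1) - L m" "p \<in> S" for z p
    proof -
      have "interval_gap (\<tau> i + 1) (z $ i + p $ i) = 0"
        using that m(1)[of p] m(2,3) by (auto simp: interval_gap_def L_def)
      then show ?thesis unfolding mem rest using rest_e[of "z + p" m]
        by (simp add: rounded_box_def algebra_simps)
    qed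
    moreover have "z \<in> L (m + 1) - L m \<and> z \<in> unit_slab J \<longleftrightarrow> z - m *\<^sub>R e \<in> unit_slab (insert i J)" for z
      using i by (auto simp: unit_slab_def L_def ei split: if_splits)
    ultimately show ?thesis unfolding slab_hits_def by blast
  qed
  have 3: "?A - L (m + 1) = {z. z - 1 *\<^sub>R e \<in> ?B - L m}"
  proof -
    have "z + p \<in> rounded_box (\<tau>(i := \<tau> i + 1)) J \<rho> \<longleftrightarrow> z - 1 *\<^sub>R e + p \<in> rounded_box \<tau> J \<rho>"
      if "z \<notin> L (m + 1)" "p \<in> S" for z p
    proof -
      have "interval_gap (\<tau> i + 1) (z $ i + p $ i) = interval_gap (\<tau> i) (z $ i - 1 + p $ i)"
        using that m(1)[of p] m(2,3) by (auto simp: interval_gap_def L_def)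
      then show ?thesis unfolding mem rest using rest_e[of "z + p" 1]
        by (simp add: ei algebra_simps)
    qed
    moreover have "z \<notin> L (m + 1) \<longleftrightarrow> z - 1 *\<^sub>R e \<notin> L m" for z
      by (auto simp: L_def ei)
    moreover have "z - 1 *\<^sub>R e \<in> unit_slab J \<longleftrightarrow> z \<in> unit_slab J" for z by (rule slab_e)
    ultimately show ?thesis unfolding slab_hits_def by blast
  qed
  have fin: "emeasure lborel (slab_hits \<sigma> J' \<rho> S \<inter> X) \<noteq> \<infinity>" "emeasure lborel (slab_hits \<sigma> J' \<rho> S - X) \<noteq> \<infinity>" 
    for \<sigma> J' X
    using bounded_slab_hits[OF S, of \<sigma> J' \<rho>]
    by (auto intro!: emeasure_bounded_not_infinite elim!: bounded_subset simp del: infinity_ennreal_def)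
  have split: "vol (slab_hits \<sigma> J' \<rho> S) =
     vol (slab_hits \<sigma> J' \<rho> S \<inter> L c) + vol (slab_hits \<sigma> J' \<rho> S - L c)" for \<sigma> J' c
  proof -
    have "slab_hits \<sigma> J' \<rho> S = (slab_hits \<sigma> J' \<rho> S \<inter> L c) \<union> (slab_hits \<sigma> J' \<rho> S - L c)" by auto
    also have "vol \<dots> = vol (slab_hits \<sigma> J' \<rho> S \<inter> L c) + vol (slab_hits \<sigma> J' \<rho> S - L c)"
      by (rule measure_Union) (use fin in auto)
    finally show ?thesis .
  qed
  have "?A \<inter> L (m + 1) = (?A \<inter> L m) \<union> (?A \<inter> (L (m + 1) - L m))" by (auto simp: L_def)
  also have "vol \<dots> = vol (?A \<inter> L m) + vol (?A \<inter> (L (m + 1) - L m))"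
    by (rule measure_Union) (use fin in auto)
  finally have "vol ?A = vol (?B \<inter> L m) + vol ?C + vol (?B - L m)"
    using split[of "\<tau>(i := \<tau> i + 1)" J "m + 1"] measure_lborel_translation[of ?C "m *\<^sub>R e"]
      measure_lborel_translation[of "?B - L m" "1 *\<^sub>R e"] unfolding 1 2 3
    by simp
  then show ?thesis using split[of \<tau> J m] by simp
qed

text \<open>
  Iterates the recursion of \<open>slab_hits_cut\<close> over all directions of \<open>K\<close>; only the term in
  which every direction has become a cylinder direction survives.
\<close>
lemma mixed_difference_of_additive:
  fixes H :: "('d \<Rightarrow> real) \<Rightarrow> 'd set \<Rightarrow> real"
  assumes step: "\<And>\<tau> J i. i \<notin> J \<Longrightarrow> c \<le> \<tau> i \<Longrightarrow> H (\<tau>(i := \<tau> i + 1)) J = H \<tau> J + H \<tau> (insert i J)"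
    and indep: "\<And>\<tau> J i v. i \<in> J \<Longrightarrow> H (\<tau>(i := v)) J = H \<tau> J"
  assumes "finite K" "K \<inter> J = {}" "\<And>i. i \<in> K \<Longrightarrow> c \<le> \<tau> i"
  shows "(\<Sum>A\<in>Pow K. (-1) ^ card (K - A) * H (\<lambda>i. if i \<in> A then \<tau> i + 1 else \<tau> i) J) = H \<tau> (J \<union> K)"
  using assms(3-)
proof (induction K arbitrary: \<tau> J)
  case empty
  then show ?case by simp
next
  case (insert k K)
  let ?f = "\<lambda>\<tau> A. H (\<lambda>i. if i \<in> A then \<tau> i + 1 else \<tau> i) J"
  have "(\<Sum>A\<in>Pow (insert k K). (-1) ^ card (insert k K - A) * ?f \<tau> A)
     = (\<Sum>A\<in>Pow K. (-1) ^ card (insert k K - A) * ?f \<tau> A)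
       + (\<Sum>A\<in>insert k ` Pow K. (-1) ^ card (insert k K - A) * ?f \<tau> A)"
    unfolding Pow_insert using insert.hyps by (intro sum.union_disjoint) auto
  also have "(\<Sum>A\<in>Pow K. (-1) ^ card (insert k K - A) * ?f \<tau> A)
      = - (\<Sum>A\<in>Pow K. (-1) ^ card (K - A) * ?f \<tau> A)"
    unfolding sum_negf[symmetric]
  proof (rule sum.cong[OF refl])
    fix A assume "A \<in> Pow K"
    then have "insert k K - A = insert k (K - A)" using insert.hyps by auto
    then show "(-1) ^ card (insert k K - A) * ?f \<tau> A = - ((-1) ^ card (K - A) * ?f \<tau> A)"
      using insert.hyps by simp
  qed
  also have "\<dots> = - H \<tau> (J \<union> K)" using insert by simp
  also have "(\<Sum>A\<in>insert k ` Pow K. (-1) ^ card (insert k K - A) * ?f \<tau> A)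
      = (\<Sum>A\<in>Pow K. (-1) ^ card (K - A) * ?f (\<tau>(k := \<tau> k + 1)) A)"
  proof (subst sum.reindex)
    show "inj_on (insert k) (Pow K)"
      using insert.hyps by (auto simp: inj_on_def)
    have "insert k K - insert k A = K - A" for A using insert.hyps by auto
    moreover have "(\<lambda>i. if i \<in> insert k A then \<tau> i + 1 else \<tau> i)
       = (\<lambda>i. if i \<in> A then (\<tau>(k := \<tau> k + 1)) i + 1 else (\<tau>(k := \<tau> k + 1)) i)" if "A \<in> Pow K" for A
      using that insert.hyps by (auto simp: fun_eq_iff)
    ultimately show "sum ((\<lambda>A. (-1) ^ card (insert k K - A) * ?f \<tau> A) \<circ> insert k) (Pow K)
       = (\<Sum>A\<in>Pow K. (-1) ^ card (K - A) * ?f (\<tau>(k := \<tau> k + 1)) A)"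
      by (intro sum.cong) (simp_all only: o_def)
  qed
  also have "\<dots> = H (\<tau>(k := \<tau> k + 1)) (J \<union> K)"
    using insert by (intro insert.IH) auto
  also have "H (\<tau>(k := \<tau> k + 1)) (J \<union> K) = H \<tau> (J \<union> K) + H \<tau> (insert k (J \<union> K))"
    using insert by (intro step) auto
  finally show ?case by simp
qed

lemma slab_hits_upd_inside:
  assumes "i \<in> J" shows "slab_hits (\<tau>(i := v)) J \<rho> S = slab_hits \<tau> J \<rho> S"
proof -
  have "rounded_box (\<tau>(i := v)) J \<rho> = rounded_box \<tau> J \<rho>"
    unfolding rounded_box_def using assms
    by (intro Collect_cong arg_cong2[where f = "(\<le>)"] sum.cong refl) auto
  then show ?thesis by (simp add: slab_hits_def)
qed

text \<open>
  If the box has no finite extension left, the body is a cylinder over a ball of dimension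
  \<open>CARD('d) - card K\<close>.
\<close>
lemma slab_hits_flat:
  fixes \<beta> :: "'d::finite \<Rightarrow> 'b::euclidean_space"
  assumes \<beta>: "bij_betw \<beta> (-K) Basis" and \<tau>: "\<And>i. i \<notin> K \<Longrightarrow> \<tau> i = 0" and \<rho>: "0 \<le> \<rho>"
  shows "slab_hits \<tau> K \<rho> S = unit_slab K \<inter> slab_projection \<beta> K -` (\<Union>p\<in>S. cball (- slab_projection \<beta> K p) \<rho>)"
proof -
  have "x \<in> rounded_box \<tau> K \<rho> \<longleftrightarrow> norm (slab_projection \<beta> K x) \<le> \<rho>" for x
  proof -
    have "(\<Sum>i\<in>-K. (interval_gap (\<tau> i) (x $ i))\<^sup>2) = (\<Sum>i\<in>-K. (x $ i)\<^sup>2)"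
      using \<tau> by (intro sum.cong) (auto simp: interval_gap_def max_def)
    then show ?thesis
      using \<rho> by (simp add: rounded_box_def norm_slab_projection[OF \<beta>, symmetric] abs_le_square_iff[symmetric])
  qed
  then show ?thesis
    unfolding slab_hits_def
    by (auto simp: linear_add[OF linear_slab_projection] dist_norm norm_minus_commute[of "- _"] add.commute)
qed

text \<open>
  The bound on \<open>S\<close> keeps the configuration, placed in the middle of a side of length at least 1, away
  from both ends of that side.
\<close>
lemma mixed_difference_hits:
  fixes \<beta> :: "'d::finite \<Rightarrow> 'b::euclidean_space" and K :: "'d set"
  assumes \<beta>: "bij_betw \<beta> (-K) Basis" and S: "finite S" and small: "\<And>p. p \<in> S \<Longrightarrow> norm p \<le> 1 / 2"
    and \<rho>: "0 \<le> \<rho>"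
  defines "\<tau> A \<equiv> (\<lambda>i. if i \<in> A then 2 else if i \<in> K then 1 else 0)"
  shows "(\<Sum>A\<in>Pow K. (-1) ^ card (K - A) * vol (slab_hits (\<tau> A) {} \<rho> S))
    = vol (\<Union>p\<in>S. cball (- slab_projection \<beta> K p) \<rho>)"
proof -
  let ?H = "\<lambda>\<tau> J. vol (slab_hits \<tau> J \<rho> S)"
  have sm: "\<bar>p $ i\<bar> \<le> 1 / 2" if "p \<in> S" for p i
    using component_le_norm_cart[of p i] small[OF that] by linarith
  have "(\<Sum>A\<in>Pow K. (-1) ^ card (K - A) * ?H (\<tau> A) {})
      = (\<Sum>A\<in>Pow K. (-1) ^ card (K - A) * ?H (\<lambda>i. if i \<in> A then \<tau> {} i + 1 else \<tau> {} i) {})"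
  proof (rule sum.cong[OF refl])
    fix A assume "A \<in> Pow K"
    then have "\<tau> A = (\<lambda>i. if i \<in> A then \<tau> {} i + 1 else \<tau> {} i)" by (auto simp: \<tau>_def fun_eq_iff)
    then show "(-1) ^ card (K - A) * ?H (\<tau> A) {} = (-1) ^ card (K - A) * ?H (\<lambda>i. if i \<in> A then \<tau> {} i + 1 else \<tau> {} i) {}" by simp
  qed
  also have "\<dots> = ?H (\<tau> {}) ({} \<union> K)"
  proof (rule mixed_difference_of_additive[where c = 1])
    fix \<sigma> :: "'d \<Rightarrow> real" and J i assume "i \<notin> J" "1 \<le> \<sigma> i"
    then show "?H (\<sigma>(i := \<sigma> i + 1)) J = ?H \<sigma> J + ?H \<sigma> (insert i J)"
      using sm by (intro slab_hits_cut[where m = "1 / 2"] S) auto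
  next
    fix \<sigma> :: "'d \<Rightarrow> real" and J :: "'d set" and i v assume "i \<in> J"
    then show "?H (\<sigma>(i := v)) J = ?H \<sigma> J" by (simp only: slab_hits_upd_inside)
  qed (auto simp: \<tau>_def)
  also have "\<dots> = vol (unit_slab K \<inter> slab_projection \<beta> K -` (\<Union>p\<in>S. cball (- slab_projection \<beta> K p) \<rho>))"
    using slab_hits_flat[OF \<beta>, of "\<tau> {}" \<rho> S] \<rho> by (simp add: \<tau>_def)
  also have "\<dots> = vol (\<Union>p\<in>S. cball (- slab_projection \<beta> K p) \<rho>)"
    using S by (intro measure_unit_slab_vimage[OF \<beta>] borel_closed closed_UN) auto
  finally show ?thesis .
qed

section \<open>Rounded boxes: regularity and intrinsic volumes\<close>

lemma measure_lebesgue_compact: "compact A \<Longrightarrow> measure lebesgue A = vol (A :: 'a::euclidean_space set)"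
  by (intro measure_completion) (simp add: borel_compact)

lemma convex_set_sums: "convex S \<Longrightarrow> convex T \<Longrightarrow> convex {x + y | x y. x \<in> S \<and> y \<in> T}"
proof -
  assume "convex S" "convex T"
  moreover have "{x + y | x y. x \<in> S \<and> y \<in> T} = (\<Union>x\<in>S. \<Union>y\<in>T. {x + y})" by blast
  ultimately show ?thesis by (simp add: convex_sums)
qed

text \<open>
  The inner ball is the one that was added to the point of \<open>P\<close>; the outer one touches a supporting
  hyperplane from the other side.
\<close>
lemma parallel_body_r_regular:
  fixes P :: "(real ^ 'd::finite) set"
  assumes "compact P" "convex P" "0 < r"
  shows "{p + b | p b. p \<in> P \<and> b \<in> cball 0 r} \<in> r_regular_sets"
proof -
  let ?X = "{p + b | p b. p \<in> P \<and> b \<in> cball 0 r}"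
  have cpt: "compact ?X" using assms by (intro compact_sums) auto
  have conv: "convex ?X" using assms by (intro convex_set_sums) auto
  have inner: "cball p r \<subseteq> ?X" if "p \<in> P" for p
  proof
    fix y assume "y \<in> cball p r"
    then have "y = p + (y - p)" "y - p \<in> cball 0 r" by (auto simp: dist_norm norm_minus_commute)
    then show "y \<in> ?X" using that by blast
  qed
  have "r_regular r ?X" unfolding r_regular_def
  proof
    fix x assume x: "x \<in> frontier ?X"
    have "frontier ?X \<subseteq> ?X" using cpt by (intro frontier_subset_closed compact_imp_closed)
    with x have "x \<in> ?X" by (rule subsetD[rotated])
    then obtain p b where pb: "x = p + b" "p \<in> P" "b \<in> cball 0 r" by blast
    have "ball p r \<subseteq> ?X" using inner[OF pb(2)] ball_subset_cball by blast
    then have "ball p r \<subseteq> interior ?X" by (rule interior_maximal) simp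
    moreover have "p \<in> ball p r" using \<open>0 < r\<close> by simp
    ultimately have "interior ?X \<noteq> {}" by (metis subsetD empty_iff)
    then have "rel_interior ?X = interior ?X" by (rule rel_interior_nonempty_interior)
    then have "x \<in> closure ?X" "x \<notin> rel_interior ?X" using x unfolding frontier_def by simp_all
    then obtain a where a: "a \<noteq> 0" "\<And>y. y \<in> closure ?X \<Longrightarrow> a \<bullet> x \<le> a \<bullet> y"
      by (rule supporting_hyperplane_relative_frontier[OF conv]) (rule that)
    \<comment> \<open>The centre of the outer ball.\<close>
    define c where "c = x - (r / norm a) *\<^sub>R a"
    have "ball c r \<subseteq> - ?X"
    proof
      fix y assume y: "y \<in> ball c r"
      have "a \<bullet> (y - c) \<le> norm a * norm (y - c)" by (rule norm_cauchy_schwarz)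
      also have "\<dots> < norm a * r"
        using y a(1) by (simp add: dist_norm norm_minus_commute)
      finally have "a \<bullet> y < a \<bullet> c + norm a * r" by (simp add: inner_diff_right)
      also have "a \<bullet> c = a \<bullet> x - norm a * r"
        using a(1) by (simp add: c_def inner_diff_right dot_square_norm power2_eq_square)
      finally have "a \<bullet> y < a \<bullet> x" by simp
      then have "y \<notin> closure ?X" using a(2)[of y] by linarith
      then show "y \<in> - ?X" unfolding Compl_iff by (rule contra_subsetD[OF closure_subset])
    qed
    moreover have "x \<in> cball c r"
    proof -
      have "c - x = - ((r / norm a) *\<^sub>R a)" by (simp add: c_def)
      then have "dist c x = r" using a(1) \<open>0 < r\<close> by (simp only: dist_norm norm_minus_cancel norm_scaleR) simp
      then show ?thesis by simp
    qed
    moreover have "x \<in> cball p r"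
    proof -
      have "dist p x = norm b" unfolding pb(1) by (simp add: dist_norm)
      then show ?thesis using pb(3) by simp
    qed
    ultimately show "\<exists>p1 p2. x \<in> cball p1 r \<and> x \<in> cball p2 r \<and> cball p1 r \<subseteq> ?X \<and> interior (cball p2 r) \<subseteq> - ?X"
      using inner[OF pb(2)] unfolding interior_cball by (intro exI[of _ p] exI[of _ c] conjI)
  qed
  then show ?thesis unfolding r_regular_sets_def
    by (intro CollectI conjI exI[of _ r] cpt \<open>0 < r\<close>)
qed

definition coordinate_box :: "('d \<Rightarrow> real) \<Rightarrow> (real ^ 'd::finite) set" where
  "coordinate_box \<tau> = {x. \<forall>i. 0 \<le> x $ i \<and> x $ i \<le> \<tau> i}"

lemma coordinate_box_eq_cbox: "coordinate_box \<tau> = cbox 0 (\<chi> i. \<tau> i)"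
  by (auto simp: coordinate_box_def mem_box_cart)

lemma norm_cart_le_iff: "0 \<le> \<rho> \<Longrightarrow> norm (x :: real ^ 'd::finite) \<le> \<rho> \<longleftrightarrow> (\<Sum>i\<in>UNIV. (x $ i)\<^sup>2) \<le> \<rho>\<^sup>2"
  using abs_le_square_iff[of "norm x" \<rho>] by (simp add: power2_norm_eq_inner inner_vec_def power2_eq_square[of "_ $ _"])

lemma rounded_box_eq_parallel_body:
  assumes \<tau>: "\<And>i. 0 \<le> \<tau> i" and \<rho>: "0 \<le> \<rho>"
  shows "rounded_box \<tau> {} \<rho> = {p + b | p b. p \<in> coordinate_box \<tau> \<and> b \<in> cball 0 \<rho>}"
proof (intro equalityI subsetI)
  fix x assume x: "x \<in> rounded_box \<tau> {} \<rho>"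
  define p where "p = (\<chi> i. max 0 (min (\<tau> i) (x $ i)))"
  have "p \<in> coordinate_box \<tau>" using \<tau> by (auto simp: p_def coordinate_box_def)
  moreover have "(\<Sum>i\<in>UNIV. ((x - p) $ i)\<^sup>2) = (\<Sum>i\<in>UNIV. (interval_gap (\<tau> i) (x $ i))\<^sup>2)"
  proof (rule sum.cong[OF refl])
    fix i
    show "((x - p) $ i)\<^sup>2 = (interval_gap (\<tau> i) (x $ i))\<^sup>2"
      using \<tau>[of i] by (auto simp: p_def interval_gap_def max_def min_def)
  qed
  then have "x - p \<in> cball 0 \<rho>" using x \<rho> by (simp add: norm_cart_le_iff rounded_box_def)
  moreover have "x = p + (x - p)" by simp
  ultimately show "x \<in> {p + b | p b. p \<in> coordinate_box \<tau> \<and> b \<in> cball 0 \<rho>}" by blast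
next
  fix x assume "x \<in> {p + b | p b. p \<in> coordinate_box \<tau> \<and> b \<in> cball 0 \<rho>}"
  then obtain p b where x: "x = p + b" "p \<in> coordinate_box \<tau>" "norm b \<le> \<rho>" by auto
  have "(\<Sum>i\<in>UNIV. (interval_gap (\<tau> i) (x $ i))\<^sup>2) \<le> (\<Sum>i\<in>UNIV. (b $ i)\<^sup>2)"
  proof (rule sum_mono)
    fix i
    have "0 \<le> p $ i" "p $ i \<le> \<tau> i" using x(2) by (auto simp: coordinate_box_def)
    then have "\<bar>interval_gap (\<tau> i) (x $ i)\<bar> \<le> \<bar>b $ i\<bar>" using x(1) by (auto simp: interval_gap_def)
    then show "(interval_gap (\<tau> i) (x $ i))\<^sup>2 \<le> (b $ i)\<^sup>2" by (simp add: abs_le_square_iff)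
  qed
  also have "\<dots> \<le> \<rho>\<^sup>2" using x(3) \<rho> by (simp add: norm_cart_le_iff[symmetric])
  finally show "x \<in> rounded_box \<tau> {} \<rho>" by (simp add: rounded_box_def)
qed

lemma rounded_box_parallel:
  assumes \<tau>: "\<And>i. 0 \<le> \<tau> i" and \<rho>: "0 \<le> \<rho>" "0 \<le> s"
  shows "{x + y | x y. x \<in> rounded_box \<tau> {} \<rho> \<and> y \<in> cball 0 s} = rounded_box \<tau> {} (\<rho> + s)"
proof (intro equalityI subsetI)
  fix z assume "z \<in> {x + y | x y. x \<in> rounded_box \<tau> {} \<rho> \<and> y \<in> cball 0 s}"
  then obtain p b y where "z = p + (b + y)" "p \<in> coordinate_box \<tau>" "norm b \<le> \<rho>" "norm y \<le> s"
    unfolding rounded_box_eq_parallel_body[OF assms(1,2)] by (auto simp: add.assoc)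
  moreover have "norm (b + y) \<le> \<rho> + s" using norm_triangle_ineq[of b y] \<open>norm b \<le> \<rho>\<close> \<open>norm y \<le> s\<close> by linarith
  ultimately show "z \<in> rounded_box \<tau> {} (\<rho> + s)"
    using rounded_box_eq_parallel_body[of \<tau> "\<rho> + s"] assms by auto
next
  fix z assume "z \<in> rounded_box \<tau> {} (\<rho> + s)"
  then obtain p b where z: "z = p + b" "p \<in> coordinate_box \<tau>" "norm b \<le> \<rho> + s"
    using rounded_box_eq_parallel_body[of \<tau> "\<rho> + s"] assms by auto
  have "\<exists>u v. b = u + v \<and> norm u \<le> \<rho> \<and> norm v \<le> s"
  proof (cases "\<rho> + s = 0")
    case True
    then have "\<rho> = 0" "s = 0" "b = 0" using z \<rho> by auto
    then show ?thesis by (intro exI[of _ 0]) auto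
  next
    case False
    then have "\<rho> + s > 0" using \<rho> by auto
    then have "norm ((\<rho> / (\<rho> + s)) *\<^sub>R b) \<le> \<rho>" "norm ((s / (\<rho> + s)) *\<^sub>R b) \<le> s"
      using z(3) \<rho> mult_left_mono[OF z(3), of \<rho>] mult_left_mono[OF z(3), of s] by (auto simp: divide_le_eq)
    moreover have "b = (\<rho> / (\<rho> + s)) *\<^sub>R b + (s / (\<rho> + s)) *\<^sub>R b"
      using \<open>\<rho> + s > 0\<close> by (simp add: scaleR_add_left[symmetric] add_divide_distrib[symmetric] del: scaleR_left_distrib)
    ultimately show ?thesis by blast
  qed
  then obtain u v where "b = u + v" "norm u \<le> \<rho>" "norm v \<le> s" by blast
  then have "p + u \<in> rounded_box \<tau> {} \<rho>" "z = (p + u) + v" "v \<in> cball 0 s"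
    unfolding rounded_box_eq_parallel_body[OF assms(1,2)] using z by auto
  then show "z \<in> {x + y | x y. x \<in> rounded_box \<tau> {} \<rho> \<and> y \<in> cball 0 s}" by blast
qed

lemma slab_hits_origin: "slab_hits \<tau> {} \<rho> {0} = rounded_box \<tau> {} \<rho>"
  by (auto simp: slab_hits_def unit_slab_def)

lemma compact_rounded_box: "compact (rounded_box \<tau> {} \<rho>)"
  using closed_rounded_box[of \<tau> "{}" \<rho>] bounded_slab_hits[of "{0}" \<tau> "{}" \<rho>]
  by (simp add: slab_hits_origin compact_eq_bounded_closed)

lemma measure_slab_hits_scaling:
  fixes J :: "'d::finite set"
  assumes "0 < \<rho>" and \<tau>: "\<And>i. i \<notin> J \<Longrightarrow> \<tau> i = 0"
  shows "vol (slab_hits \<tau> J \<rho> {0}) = \<rho> ^ card (- J) * vol (slab_hits \<tau> J 1 {0})"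
proof -
  define c where "c = (\<lambda>b :: real ^ 'd. if \<exists>i\<in>J. b = axis i 1 then 1 else \<rho>)"
  define T where "T = (\<lambda>x :: real ^ 'd. 0 + (\<Sum>b\<in>Basis. (c b * (x \<bullet> b)) *\<^sub>R b))"
  have c_axis: "c (axis i 1) = (if i \<in> J then 1 else \<rho>)" for i
    by (auto simp: c_def axis_eq_axis)
  have T_nth: "T x $ i = (if i \<in> J then 1 else \<rho>) * x $ i" for x i
  proof -
    have "T x $ i = T x \<bullet> axis i 1" by (simp add: cart_eq_inner_axis)
    also have "\<dots> = c (axis i 1) * (x \<bullet> axis i 1)"
      unfolding T_def by (simp add: inner_sum_left inner_Basis if_distrib sum.If_cases axis_in_Basis_iff cong: if_cong)
    finally show ?thesis by (simp add: c_axis cart_eq_inner_axis)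
  qed
  have [measurable]: "T \<in> borel_measurable borel" unfolding T_def by simp
  note [measurable] = sets_slab_hits[of "{0}", simplified]
  have cpos: "c b > 0" for b using \<open>0 < \<rho>\<close> by (simp add: c_def)
  have "(\<Sum>i\<in>-J. (interval_gap (\<tau> i) (T x $ i))\<^sup>2) = \<rho>\<^sup>2 * (\<Sum>i\<in>-J. (interval_gap (\<tau> i) (x $ i))\<^sup>2)" for x
    unfolding sum_distrib_left
  proof (rule sum.cong[OF refl])
    fix i assume "i \<in> -J"
    then show "(interval_gap (\<tau> i) (T x $ i))\<^sup>2 = \<rho>\<^sup>2 * (interval_gap (\<tau> i) (x $ i))\<^sup>2"
      using \<tau>[of i] by (auto simp: T_nth interval_gap_def max_def power_mult_distrib)
  qed
  then have "T x \<in> rounded_box \<tau> J \<rho> \<longleftrightarrow> x \<in> rounded_box \<tau> J 1" for x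
    using \<open>0 < \<rho>\<close> by (simp add: rounded_box_def)
  moreover have "T x \<in> unit_slab J \<longleftrightarrow> x \<in> unit_slab J" for x
    by (auto simp: unit_slab_def T_nth)
  ultimately have vim: "T -` slab_hits \<tau> J \<rho> {0} = slab_hits \<tau> J 1 {0}"
    by (auto simp: slab_hits_def)
  have prod: "(\<Prod>b\<in>Basis. \<bar>c b\<bar>) = \<rho> ^ card (- J)"
  proof -
    have "(\<Prod>b\<in>Basis. \<bar>c b\<bar>) = (\<Prod>i\<in>UNIV. if i \<in> J then 1 else \<rho>)"
      unfolding prod_Basis_vec using \<open>0 < \<rho>\<close> by (intro prod.cong) (auto simp: c_axis)
    also have "\<dots> = \<rho> ^ card (- J)"
      by (simp add: prod.If_cases Compl_eq)
    finally show ?thesis .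
  qed
  have "lborel = density (distr lborel borel T) (\<lambda>_. ennreal (\<Prod>b\<in>Basis. \<bar>c b\<bar>))"
    unfolding T_def by (rule lborel_affine_euclidean) (use cpos in \<open>auto simp: less_imp_neq\<close>, metis less_irrefl)
  then have "emeasure lborel (slab_hits \<tau> J \<rho> {0})
     = emeasure (density (distr lborel borel T) (\<lambda>_. ennreal (\<Prod>b\<in>Basis. \<bar>c b\<bar>))) (slab_hits \<tau> J \<rho> {0})" by simp
  also have "\<dots> = ennreal (\<rho> ^ card (- J)) * emeasure lborel (slab_hits \<tau> J 1 {0})"
    by (simp add: emeasure_density nn_integral_cmult prod emeasure_distr vim)
  finally show ?thesis using \<open>0 < \<rho>\<close> by (simp add: measure_def enn2real_mult)
qed

text \<open>
  The recursion of \<open>slab_hits_cut\<close> shortens sides down to 0. What remains scales as a power of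
  \<open>\<rho>\<close>.
\<close>
lemma measure_slab_hits_polynomial:
  fixes t :: "'d::finite \<Rightarrow> nat"
  shows "\<exists>p. degree p \<le> CARD('d) \<and> (\<forall>\<rho>>0. vol (slab_hits (\<lambda>i. real (t i)) J \<rho> {0}) = poly p \<rho>)"
proof (induction "\<Sum>i\<in>-J. t i" arbitrary: t J rule: less_induct)
  case less
  show ?case
  proof (cases "\<forall>i\<in>-J. t i = 0")
    case True
    let ?p = "monom (vol (slab_hits (\<lambda>i. real (t i)) J 1 {0})) (card (- J))"
    have "degree ?p \<le> CARD('d)"
      using degree_monom_le card_mono[of UNIV "-J"] by (metis finite_class.finite_UNIV le_trans top_greatest)
    moreover have "vol (slab_hits (\<lambda>i. real (t i)) J \<rho> {0}) = poly ?p \<rho>" if "\<rho> > 0" for \<rho>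
      using measure_slab_hits_scaling[OF that, of J "\<lambda>i. real (t i)"] True by (simp add: poly_monom mult.commute)
    ultimately show ?thesis by blast
  next
    case False
    then obtain i where i: "i \<notin> J" "t i > 0" by auto
    define t' where "t' = t(i := t i - 1)"
    have cmpl: "- J = insert i (- insert i J)" using i by auto
    have "(\<Sum>j\<in>-J. t j) = t i + (\<Sum>j\<in>- insert i J. t j)" by (subst cmpl) simp
    moreover have "(\<Sum>j\<in>-J. t' j) = t' i + (\<Sum>j\<in>- insert i J. t' j)" by (subst cmpl) simp
    moreover have "(\<Sum>j\<in>- insert i J. t' j) = (\<Sum>j\<in>- insert i J. t j)"
      by (rule sum.cong) (auto simp: t'_def)
    ultimately have "(\<Sum>j\<in>-J. t' j) < (\<Sum>j\<in>-J. t j)" "(\<Sum>j\<in>- insert i J. t' j) < (\<Sum>j\<in>-J. t j)"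
      using i by (auto simp: t'_def)
    with less obtain p p' where p: "degree p \<le> CARD('d)" "\<And>\<rho>. \<rho> > 0 \<Longrightarrow> vol (slab_hits (\<lambda>i. real (t' i)) J \<rho> {0}) = poly p \<rho>"
      and p': "degree p' \<le> CARD('d)" "\<And>\<rho>. \<rho> > 0 \<Longrightarrow> vol (slab_hits (\<lambda>i. real (t' i)) (insert i J) \<rho> {0}) = poly p' \<rho>"
      by metis
    have t: "(\<lambda>i. real (t i)) = (\<lambda>i. real (t' i))(i := real (t' i) + 1)"
      using i by (auto simp: t'_def fun_eq_iff)
    have "vol (slab_hits (\<lambda>i. real (t i)) J \<rho> {0}) = poly (p + p') \<rho>" if "\<rho> > 0" for \<rho>
      unfolding t using slab_hits_cut[of "{0}" i J 0 "\<lambda>i. real (t' i)" \<rho>] p(2)[OF that] p'(2)[OF that] i by simp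
    moreover have "degree (p + p') \<le> CARD('d)" using p p' by (intro degree_add_le)
    ultimately show ?thesis by blast
  qed
qed

lemma poly_eqI_on_interval:
  fixes p r :: "real poly"
  assumes "0 < \<epsilon>" "\<And>s. 0 < s \<Longrightarrow> s < \<epsilon> \<Longrightarrow> poly p s = poly r s"
  shows "p = r"
proof (rule ccontr)
  assume "p \<noteq> r"
  then have "finite {s. poly (p - r) s = 0}" by (intro poly_roots_finite) simp
  moreover have "{0<..<\<epsilon>} \<subseteq> {s. poly (p - r) s = 0}" using assms by auto
  ultimately show False using infinite_Ioo[OF assms(1)] finite_subset by blast
qed

text \<open>
  A polynomial is determined by its values on an interval, so the Steiner coefficients are unique.
\<close>
lemma intrinsic_volume_of_parallel_polynomial:
  fixes X :: "(real ^ 'd::finite) set"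
  assumes "\<And>s. 0 \<le> s \<Longrightarrow> measure lebesgue {x + y | x y. x \<in> X \<and> y \<in> cball 0 s} = poly p s"
    and deg: "degree p \<le> CARD('d)" and q: "q \<le> CARD('d)"
  shows "intrinsic_volume q X = coeff p (CARD('d) - q) / unit_ball_vol (real (CARD('d) - q))"
proof -
  let ?d = "CARD('d)"
  have reidx: "(\<Sum>q = 0..?d. f (?d - q)) = (\<Sum>j = 0..?d. f j)" for f :: "nat \<Rightarrow> real"
    by (rule sum.reindex_bij_witness[of _ "\<lambda>j. ?d - j" "\<lambda>j. ?d - j"]) auto
  define V where "V j = coeff p (?d - j) / unit_ball_vol (real (?d - j))" for j
  have ubv: "unit_ball_vol (real j) \<noteq> 0" for j using unit_ball_vol_pos[of "real j"] by linarith
  have "steiner_coefficients X V"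
    unfolding steiner_coefficients_def
  proof (intro exI[of _ 1] conjI allI impI)
    fix s :: real assume s: "0 \<le> s \<and> s < 1"
    have "(\<Sum>q = 0..?d. s ^ (?d - q) * unit_ball_vol (real (?d - q)) * V q) = (\<Sum>q = 0..?d. coeff p (?d - q) * s ^ (?d - q))"
      unfolding V_def using ubv by (intro sum.cong refl) (simp del: of_nat_diff)
    also have "\<dots> = (\<Sum>j = 0..?d. coeff p j * s ^ j)" by (rule reidx)
    also have "\<dots> = (\<Sum>j\<le>degree p. coeff p j * s ^ j)"
      using deg by (intro sum.mono_neutral_right) (auto simp: coeff_eq_0)
    also have "\<dots> = poly p s" by (simp add: poly_altdef)
    finally show "measure lebesgue {x + y | x y. x \<in> X \<and> y \<in> cball 0 s} =
        (\<Sum>q = 0..?d. s ^ (?d - q) * unit_ball_vol (real (?d - q)) * V q)" using assms(1) s by simp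
  qed auto
  moreover have "V' q = V q" if st: "steiner_coefficients X V'" for V'
  proof -
    define r where "r = (\<Sum>j = 0..?d. monom (unit_ball_vol (real (?d - j)) * V' j) (?d - j))"
    obtain \<epsilon> where \<epsilon>: "\<epsilon> > 0" "\<forall>s. 0 \<le> s \<and> s < \<epsilon> \<longrightarrow> measure lebesgue {x + y | x y. x \<in> X \<and> y \<in> cball 0 s} =
        (\<Sum>q = 0..?d. s ^ (?d - q) * unit_ball_vol (real (?d - q)) * V' q)"
      using st unfolding steiner_coefficients_def by (elim exE conjE) (rule that)
    have "r = p"
    proof (rule poly_eqI_on_interval[OF \<epsilon>(1)])
      fix s assume "0 < s" "s < \<epsilon>"
      then show "poly r s = poly p s"
        using \<epsilon>(2)[rule_format, of s] assms(1)[of s] by (simp add: r_def poly_sum poly_monom mult_ac)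
    qed
    moreover have "coeff r (?d - q) = unit_ball_vol (real (?d - q)) * V' q"
    proof -
      have "coeff r (?d - q) = (\<Sum>j = 0..?d. if j = q then unit_ball_vol (real (?d - j)) * V' j else 0)"
        unfolding r_def coeff_sum using q by (intro sum.cong) auto
      then show ?thesis using q by simp
    qed
    ultimately show ?thesis using ubv[of "?d - q"] by (simp add: V_def)
  qed
  ultimately have "intrinsic_volume q X = V q"
    unfolding intrinsic_volume_def by (intro the_equality) blast+
  then show ?thesis by (simp add: V_def)
qed

lemma translation_vimage_eq_image: "{z. z - v \<in> B} = (\<lambda>z. z + v) ` B" for v :: "'a::ab_group_add"
proof (intro equalityI subsetI)
  fix z assume "z \<in> {z. z - v \<in> B}"
  then show "z \<in> (\<lambda>z. z + v) ` B" by (intro image_eqI[of _ _ "z - v"]) auto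
qed auto

lemma intrinsic_volume_isometry:
  fixes X :: "(real ^ 'd::finite) set" and T :: "real ^ 'd \<Rightarrow> real ^ 'd"
  assumes T: "orthogonal_transformation T" and X: "compact X"
  shows "intrinsic_volume q ((\<lambda>x. T x + v) ` X) = intrinsic_volume q X"
proof -
  have lin: "linear T" using T by (rule orthogonal_transformation_linear)
  have ball: "T ` cball 0 s = cball 0 s" for s
    using image_orthogonal_transformation_cball[OF T, of 0 s] by (simp add: linear_0[OF lin])
  have "measure lebesgue {x + y | x y. x \<in> (\<lambda>x. T x + v) ` X \<and> y \<in> cball 0 s}
      = measure lebesgue {x + y | x y. x \<in> X \<and> y \<in> cball 0 s}" for s
  proof -
    let ?A = "{x + y | x y. x \<in> X \<and> y \<in> cball 0 s}"
    have c: "compact ?A" using X by (intro compact_sums) auto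
    have cT: "compact (T ` ?A)" using c
      by (intro compact_continuous_image linear_continuous_on linear_conv_bounded_linear[THEN iffD1] lin)
    have "{x + y | x y. x \<in> (\<lambda>x. T x + v) ` X \<and> y \<in> cball 0 s} = {z. z - v \<in> T ` ?A}"
    proof (intro equalityI subsetI)
      fix z assume "z \<in> {x + y | x y. x \<in> (\<lambda>x. T x + v) ` X \<and> y \<in> cball 0 s}"
      then obtain x y where "x \<in> X" "y \<in> T ` cball 0 s" "z = T x + v + y" unfolding ball by blast
      then obtain y' where "x \<in> X" "y' \<in> cball 0 s" "z - v = T (x + y')" by (auto simp: linear_add[OF lin])
      then show "z \<in> {z. z - v \<in> T ` ?A}" by blast
    next
      fix z assume "z \<in> {z. z - v \<in> T ` ?A}"
      then obtain x y where xy: "x \<in> X" "y \<in> cball 0 s" "z - v = T (x + y)" by blast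
      then have "z = (T x + v) + T y" by (simp add: linear_add[OF lin] algebra_simps)
      moreover have "T y \<in> cball 0 s" using xy ball by blast
      ultimately show "z \<in> {x + y | x y. x \<in> (\<lambda>x. T x + v) ` X \<and> y \<in> cball 0 s}" using xy by blast
    qed
    moreover have "compact {z. z - v \<in> T ` ?A}"
    proof -
      have "{z. z - v \<in> T ` ?A} = (\<lambda>z. z + v) ` (T ` ?A)"
        by (rule translation_vimage_eq_image)
      moreover have "compact ((\<lambda>z. z + v) ` (T ` ?A))"
        by (rule compact_continuous_image[OF _ cT]) (intro continuous_intros)
      ultimately show ?thesis by (simp only:)
    qed
    moreover have "vol {z. z - v \<in> T ` ?A} = vol ?A"
      using measure_lborel_translation[OF borel_compact[OF cT], of v]
        measure_lborel_orthogonal_image[OF T borel_compact[OF c] borel_compact[OF cT]] by (rule trans)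
    ultimately show ?thesis
      using measure_lebesgue_compact[OF c] measure_lebesgue_compact[of "{z. z - v \<in> T ` ?A}"]
      by (simp only:)
  qed
  then have "steiner_coefficients ((\<lambda>x. T x + v) ` X) = steiner_coefficients X"
    unfolding steiner_coefficients_def by simp
  then show ?thesis by (simp add: intrinsic_volume_def)
qed

text \<open>
  In the alternating sum the Steiner polynomials of the boxes, as functions of the total radius
  \<open>\<rho> = 1 + s\<close>, collapse to the volume of a ball of radius \<open>\<rho>\<close> in dimension
  \<open>e = card (- K)\<close>, so the coefficient of \<open>s ^ e\<close> is the volume of the unit ball,
  which is the normalisation in the Steiner formula.
\<close>
lemma intrinsic_volume_mixed_difference:
  fixes \<beta> :: "'d::finite \<Rightarrow> 'b::euclidean_space" and K :: "'d set"
  assumes \<beta>: "bij_betw \<beta> (-K) Basis"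
  defines "\<tau> A \<equiv> (\<lambda>i. if i \<in> A then 2 else if i \<in> K then 1 else 0)"
  shows "(\<Sum>A\<in>Pow K. (-1) ^ card (K - A) * intrinsic_volume (card K) (rounded_box (\<tau> A) {} 1)) = 1"
proof -
  let ?e = "card (- K)" and ?d = "CARD('d)"
  have e: "?e = DIM('b)" using \<beta> by (metis bij_betw_same_card)
  have ed: "?d - card K = ?e" by (simp add: Compl_eq_Diff_UNIV card_Diff_subset)
  have Kd: "card K \<le> ?d" by (rule card_mono) auto
  have "\<exists>p. degree p \<le> ?d \<and> (\<forall>\<rho>>0. vol (slab_hits (\<tau> A) {} \<rho> {0}) = poly p \<rho>)" for A
  proof -
    have "\<tau> A = (\<lambda>i. real (if i \<in> A then 2 else if i \<in> K then 1 else 0))" by (auto simp: \<tau>_def)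
    then show ?thesis using measure_slab_hits_polynomial[of "\<lambda>i. if i \<in> A then 2 else if i \<in> K then 1 else 0" "{}"] by simp
  qed
  then obtain p where p: "\<And>A. degree (p A) \<le> ?d"
    "\<And>A \<rho>. \<rho> > 0 \<Longrightarrow> vol (slab_hits (\<tau> A) {} \<rho> {0}) = poly (p A) \<rho>" by metis
  have iv: "intrinsic_volume (card K) (rounded_box (\<tau> A) {} 1) = coeff (pcompose (p A) [:1, 1:]) ?e / unit_ball_vol (real ?e)" for A
    unfolding ed[symmetric]
  proof (rule intrinsic_volume_of_parallel_polynomial[OF _ _ Kd])
    fix s :: real assume s: "0 \<le> s"
    have "measure lebesgue {x + y | x y. x \<in> rounded_box (\<tau> A) {} 1 \<and> y \<in> cball 0 s} = measure lebesgue (rounded_box (\<tau> A) {} (1 + s))"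
      using s by (subst rounded_box_parallel) (auto simp: \<tau>_def)
    also have "\<dots> = vol (slab_hits (\<tau> A) {} (1 + s) {0})"
      by (simp add: measure_lebesgue_compact compact_rounded_box slab_hits_origin)
    also have "\<dots> = poly (pcompose (p A) [:1, 1:]) s"
      using s by (simp add: p poly_pcompose)
    finally show "measure lebesgue {x + y | x y. x \<in> rounded_box (\<tau> A) {} 1 \<and> y \<in> cball 0 s} = poly (pcompose (p A) [:1, 1:]) s" .
  next
    show "degree (pcompose (p A) [:1, 1:]) \<le> ?d" using p(1)[of A] by (simp add: degree_pcompose)
  qed
  define R where "R = (\<Sum>A\<in>Pow K. smult ((-1) ^ card (K - A)) (p A))"
  have "R = monom (unit_ball_vol (real ?e)) ?e"
  proof (rule poly_eqI_on_interval[of 1])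
    fix \<rho> :: real assume \<rho>: "0 < \<rho>" "\<rho> < 1"
    have "poly R \<rho> = (\<Sum>A\<in>Pow K. (-1) ^ card (K - A) * vol (slab_hits (\<tau> A) {} \<rho> {0}))"
      using \<rho> by (simp add: R_def poly_sum p)
    also have "\<dots> = vol (\<Union>p\<in>{0}. cball (- slab_projection \<beta> K p) \<rho>)"
      unfolding \<tau>_def using \<rho> by (intro mixed_difference_hits[OF \<beta>]) auto
    also have "\<dots> = vol (cball (0 :: 'b) \<rho>)"
      by (simp add: linear_0[OF linear_slab_projection])
    also have "\<dots> = poly (monom (unit_ball_vol (real ?e)) ?e) \<rho>"
      using \<rho> by (simp add: content_cball e poly_monom)
    finally show "poly R \<rho> = poly (monom (unit_ball_vol (real ?e)) ?e) \<rho>" .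
  qed simp
  moreover have "pcompose ([:0, 1:] ^ n) [:1, 1:] = ([:1, 1:] ^ n :: real poly)" for n
    by (induction n) (simp_all add: pcompose_mult pcompose_pCons pcompose_1)
  ultimately have "pcompose R [:1, 1:] = smult (unit_ball_vol (real ?e)) ([:1, 1:] ^ ?e)"
    by (simp only: monom_altdef pcompose_smult)
  then have "coeff (pcompose R [:1, 1:]) ?e = unit_ball_vol (real ?e)"
    by (simp add: coeff_linear_power)
  moreover have "coeff (pcompose R [:1, 1:]) ?e = (\<Sum>A\<in>Pow K. (-1) ^ card (K - A) * coeff (pcompose (p A) [:1, 1:]) ?e)"
    by (simp add: R_def pcompose_sum coeff_sum pcompose_smult)
  ultimately show ?thesis
    using unit_ball_vol_pos[of "real ?e"]
    by (simp add: iv less_imp_neq[symmetric] del: unit_ball_vol_pos flip: sum_divide_distrib)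
qed

section \<open>The volume of a union of large balls\<close>

text \<open>
  Additivity makes \<open>g\<close> linear on rational multiples of 1, and an additive nonnegative function is
  monotone.
\<close>
lemma additive_nonneg_imp_linear:
  fixes g :: "real \<Rightarrow> real"
  assumes add: "\<And>x y. 0 \<le> x \<Longrightarrow> 0 \<le> y \<Longrightarrow> g (x + y) = g x + g y"
    and nonneg: "\<And>x. 0 \<le> g x" and x: "0 \<le> x"
  shows "g x = x * g 1"
proof -
  have mono: "g x \<le> g y" if "0 \<le> x" "x \<le> y" for x y
    using add[of x "y - x"] nonneg[of "y - x"] that by simp
  have g0: "g 0 = 0" using add[of 0 0] by simp
  have mult: "g (real n * y) = real n * g y" if "0 \<le> y" for n y
  proof (induction n)
    case (Suc n)
    have "g (real (Suc n) * y) = g (real n * y + y)" by (simp add: algebra_simps)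
    also have "\<dots> = g (real n * y) + g y" using that by (intro add) auto
    finally show ?case using Suc by (simp add: algebra_simps)
  qed (simp add: g0)
  have "\<bar>g x - x * g 1\<bar> \<le> g 1 / real n" if n: "n > 0" for n :: nat
  proof -
    have frac: "g (real m / real n) = real m / real n * g 1" for m
      using mult[of "1 / real n" n] mult[of "1 / real n" m] n by simp
    define m where "m = nat \<lfloor>real n * x\<rfloor>"
    have m: "real m \<le> real n * x" "real n * x \<le> real (m + 1)"
      using x by (auto simp: m_def) linarith
    then have m': "real m / real n \<le> x" "x \<le> real (m + 1) / real n"
      using n by (auto simp: field_simps)
    define A where "A = real m / real n"
    define E where "E = 1 / real n"
    have AE: "real (m + 1) / real n = A + E" by (simp add: A_def E_def add_divide_distrib add.commute)
    have gAE: "g A = A * g 1" "g (A + E) = (A + E) * g 1"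
      using frac[of m] frac[of "m + 1"] unfolding AE A_def[symmetric] by auto
    have mA: "A \<le> x" "x \<le> A + E" using m' unfolding AE A_def by auto
    have "0 \<le> A" by (simp add: A_def)
    have "g A \<le> g x" by (rule mono[OF \<open>0 \<le> A\<close> mA(1)])
    moreover have "g x \<le> g (A + E)" by (rule mono[OF x mA(2)])
    moreover have "A * g 1 \<le> x * g 1" by (rule mult_right_mono[OF mA(1) nonneg])
    moreover have "x * g 1 \<le> (A + E) * g 1" by (rule mult_right_mono[OF mA(2) nonneg])
    moreover have "(A + E) * g 1 = A * g 1 + E * g 1" by (rule distrib_right)
    moreover have "E * g 1 = g 1 / real n" by (simp add: E_def)
    ultimately show ?thesis unfolding gAE by linarith
  qed
  then have "(\<lambda>n. \<bar>g x - x * g 1\<bar>) \<longlonglongrightarrow> 0"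
    by (intro tendsto_sandwich[OF _ _ tendsto_const lim_const_over_n[of "g 1"]])
       (auto simp: eventually_sequentially intro!: exI[of _ 1])
  then show ?thesis by (simp add: LIMSEQ_const_iff)
qed

lemma closest_point_eq_iff_normal:
  fixes K :: "'a::euclidean_space set"
  assumes "convex K" "closed K" "k \<in> K"
  shows "closest_point K (k + v) = k \<longleftrightarrow> (\<forall>y\<in>K. v \<bullet> (y - k) \<le> 0)"
proof
  assume "closest_point K (k + v) = k"
  then show "\<forall>y\<in>K. v \<bullet> (y - k) \<le> 0"
    using closest_point_dot[OF assms(1,2), of _ "k + v"] by auto
next
  assume v: "\<forall>y\<in>K. v \<bullet> (y - k) \<le> 0"
  have "dist (k + v) k \<le> dist (k + v) y" if "y \<in> K" for y
  proof -
    have "(norm (v - (y - k)))\<^sup>2 = (norm v)\<^sup>2 + (norm (y - k))\<^sup>2 - 2 * (v \<bullet> (y - k))"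
      by (simp add: power2_norm_eq_inner inner_diff inner_commute algebra_simps)
    then have "(norm v)\<^sup>2 \<le> (norm (v - (y - k)))\<^sup>2" using v that zero_le_power2[of "norm (y - k)"] by (smt (verit))
    then have "norm v \<le> norm (v - (y - k))" by (rule power2_le_imp_le) simp
    then show ?thesis by (simp add: dist_norm algebra_simps)
  qed
  then show "closest_point K (k + v) = k"
    using closest_point_unique[OF assms, of "k + v"] by simp
qed

lemma convex_hull_strict_halfspace:
  fixes v :: "'a::real_inner"
  assumes "\<And>p. p \<in> S \<Longrightarrow> v \<bullet> p < c" "k \<in> convex hull S"
  shows "v \<bullet> k < c"
proof -
  have "convex hull S \<subseteq> {x. v \<bullet> x < c}"
    using assms(1) by (intro hull_minimal convex_halfspace_lt) auto
  then show ?thesis using assms(2) by auto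
qed

text \<open>
  The face of the hull that is maximal in direction \<open>v\<close> contains \<open>k\<close>. As \<open>k\<close> is
  not one of the generating points, the face contains at least two of them.
\<close>
lemma hull_nonvertex_normal:
  fixes v :: "'a::euclidean_space"
  assumes k: "k \<in> convex hull S" "k \<notin> S" and v: "\<And>y. y \<in> convex hull S \<Longrightarrow> v \<bullet> (y - k) \<le> 0"
  shows "\<exists>p\<in>S. \<exists>q\<in>S. p \<noteq> q \<and> v \<bullet> (p - k) = 0 \<and> v \<bullet> (p - q) = 0"
proof -
  have le: "v \<bullet> p \<le> v \<bullet> k" if "p \<in> S" for p
    using v[of p] that by (simp add: hull_inc inner_diff_right)
  have "\<exists>p\<in>S. v \<bullet> p = v \<bullet> k"
    using convex_hull_strict_halfspace[OF _ k(1), of v "v \<bullet> k"] le by force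
  then obtain p where p: "p \<in> S" "v \<bullet> p = v \<bullet> k" by blast
  have "\<exists>q\<in>S - {p}. v \<bullet> q = v \<bullet> k"
  proof (rule ccontr)
    assume "\<not> (\<exists>q\<in>S - {p}. v \<bullet> q = v \<bullet> k)"
    then have lt: "v \<bullet> q < v \<bullet> k" if "q \<in> S - {p}" for q using le[of q] that by force
    have S: "S = insert p (S - {p})" using p by auto
    show False
    proof (cases "S - {p} = {}")
      case True
      then have "S = {p}" using p by auto
      then show False using k p by auto
    next
      case False
      have "k \<in> convex hull (insert p (S - {p}))" using k S by simp
      then obtain u t b where ut: "0 \<le> u" "0 \<le> t" "u + t = 1" "b \<in> convex hull (S - {p})" "k = u *\<^sub>R p + t *\<^sub>R b"
        unfolding convex_hull_insert[OF False] by blast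
      have "t \<noteq> 0" using ut k p by auto
      have "v \<bullet> b < v \<bullet> k" by (rule convex_hull_strict_halfspace[OF lt ut(4)])
      moreover have "v \<bullet> k = u * (v \<bullet> k) + t * (v \<bullet> b)" using ut(5) p(2) by (metis inner_add_right inner_scaleR_right)
      moreover have "u = 1 - t" using ut by simp
      ultimately have "t * (v \<bullet> k) = t * (v \<bullet> b)" by (simp add: algebra_simps)
      then show False using \<open>t \<noteq> 0\<close> \<open>v \<bullet> b < v \<bullet> k\<close> by simp
    qed
  qed
  then obtain q where "q \<in> S" "p \<noteq> q" "v \<bullet> q = v \<bullet> k" by auto
  then show ?thesis using p by (intro bexI[of _ p] bexI[of _ q]) (auto simp: inner_diff_right)
qed

text \<open>
  Let \<open>K\<close> be the hull and classify a point outside \<open>K\<close> by the nearest point of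
  \<open>K\<close>. If that is a point of \<open>S\<close>, the point lies in a cone with this apex; the part of the
  union in such cones scales with \<open>\<rho> ^ DIM('b)\<close>. Otherwise the outer normal is orthogonal to a
  difference of two points of \<open>S\<close>, which by \<open>orth\<close> leaves finitely many normals; for each of
  them, the points within distance \<open>\<rho>\<close> form a set whose volume is additive in \<open>\<rho>\<close>,
  hence linear. In this second case a point within distance \<open>\<rho>\<close> of \<open>K\<close> may fail to be
  within \<open>\<rho>\<close> of \<open>S\<close>, but only in a layer of thickness of order
  \<open>1 / \<rho>\<close>. The assumption \<open>orth\<close> holds in dimensions 1 and 2.
\<close>
lemma ball_union_volume_expansion:
  fixes S :: "'b::euclidean_space set"
  assumes S: "finite S" and orth: "\<And>w :: 'b. w \<noteq> 0 \<Longrightarrow> finite {u. norm u = 1 \<and> u \<bullet> w = 0}"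
  obtains V P where "((\<lambda>\<rho>. vol (\<Union>p\<in>S. cball p \<rho>) -
      (vol (convex hull S) + V * \<rho> ^ DIM('b) + P * \<rho>)) \<longlongrightarrow> 0) at_top"
proof (cases "S = {}")
  case True
  show ?thesis by (rule that[of 0 0]) (simp add: True)
next
  case ne: False
  define K where "K = convex hull S"
  have cpt: "compact K" unfolding K_def using S by (intro finite_imp_compact_convex_hull)
  then have cl: "closed K" by (rule compact_imp_closed)
  have conv: "convex K" by (simp add: K_def)
  have SK: "S \<subseteq> K" by (simp add: K_def hull_subset)
  have Kne: "K \<noteq> {}" using ne SK by auto
  define \<pi> where "\<pi> = closest_point K"
  have \<pi>_in: "\<pi> x \<in> K" for x unfolding \<pi>_def by (rule closest_point_in_set[OF cl Kne])
  have \<pi>_iff: "x \<in> K \<longleftrightarrow> \<pi> x = x" for x unfolding \<pi>_def using closest_point_refl[OF cl Kne] by auto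
  have "continuous_on UNIV \<pi>" unfolding \<pi>_def by (rule continuous_on_closest_point[OF conv cl Kne])
  then have [measurable]: "\<pi> \<in> borel_measurable borel" by (rule borel_measurable_continuous_onI)
  have [measurable]: "K \<in> sets borel" "S \<in> sets borel"
    using cl S by (auto intro!: borel_closed finite_imp_closed)
  have normal: "\<pi> (k + v) = k \<longleftrightarrow> (\<forall>y\<in>K. v \<bullet> (y - k) \<le> 0)" if "k \<in> K" for k v
    unfolding \<pi>_def by (rule closest_point_eq_iff_normal[OF conv cl that])
  have ray: "\<pi> (k + c *\<^sub>R v) = k" if "\<pi> (k + v) = k" "0 < c" for k v c
    using that \<pi>_in[of "k + v"] by (auto simp: normal mult_le_0_iff)
  define D where "D = diameter K"
  have D: "norm (x - y) \<le> D" if "x \<in> K" "y \<in> K" for x y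
    unfolding D_def using diameter_bounded_bound[OF compact_imp_bounded[OF cpt] that] by (simp add: dist_norm)
  have D0: "0 \<le> D" unfolding D_def by (rule diameter_ge_0) (simp add: compact_imp_bounded cpt)

  \<comment> \<open>\<open>B p\<close> is the part of the cone at the vertex \<open>p\<close>, \<open>T u\<close> the part with nearest point off \<open>S\<close> and outer normal \<open>u\<close>, \<open>TT\<close> the union of the \<open>T u\<close>.\<close>
  define B where "B p \<rho> = {x. x \<notin> K \<and> \<pi> x = p \<and> norm (x - \<pi> x) \<le> \<rho>}" for p \<rho>
  define N where "N = (\<Union>p\<in>S. \<Union>q\<in>S - {p}. {u. norm u = 1 \<and> u \<bullet> (p - q) = 0})"
  define T where "T u \<rho> = {x. x \<notin> K \<and> \<pi> x \<notin> S \<and> norm (x - \<pi> x) \<le> \<rho> \<and> x - \<pi> x = norm (x - \<pi> x) *\<^sub>R u}" for u \<rho>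
  define TT where "TT \<rho> = {x. x \<notin> K \<and> \<pi> x \<notin> S \<and> norm (x - \<pi> x) \<le> \<rho>}" for \<rho>
  define U where "U \<rho> = (\<Union>p\<in>S. cball p \<rho>)" for \<rho>
  define M where "M \<rho> = U \<rho> \<inter> {x. x \<notin> K \<and> \<pi> x \<notin> S}" for \<rho>
  have [measurable]: "B p \<rho> \<in> sets borel" "T u \<rho> \<in> sets borel" "TT \<rho> \<in> sets borel" for p u \<rho>
    unfolding B_def T_def TT_def by measurable
  have [measurable]: "U \<rho> \<in> sets borel" for \<rho> unfolding U_def using S by (intro borel_closed closed_UN) auto
  have [measurable]: "M \<rho> \<in> sets borel" for \<rho> unfolding M_def by measurable
  have finN: "finite N" unfolding N_def using S by (intro finite_UN_I finite_Diff orth) auto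
  obtain C where C: "\<And>x. x \<in> K \<Longrightarrow> norm x \<le> C"
    using compact_imp_bounded[OF cpt] by (auto simp: bounded_iff)
  have bdd: "bounded {x. norm (x - \<pi> x) \<le> \<rho>}" for \<rho>
    unfolding bounded_iff
  proof (intro exI[of _ "C + \<rho>"] ballI)
    fix x assume "x \<in> {x. norm (x - \<pi> x) \<le> \<rho>}"
    then show "norm x \<le> C + \<rho>" using C[OF \<pi>_in[of x]] norm_triangle_sub[of x "\<pi> x"] by simp
  qed
  have fin: "emeasure lborel X \<noteq> \<infinity>" if "X \<subseteq> {x. norm (x - \<pi> x) \<le> \<rho>}" for X \<rho>
    by (rule emeasure_bounded_not_infinite[OF bounded_subset[OF bdd that]])
  have finU: "emeasure lborel X \<noteq> \<infinity>" if "X \<subseteq> U \<rho>" for X \<rho>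
  proof (rule emeasure_bounded_not_infinite[OF bounded_subset[OF _ that]])
    show "bounded (U \<rho>)" unfolding U_def using S by (intro bounded_UN) auto
  qed
  have \<pi>_le: "norm (x - \<pi> x) \<le> norm (x - y)" if "y \<in> K" for x y
    unfolding \<pi>_def using closest_point_le[OF cl that, of x] by (simp add: dist_norm)

  have vertex: "vol (B p \<rho>) = \<rho> ^ DIM('b) * vol {v. p + v \<in> B p 1}" if \<rho>: "0 < \<rho>" for p \<rho>
  proof -
    have "x \<in> B p \<rho> \<longleftrightarrow> p + (1 / \<rho>) *\<^sub>R (x - p) \<in> B p 1" for x
    proof -
      have "\<pi> x = p \<longleftrightarrow> \<pi> (p + (1 / \<rho>) *\<^sub>R (x - p)) = p"
        using ray[of p "x - p" "1 / \<rho>"] ray[of p "(1 / \<rho>) *\<^sub>R (x - p)" \<rho>] \<rho> by auto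
      then show ?thesis using \<rho> by (auto simp: B_def \<pi>_iff divide_le_eq)
    qed
    then have "B p \<rho> = {x. (1 / \<rho>) *\<^sub>R (x - p) \<in> {v. p + v \<in> B p 1}}" by blast
    moreover have "{v. p + v \<in> B p 1} \<in> sets borel" by measurable
    ultimately show ?thesis using measure_lborel_dilation[of "{v. p + v \<in> B p 1}" \<rho> p] \<rho> by simp
  qed

  have edge: "vol (T u \<rho>) = \<rho> * vol (T u 1)" if u: "norm u = 1" and \<rho>: "0 \<le> \<rho>" for u \<rho>
  proof (rule additive_nonneg_imp_linear[OF _ _ \<rho>])
    fix x y :: real assume xy: "0 \<le> x" "0 \<le> y"
    have Tiff: "z \<in> T u \<rho> \<longleftrightarrow> (\<exists>k s. z = k + s *\<^sub>R u \<and> 0 < s \<and> s \<le> \<rho> \<and> k \<in> K \<and> k \<notin> S \<and> \<pi> (k + u) = k)" for z \<rho>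
    proof
      assume z: "z \<in> T u \<rho>"
      define s where "s = norm (z - \<pi> z)"
      have "z - \<pi> z = s *\<^sub>R u" using z unfolding T_def s_def by blast
      then have zs: "z = \<pi> z + s *\<^sub>R u" by (metis add.commute diff_add_cancel)
      have "s > 0" using z by (auto simp: T_def s_def \<pi>_iff)
      moreover have "\<pi> (\<pi> z + u) = \<pi> z"
        using ray[of "\<pi> z" "s *\<^sub>R u" "1 / s"] zs \<open>s > 0\<close> by simp
      ultimately show "\<exists>k s. z = k + s *\<^sub>R u \<and> 0 < s \<and> s \<le> \<rho> \<and> k \<in> K \<and> k \<notin> S \<and> \<pi> (k + u) = k"
        using z \<pi>_in[of z] zs by (intro exI[of _ "\<pi> z"] exI[of _ s]) (simp add: T_def s_def)
    next
      assume "\<exists>k s. z = k + s *\<^sub>R u \<and> 0 < s \<and> s \<le> \<rho> \<and> k \<in> K \<and> k \<notin> S \<and> \<pi> (k + u) = k"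
      then obtain k s where ks: "z = k + s *\<^sub>R u" "0 < s" "s \<le> \<rho>" "k \<in> K" "k \<notin> S" "\<pi> (k + u) = k" by blast
      have "\<pi> z = k" using ray[OF ks(6,2)] ks(1) by simp
      then show "z \<in> T u \<rho>" using ks u by (auto simp: T_def \<pi>_iff)
    qed
    have dist_T: "norm (z - \<pi> z) = s" if "z = k + s *\<^sub>R u" "0 < s" "\<pi> (k + u) = k" for z k s
      using ray[OF that(3,2)] that u by simp
    have Tsplit: "T u (x + y) = T u x \<union> {z. z - x *\<^sub>R u \<in> T u y}"
    proof (intro equalityI subsetI)
      fix z assume "z \<in> T u (x + y)"
      then obtain k s where ks: "z = k + s *\<^sub>R u" "0 < s" "s \<le> x + y" "k \<in> K" "k \<notin> S" "\<pi> (k + u) = k"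
        unfolding Tiff by blast
      show "z \<in> T u x \<union> {z. z - x *\<^sub>R u \<in> T u y}"
      proof (cases "s \<le> x")
        case True
        then have "z \<in> T u x" unfolding Tiff using ks by blast
        then show ?thesis ..
      next
        case False
        have "z - x *\<^sub>R u \<in> T u y" unfolding Tiff
          using ks False by (intro exI[of _ k] exI[of _ "s - x"]) (auto simp: algebra_simps)
        then show ?thesis by simp
      qed
    next
      fix z assume "z \<in> T u x \<union> {z. z - x *\<^sub>R u \<in> T u y}"
      then show "z \<in> T u (x + y)"
      proof
        assume "z \<in> T u x"
        then show ?thesis using xy by (auto simp: T_def)
      next
        assume "z \<in> {z. z - x *\<^sub>R u \<in> T u y}"
        then obtain k s where ks: "z - x *\<^sub>R u = k + s *\<^sub>R u" "0 < s" "s \<le> y" "k \<in> K" "k \<notin> S" "\<pi> (k + u) = k"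
          unfolding mem_Collect_eq Tiff by blast
        then show ?thesis unfolding Tiff using xy
          by (intro exI[of _ k] exI[of _ "s + x"]) (auto simp: algebra_simps)
      qed
    qed
    have "T u x \<inter> {z. z - x *\<^sub>R u \<in> T u y} = {}"
    proof (rule ccontr)
      assume "T u x \<inter> {z. z - x *\<^sub>R u \<in> T u y} \<noteq> {}"
      then obtain z where z: "z \<in> T u x" "z - x *\<^sub>R u \<in> T u y" by blast
      obtain k s where ks: "z - x *\<^sub>R u = k + s *\<^sub>R u" "0 < s" "\<pi> (k + u) = k"
        using z(2) unfolding Tiff by blast
      then have "norm (z - \<pi> z) = s + x"
        using xy by (intro dist_T[of z k]) (auto simp: algebra_simps)
      then show False using z(1) ks by (simp add: T_def)
    qed
    moreover have "{z. z - x *\<^sub>R u \<in> T u y} \<in> sets borel" by measurable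
    moreover have "emeasure lborel {z. z - x *\<^sub>R u \<in> T u y} \<noteq> \<infinity>"
    proof (rule fin[of _ "x + y"])
      show "{z. z - x *\<^sub>R u \<in> T u y} \<subseteq> {z. norm (z - \<pi> z) \<le> x + y}"
        using equalityD2[OF Tsplit] unfolding T_def[of u "x + y"] by blast
    qed
    moreover have "emeasure lborel (T u x) \<noteq> \<infinity>" by (rule fin[of _ x]) (auto simp: T_def)
    ultimately show "vol (T u (x + y)) = vol (T u x) + vol (T u y)"
      unfolding Tsplit by (simp add: measure_Union measure_lborel_translation)
  qed simp
  define P where "P = (\<Sum>u\<in>N. vol (T u 1))"
  define V where "V = (\<Sum>p\<in>S. vol {v. p + v \<in> B p 1})"
  have P0: "0 \<le> P" unfolding P_def by (intro sum_nonneg) simp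

  have TT: "vol (TT \<rho>) = P * \<rho>" if \<rho>: "0 \<le> \<rho>" for \<rho>
  proof -
    have "TT \<rho> = (\<Union>u\<in>N. T u \<rho>)"
    proof (intro equalityI subsetI)
      fix x assume x: "x \<in> TT \<rho>"
      define v where "v = x - \<pi> x"
      have "v \<noteq> 0" using x by (auto simp: TT_def v_def \<pi>_iff)
      have "\<pi> (\<pi> x + v) = \<pi> x" by (simp add: v_def)
      then have "v \<bullet> (y - \<pi> x) \<le> 0" if "y \<in> convex hull S" for y
        using normal[OF \<pi>_in[of x], of v] that by (simp add: K_def)
      then obtain p q where pq: "p \<in> S" "q \<in> S" "p \<noteq> q" "v \<bullet> (p - q) = 0"
        using hull_nonvertex_normal[of "\<pi> x" S v] \<pi>_in[of x] x by (auto simp: K_def TT_def)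
      define u where "u = (1 / norm v) *\<^sub>R v"
      have "u \<in> N" unfolding N_def using pq \<open>v \<noteq> 0\<close>
        by (intro UN_I[of p] UN_I[of q]) (auto simp: u_def)
      moreover have "x \<in> T u \<rho>" using x \<open>v \<noteq> 0\<close> by (auto simp: T_def TT_def u_def v_def[symmetric])
      ultimately show "x \<in> (\<Union>u\<in>N. T u \<rho>)" by blast
    qed (auto simp: T_def TT_def)
    also have "vol \<dots> = (\<Sum>u\<in>N. vol (T u \<rho>))"
    proof (rule measure_finite_Union[OF finN])
      show "disjoint_family_on (\<lambda>u. T u \<rho>) N"
        unfolding disjoint_family_on_def
      proof (intro ballI impI)
        fix u u' assume "u \<in> N" "u' \<in> N" "u \<noteq> u'"
        show "T u \<rho> \<inter> T u' \<rho> = {}"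
        proof (rule ccontr)
          assume "T u \<rho> \<inter> T u' \<rho> \<noteq> {}"
          then obtain x where x: "x \<in> T u \<rho>" "x \<in> T u' \<rho>" by blast
          have "x \<notin> K" "x - \<pi> x = norm (x - \<pi> x) *\<^sub>R u" "x - \<pi> x = norm (x - \<pi> x) *\<^sub>R u'"
            using x unfolding T_def by blast+
          then have "norm (x - \<pi> x) *\<^sub>R u = norm (x - \<pi> x) *\<^sub>R u'" "x - \<pi> x \<noteq> 0"
            using \<pi>_iff[of x] by (metis, simp)
          then show False using \<open>u \<noteq> u'\<close> by simp
        qed
      qed
      show "emeasure lborel (T u \<rho>) \<noteq> \<infinity>" for u by (rule fin[of _ \<rho>]) (auto simp: T_def)
    qed auto
    also have "\<dots> = P * \<rho>"
      unfolding P_def sum_distrib_right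
    proof (rule sum.cong[OF refl])
      fix u assume "u \<in> N"
      then have "norm u = 1" by (auto simp: N_def)
      from edge[OF this \<rho>] show "vol (T u \<rho>) = vol (T u 1) * \<rho>"
        by (metis mult.commute)
    qed
    finally show ?thesis .
  qed

  have Ubound: "vol (U \<rho>) - (vol K + V * \<rho> ^ DIM('b) + P * \<rho>) = vol (M \<rho>) - P * \<rho>"
    if \<rho>: "0 < \<rho>" "D \<le> \<rho>" for \<rho>
  proof -
    have "K \<subseteq> U \<rho>"
    proof
      fix x assume x: "x \<in> K"
      obtain p where "p \<in> S" using ne by blast
      then have "x \<in> cball p \<rho>" using D[of p x] x SK \<rho> by (auto simp: dist_norm)
      then show "x \<in> U \<rho>" using \<open>p \<in> S\<close> by (auto simp: U_def)
    qed
    moreover have "B p \<rho> \<subseteq> U \<rho>" if "p \<in> S" for p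
      using that by (auto simp: U_def B_def dist_norm norm_minus_commute intro!: bexI[of _ p])
    moreover have "x \<in> B (\<pi> x) \<rho>" if xU: "x \<in> U \<rho>" "x \<notin> K" for x
    proof -
      obtain p where "p \<in> S" "norm (x - p) \<le> \<rho>" using xU by (auto simp: U_def dist_norm norm_minus_commute)
      then show ?thesis using \<pi>_le[of p x] SK that by (auto simp: B_def)
    qed
    ultimately have eq: "U \<rho> = (K \<union> M \<rho>) \<union> (\<Union>p\<in>S. B p \<rho>)" unfolding M_def by blast
    have fB: "emeasure lborel (B p \<rho>) \<noteq> \<infinity>" for p by (rule fin[of _ \<rho>]) (auto simp: B_def)
    have fM: "emeasure lborel (M \<rho>) \<noteq> \<infinity>" by (rule finU[of _ \<rho>]) (auto simp: M_def)
    have fK: "emeasure lborel K \<noteq> \<infinity>" using cpt by (intro emeasure_bounded_not_infinite compact_imp_bounded)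
    have "vol (U \<rho>) = vol (K \<union> M \<rho>) + vol (\<Union>p\<in>S. B p \<rho>)"
      unfolding eq
    proof (rule measure_Union)
      show "(K \<union> M \<rho>) \<inter> (\<Union>p\<in>S. B p \<rho>) = {}" by (auto simp: M_def B_def)
      show "emeasure lborel (K \<union> M \<rho>) \<noteq> \<infinity>" "emeasure lborel (\<Union>p\<in>S. B p \<rho>) \<noteq> \<infinity>"
        by (rule finU[of _ \<rho>], use eq in blast)+
    qed (use S in auto)
    also have "vol (K \<union> M \<rho>) = vol K + vol (M \<rho>)"
      by (rule measure_Union) (use fK fM in \<open>auto simp: M_def\<close>)
    also have "vol (\<Union>p\<in>S. B p \<rho>) = (\<Sum>p\<in>S. vol (B p \<rho>))"
      by (rule measure_finite_Union[OF S]) (use fB in \<open>auto simp: disjoint_family_on_def B_def\<close>)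
    also have "\<dots> = V * \<rho> ^ DIM('b)"
      unfolding V_def sum_distrib_right using \<rho> by (intro sum.cong refl) (simp add: vertex mult.commute)
    finally show ?thesis by simp
  qed

  have upper: "vol (M \<rho>) - P * \<rho> \<le> 0" if \<rho>: "0 < \<rho>" for \<rho>
  proof -
    have "M \<rho> \<subseteq> TT \<rho>"
    proof
      fix x assume x: "x \<in> M \<rho>"
      then obtain p where "p \<in> S" "norm (x - p) \<le> \<rho>" by (auto simp: M_def U_def dist_norm norm_minus_commute)
      then show "x \<in> TT \<rho>" using x \<pi>_le[of p x] SK by (auto simp: TT_def M_def)
    qed
    moreover have "emeasure lborel (TT \<rho>) \<noteq> \<infinity>" by (rule fin[of _ \<rho>]) (auto simp: TT_def)
    then have "TT \<rho> \<in> fmeasurable lborel" by (intro fmeasurableI) (auto simp: less_top[symmetric])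
    ultimately have "vol (M \<rho>) \<le> vol (TT \<rho>)"
      by (intro measure_mono_fmeasurable) auto
    then show ?thesis using TT[of \<rho>] \<rho> by simp
  qed

  have lower: "- (P * D\<^sup>2) / \<rho> \<le> vol (M \<rho>) - P * \<rho>" if \<rho>: "0 < \<rho>" "D \<le> \<rho>" for \<rho>
  proof -
    \<comment> \<open>If the point of \<open>K\<close> nearest to \<open>x\<close> is off \<open>S\<close> and at most \<open>\<sigma>\<close> away, Pythagoras bounds its distance from \<open>S\<close> by \<open>\<rho>\<close>.\<close>
    define \<sigma> where "\<sigma> = \<rho> - D\<^sup>2 / \<rho>"
    have D2: "D\<^sup>2 \<le> \<rho>\<^sup>2" using \<rho> D0 by (intro power_mono)
    have \<sigma>0: "0 \<le> \<sigma>" using D2 \<rho> by (simp add: \<sigma>_def divide_le_eq power2_eq_square)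
    have \<sigma>2: "\<sigma>\<^sup>2 \<le> \<rho>\<^sup>2 - D\<^sup>2"
    proof -
      have "\<sigma>\<^sup>2 = \<rho>\<^sup>2 - 2 * D\<^sup>2 + (D\<^sup>2 / \<rho>)\<^sup>2"
        using \<rho> by (simp add: \<sigma>_def power2_diff)
      moreover have "(D\<^sup>2 / \<rho>)\<^sup>2 \<le> D\<^sup>2"
        using mult_left_mono[OF D2, of "D\<^sup>2"] \<rho> by (simp add: power_divide divide_le_eq power2_eq_square mult_ac)
      ultimately show ?thesis by simp
    qed
    have "TT \<sigma> \<subseteq> M \<rho>"
    proof
      fix x assume x: "x \<in> TT \<sigma>"
      define v where "v = x - \<pi> x"
      have "\<pi> (\<pi> x + v) = \<pi> x" by (simp add: v_def)
      then have "v \<bullet> (y - \<pi> x) \<le> 0" if "y \<in> convex hull S" for y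
        using normal[OF \<pi>_in[of x], of v] that by (simp add: K_def)
      then obtain p where p: "p \<in> S" "v \<bullet> (p - \<pi> x) = 0"
        using hull_nonvertex_normal[of "\<pi> x" S v] \<pi>_in[of x] x by (auto simp: K_def TT_def)
      have xp: "x - p = v - (p - \<pi> x)" by (simp add: v_def)
      have "(norm (v - w))\<^sup>2 = (norm v)\<^sup>2 + (norm w)\<^sup>2 - 2 * (v \<bullet> w)" for w
        by (simp add: power2_norm_eq_inner inner_diff inner_commute algebra_simps)
      then have "(norm (x - p))\<^sup>2 = (norm v)\<^sup>2 + (norm (p - \<pi> x))\<^sup>2"
        unfolding xp using p(2) by simp
      moreover have "(norm v)\<^sup>2 \<le> \<sigma>\<^sup>2" using x by (intro power_mono) (auto simp: TT_def v_def)
      moreover have "(norm (p - \<pi> x))\<^sup>2 \<le> D\<^sup>2" using p SK by (intro power_mono D \<pi>_in) auto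
      ultimately have "(norm (x - p))\<^sup>2 \<le> \<rho>\<^sup>2" using \<sigma>2 by linarith
      then have "norm (x - p) \<le> \<rho>" by (rule power2_le_imp_le) (use \<rho> in simp)
      then have "x \<in> U \<rho>" using p by (auto simp: U_def dist_norm norm_minus_commute intro!: bexI[of _ p])
      then show "x \<in> M \<rho>" using x by (auto simp: M_def TT_def)
    qed
    moreover have "emeasure lborel (M \<rho>) \<noteq> \<infinity>" by (rule finU[of _ \<rho>]) (auto simp: M_def)
    then have "M \<rho> \<in> fmeasurable lborel" by (intro fmeasurableI) (auto simp: less_top[symmetric])
    ultimately have "vol (TT \<sigma>) \<le> vol (M \<rho>)"
      by (intro measure_mono_fmeasurable) auto
    then show ?thesis using TT[OF \<sigma>0] \<rho> by (simp add: \<sigma>_def algebra_simps)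
  qed

  have "((\<lambda>\<rho>. vol (U \<rho>) - (vol K + V * \<rho> ^ DIM('b) + P * \<rho>)) \<longlongrightarrow> 0) at_top"
  proof (rule tendsto_sandwich)
    show "((\<lambda>\<rho>. - (P * D\<^sup>2) / \<rho>) \<longlongrightarrow> 0) at_top"
      by (rule tendsto_divide_0[OF tendsto_const filterlim_at_top_imp_at_infinity[OF filterlim_ident]])
    show "((\<lambda>\<rho>. 0) \<longlongrightarrow> (0 :: real)) at_top" by simp
    have ev: "\<forall>\<^sub>F \<rho> in at_top. 0 < \<rho> \<and> D \<le> \<rho>"
      by (intro eventually_conj eventually_gt_at_top eventually_ge_at_top)
    show "\<forall>\<^sub>F \<rho> in at_top. - (P * D\<^sup>2) / \<rho> \<le> vol (U \<rho>) - (vol K + V * \<rho> ^ DIM('b) + P * \<rho>)"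
      using ev by eventually_elim (use lower Ubound in force)
    show "\<forall>\<^sub>F \<rho> in at_top. vol (U \<rho>) - (vol K + V * \<rho> ^ DIM('b) + P * \<rho>) \<le> 0"
      using ev by eventually_elim (use upper Ubound in force)
  qed
  then show ?thesis using that[of V P] by (simp add: U_def K_def)
qed

lemma finite_unit_normals_real: "finite {u :: real. norm u = 1 \<and> u \<bullet> w = 0}" if "w \<noteq> 0"
  using that by (simp add: Collect_conv_if)

lemma finite_unit_normals_real_prod:
  assumes "w \<noteq> (0 :: real \<times> real)"
  shows "finite {u :: real \<times> real. norm u = 1 \<and> u \<bullet> w = 0}"
proof -
  obtain a b where w: "w = (a, b)" by (cases w)
  define c where "c = sqrt (a\<^sup>2 + b\<^sup>2)"
  have ab: "a\<^sup>2 + b\<^sup>2 > 0" using assms w by (auto simp: zero_prod_def sum_power2_gt_zero_iff)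
  then have c: "c > 0" "c\<^sup>2 = a\<^sup>2 + b\<^sup>2" by (auto simp: c_def)
  have "{u :: real \<times> real. norm u = 1 \<and> u \<bullet> w = 0} \<subseteq> {(- b / c, a / c), (b / c, - a / c)}"
  proof
    fix u assume u: "u \<in> {u :: real \<times> real. norm u = 1 \<and> u \<bullet> w = 0}"
    obtain x y where xy: "u = (x, y)" by (cases u)
    have n: "x\<^sup>2 + y\<^sup>2 = 1" using u xy by (simp add: norm_Pair)
    have o: "x * a + y * b = 0" using u xy w by simp
    define s where "s = (y * a - x * b) / c"
    have "(y * a - x * b)\<^sup>2 + (x * a + y * b)\<^sup>2 = (x\<^sup>2 + y\<^sup>2) * (a\<^sup>2 + b\<^sup>2)" by algebra
    then have "(y * a - x * b)\<^sup>2 = c\<^sup>2" using n o c by simp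
    then have s: "s\<^sup>2 = 1" using c(1) by (simp add: s_def power_divide)
    have "x * c\<^sup>2 = - b * (y * a - x * b)" using o c by (simp add: algebra_simps power2_eq_square) algebra
    moreover have "y * c\<^sup>2 = a * (y * a - x * b)" using o c by (simp add: algebra_simps power2_eq_square) algebra
    ultimately have "x = - b / c * s" "y = a / c * s" using c(1) by (auto simp: s_def field_simps power2_eq_square)
    moreover have "s = 1 \<or> s = -1" using s by (simp add: power2_eq_1_iff)
    ultimately show "u \<in> {(- b / c, a / c), (b / c, - a / c)}" using xy by auto
  qed
  then show ?thesis by (rule finite_subset) simp
qed

section \<open>Projections of polytopes in rotating directions\<close>

text \<open>
  For small \<open>t > 0\<close>, the three-term relation is satisfied by the functions
  \<open>\<alpha> * cos t + \<beta> * sin t\<close> and, in contrast to this form, can be integrated over a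
  parameter with no regard to \<open>\<alpha>\<close> and \<open>\<beta>\<close>.
\<close>
definition locally_sinusoidal :: "(real \<Rightarrow> real) \<Rightarrow> bool" where
  "locally_sinusoidal f \<longleftrightarrow>
     (\<exists>\<epsilon>>0. \<forall>t h. 0 < t - h \<and> 0 \<le> h \<and> t + h < \<epsilon> \<longrightarrow> f (t + h) + f (t - h) = 2 * cos h * f t)"

lemma locally_sinusoidal_sum:
  assumes "finite I" "\<And>i. i \<in> I \<Longrightarrow> locally_sinusoidal (f i)"
  shows "locally_sinusoidal (\<lambda>t. \<Sum>i\<in>I. c i * f i t)"
proof -
  obtain \<epsilon> where \<epsilon>: "\<And>i. i \<in> I \<Longrightarrow> \<epsilon> i > 0"
    "\<And>i t h. i \<in> I \<Longrightarrow> 0 < t - h \<Longrightarrow> 0 \<le> h \<Longrightarrow> t + h < \<epsilon> i \<Longrightarrow> f i (t + h) + f i (t - h) = 2 * cos h * f i t"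
    using assms(2) unfolding locally_sinusoidal_def by metis
  define e where "e = Min (insert 1 (\<epsilon> ` I))"
  have e: "e > 0" "\<And>i. i \<in> I \<Longrightarrow> e \<le> \<epsilon> i" using assms(1) \<epsilon>(1) by (auto simp: e_def)
  show ?thesis unfolding locally_sinusoidal_def
  proof (intro exI[of _ e] conjI allI impI e(1))
    fix t h assume th: "0 < t - h \<and> 0 \<le> h \<and> t + h < e"
    have "(\<Sum>i\<in>I. c i * f i (t + h)) + (\<Sum>i\<in>I. c i * f i (t - h)) = (\<Sum>i\<in>I. c i * (f i (t + h) + f i (t - h)))"
      by (simp add: sum.distrib distrib_left)
    also have "\<dots> = (\<Sum>i\<in>I. c i * (2 * cos h * f i t))"
    proof (rule sum.cong[OF refl])
      fix i assume i: "i \<in> I"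
      have "f i (t + h) + f i (t - h) = 2 * cos h * f i t" using th e(2)[OF i] by (intro \<epsilon>(2)[OF i]) auto
      then show "c i * (f i (t + h) + f i (t - h)) = c i * (2 * cos h * f i t)" by simp
    qed
    finally show "(\<Sum>i\<in>I. c i * f i (t + h)) + (\<Sum>i\<in>I. c i * f i (t - h)) = 2 * cos h * (\<Sum>i\<in>I. c i * f i t)"
      by (simp add: sum_distrib_left mult_ac)
  qed
qed

lemma locally_sinusoidal_const:
  assumes "locally_sinusoidal (\<lambda>_. c)" shows "c = 0"
proof -
  obtain \<epsilon> where \<epsilon>: "\<epsilon> > 0" "\<And>t h. 0 < t - h \<and> 0 \<le> h \<and> t + h < \<epsilon> \<Longrightarrow> c + c = 2 * cos h * c"
    using assms unfolding locally_sinusoidal_def by blast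
  \<comment> \<open>Small enough to use \<open>t = 2 * h\<close>, and below \<open>pi\<close> so that \<open>cos h \<noteq> 1\<close>.\<close>
  define h where "h = min 1 (\<epsilon> / 4)"
  have h: "0 < h" "h \<le> 1" "h \<le> \<epsilon> / 4" using \<epsilon>(1) by (auto simp: h_def)
  have "c + c = 2 * cos h * c" using h by (intro \<epsilon>(2)[of "2 * h"]) auto
  moreover have "cos h < cos 0" using h pi_gt3 by (intro cos_monotone_0_pi) auto
  then have "cos h \<noteq> 1" by simp
  ultimately show ?thesis by (simp add: algebra_simps)
qed

definition rotating_functional :: "'a::euclidean_space \<Rightarrow> 'a \<Rightarrow> real \<Rightarrow> 'a \<Rightarrow> real" where
  "rotating_functional u v t z = cos t * (u \<bullet> z) + sin t * (v \<bullet> z)"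

lemma linear_rotating_functional: "linear (rotating_functional u v t)"
  unfolding rotating_functional_def by (intro linearI) (simp_all add: inner_add_right algebra_simps)

lemma rotating_functional_three_terms:
  "rotating_functional u v (t + h) z + rotating_functional u v (t - h) z = 2 * cos h * rotating_functional u v t z"
  unfolding rotating_functional_def cos_add cos_diff sin_add sin_diff by (simp add: algebra_simps)

text \<open>
  The vertex that is lexicographically maximal for \<open>u\<close> and then \<open>v\<close> is the one that stays
  maximal for all small angles \<open>t > 0\<close>.
\<close>
lemma polytope_rotating_maximizer:
  fixes C :: "'a::euclidean_space set"
  assumes "polytope C" "C \<noteq> {}"
  shows "\<exists>z\<in>C. \<exists>\<epsilon>>0. \<forall>t. 0 < t \<and> t < \<epsilon> \<longrightarrow> (\<forall>y\<in>C. rotating_functional u v t y \<le> rotating_functional u v t z)"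
proof -
  obtain V where V: "finite V" "C = convex hull V" using assms(1) unfolding polytope_def by blast
  have "V \<noteq> {}" using V assms(2) by auto
  define m where "m = Max ((\<bullet>) u ` V)"
  \<comment> \<open>Among the maximizers of \<open>u\<close>, take one that maximizes \<open>v\<close>.\<close>
  define V' where "V' = {z \<in> V. u \<bullet> z = m}"
  have "m \<in> (\<bullet>) u ` V" unfolding m_def using V(1) \<open>V \<noteq> {}\<close> by (intro Max_in) auto
  then have V': "finite V'" "V' \<noteq> {}" using V(1) by (auto simp: V'_def)
  have "Max ((\<bullet>) v ` V') \<in> (\<bullet>) v ` V'" using V' by (intro Max_in) auto
  then obtain z where z: "z \<in> V'" "v \<bullet> z = Max ((\<bullet>) v ` V')" by auto
  have zv: "v \<bullet> y \<le> v \<bullet> z" if "y \<in> V'" for y unfolding z(2) using that V' by (intro Max_ge) auto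
  have zu: "u \<bullet> y \<le> m" if "y \<in> V" for y unfolding m_def using that V by (intro Max_ge) auto
  have uz: "u \<bullet> z = m" "z \<in> V" using z(1) by (auto simp: V'_def)
  have "\<forall>y\<in>V. \<forall>\<^sub>F t in at_right 0. rotating_functional u v t y \<le> rotating_functional u v t z"
  proof
    fix y assume y: "y \<in> V"
    show "\<forall>\<^sub>F t in at_right 0. rotating_functional u v t y \<le> rotating_functional u v t z"
    proof (cases "u \<bullet> y = m")
      case True
      then have vy: "v \<bullet> y \<le> v \<bullet> z" using y by (intro zv) (simp add: V'_def)
      have "\<forall>\<^sub>F t in at_right 0. t \<in> {0<..<pi}"
        by (rule eventually_at_rightI[of 0 pi]) auto
      then show ?thesis
      proof eventually_elim
        case (elim t)
        then have "sin t \<ge> 0" by (auto intro: sin_ge_zero)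
        then show ?case using True uz vy by (simp add: rotating_functional_def mult_left_mono)
      qed
    next
      case False
      then have "0 < m - u \<bullet> y" using zu[OF y] by simp
      have "((\<lambda>t. rotating_functional u v t z - rotating_functional u v t y) \<longlongrightarrow>
              cos 0 * (u \<bullet> z) + sin 0 * (v \<bullet> z) - (cos 0 * (u \<bullet> y) + sin 0 * (v \<bullet> y))) (at_right 0)"
        unfolding rotating_functional_def by (intro tendsto_intros)
      then have "((\<lambda>t. rotating_functional u v t z - rotating_functional u v t y) \<longlongrightarrow> m - u \<bullet> y) (at_right 0)"
        using uz by simp
      from order_tendstoD(1)[OF this \<open>0 < m - u \<bullet> y\<close>] show ?thesis by eventually_elim simp
    qed
  qed
  then have "\<forall>\<^sub>F t in at_right 0. \<forall>y\<in>V. rotating_functional u v t y \<le> rotating_functional u v t z"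
    using V(1) by (simp add: eventually_ball_finite)
  then obtain \<epsilon> where \<epsilon>: "\<epsilon> > 0" "\<And>t. 0 < t \<Longrightarrow> t < \<epsilon> \<Longrightarrow> \<forall>y\<in>V. rotating_functional u v t y \<le> rotating_functional u v t z"
    unfolding eventually_at_right_field by auto
  show ?thesis
  proof (intro bexI[of _ z] exI[of _ \<epsilon>] conjI allI impI ballI \<epsilon>(1))
    show "z \<in> C" using V uz by (simp add: hull_inc)
    fix t y assume t: "0 < t \<and> t < \<epsilon>" and y: "y \<in> C"
    have "convex {y. rotating_functional u v t y \<le> rotating_functional u v t z}"
    proof -
      have "{y. rotating_functional u v t y \<le> rotating_functional u v t z}
         = {y. (cos t *\<^sub>R u + sin t *\<^sub>R v) \<bullet> y \<le> rotating_functional u v t z}"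
        by (simp add: rotating_functional_def inner_add_left)
      then show ?thesis by (simp add: convex_halfspace_le)
    qed
    then have "C \<subseteq> {y. rotating_functional u v t y \<le> rotating_functional u v t z}"
      unfolding V(2) using \<epsilon>(2) t by (intro hull_minimal) auto
    then show "rotating_functional u v t y \<le> rotating_functional u v t z" using y by auto
  qed
qed

text \<open>
  One \<open>\<epsilon>\<close> has to serve all slices. The finitely many slices through points of \<open>S\<close>
  are polytopes. Any other nonempty slice lies between two consecutive ones of these and is the corresponding
  Minkowski combination of them, because no point of \<open>S\<close> lies strictly between; so the combination of
  their maximizers is its maximizer.
\<close>
lemma slices_rotating_maximizer:
  fixes S :: "'a::euclidean_space set" and a u v :: 'a
  assumes S: "finite S"
  defines "C x \<equiv> convex hull S \<inter> {z. a \<bullet> z = x}"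
  shows "\<exists>\<epsilon>>0. \<forall>x. C x \<noteq> {} \<longrightarrow>
     (\<exists>z\<in>C x. \<forall>t. 0 < t \<and> t < \<epsilon> \<longrightarrow> (\<forall>y\<in>C x. rotating_functional u v t y \<le> rotating_functional u v t z))"
proof -
  let ?n = "rotating_functional u v"
  have poly: "polytope (C x)" for x
    unfolding C_def using S by (intro polytope_Int_polyhedron polyhedron_hyperplane polytope_convex_hull)
  define X where "X = (\<bullet>) a ` S"
  have CX: "C x \<noteq> {}" if "x \<in> X" for x using that by (auto simp: X_def C_def intro: hull_inc)
  then have "\<exists>z \<epsilon>. z \<in> C x \<and> \<epsilon> > 0 \<and> (\<forall>t. 0 < t \<and> t < \<epsilon> \<longrightarrow> (\<forall>y\<in>C x. ?n t y \<le> ?n t z))" if "x \<in> X" for x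
    using polytope_rotating_maximizer[OF poly CX[OF that], of u v] by blast
  then obtain z \<epsilon> where z: "\<And>x. x \<in> X \<Longrightarrow> z x \<in> C x" "\<And>x. x \<in> X \<Longrightarrow> \<epsilon> x > 0"
    "\<And>x t y. x \<in> X \<Longrightarrow> 0 < t \<Longrightarrow> t < \<epsilon> x \<Longrightarrow> y \<in> C x \<Longrightarrow> ?n t y \<le> ?n t (z x)" by metis
  define e where "e = Min (insert 1 (\<epsilon> ` X))"
  have finX: "finite X" using S by (simp add: X_def)
  have e: "e > 0" "\<And>x. x \<in> X \<Longrightarrow> e \<le> \<epsilon> x" using finX z(2) by (auto simp: e_def)
  show ?thesis
  proof (intro exI[of _ e] conjI allI impI e(1))
    fix x assume ne: "C x \<noteq> {}"
    show "\<exists>z\<in>C x. \<forall>t. 0 < t \<and> t < e \<longrightarrow> (\<forall>y\<in>C x. ?n t y \<le> ?n t z)"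
    proof (cases "x \<in> X")
      case True
      show ?thesis
      proof (intro bexI[of _ "z x"] allI impI ballI)
        fix t y assume "0 < t \<and> t < e" "y \<in> C x"
        then show "?n t y \<le> ?n t (z x)" using e(2)[OF True] by (intro z(3)[OF True]) auto
      qed (rule z(1)[OF True])
    next
      case False
      define L where "L = {p \<in> S. a \<bullet> p < x}"
      define R where "R = {p \<in> S. a \<bullet> p > x}"
      have SLR: "S = L \<union> R" using False by (auto simp: L_def R_def X_def)
      have finLR: "finite L" "finite R" using S by (auto simp: L_def R_def)
      obtain y0 where y0: "y0 \<in> convex hull S" "a \<bullet> y0 = x" using ne by (auto simp: C_def)
      have "L \<noteq> {}"
      proof
        assume "L = {}"
        then have "convex hull S \<subseteq> {y. a \<bullet> y > x}"
          using SLR by (intro hull_minimal convex_halfspace_gt) (auto simp: R_def)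
        then show False using y0 by auto
      qed
      have "R \<noteq> {}"
      proof
        assume "R = {}"
        then have "convex hull S \<subseteq> {y. a \<bullet> y < x}"
          using SLR by (intro hull_minimal convex_halfspace_lt) (auto simp: L_def)
        then show False using y0 by auto
      qed
      \<comment> \<open>The two consecutive levels of \<open>S\<close> that enclose \<open>x\<close>.\<close>
      define x1 where "x1 = Max ((\<bullet>) a ` L)"
      define x2 where "x2 = Min ((\<bullet>) a ` R)"
      have "x1 \<in> (\<bullet>) a ` L" unfolding x1_def using finLR \<open>L \<noteq> {}\<close> by (intro Max_in) auto
      then have x1: "x1 \<in> X" "x1 < x" by (auto simp: X_def L_def)
      have "x2 \<in> (\<bullet>) a ` R" unfolding x2_def using finLR \<open>R \<noteq> {}\<close> by (intro Min_in) auto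
      then have x2: "x2 \<in> X" "x < x2" by (auto simp: X_def R_def)
      have Lle: "convex hull L \<subseteq> {y. a \<bullet> y \<le> x1}"
        using finLR by (intro hull_minimal convex_halfspace_le) (auto simp: x1_def)
      have Rge: "convex hull R \<subseteq> {y. a \<bullet> y \<ge> x2}"
        using finLR by (intro hull_minimal convex_halfspace_ge) (auto simp: x2_def)
      define \<mu> where "\<mu> = (x - x1) / (x2 - x1)"
      have "\<mu> * (x2 - x1) = x - x1" using x1 x2 by (simp add: \<mu>_def)
      then have "x = (1 - \<mu>) * x1 + \<mu> * x2" by (simp add: algebra_simps)
      moreover have "0 \<le> \<mu>" "\<mu> \<le> 1" using x1 x2 by (auto simp: \<mu>_def)
      ultimately have \<mu>: "0 \<le> \<mu>" "\<mu> \<le> 1" "x = (1 - \<mu>) * x1 + \<mu> * x2" by auto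
      define w where "w = (1 - \<mu>) *\<^sub>R z x1 + \<mu> *\<^sub>R z x2"
      have "w \<in> convex hull S" unfolding w_def
        using z(1)[OF x1(1)] z(1)[OF x2(1)] \<mu> by (intro convexD convex_convex_hull) (auto simp: C_def)
      moreover have "a \<bullet> w = x"
        using z(1)[OF x1(1)] z(1)[OF x2(1)] \<mu>(3) by (simp add: w_def inner_add_right C_def)
      ultimately have "w \<in> C x" by (simp add: C_def)
      moreover have "?n t y \<le> ?n t w" if t: "0 < t" "t < e" and y: "y \<in> C x" for t y
      proof -
        have "y \<in> convex hull (L \<union> R)" using y SLR by (simp add: C_def)
        then have "y \<in> convex hull (convex hull L \<union> convex hull R)"
          by (metis hull_Un_left hull_Un_right)
        then obtain b' b l r where "b' \<ge> 0" "0 \<le> b" "b' + b = 1" "l \<in> convex hull L" "r \<in> convex hull R" "y = b' *\<^sub>R l + b *\<^sub>R r"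
          using convex_hull_union_two[OF convex_convex_hull[of L] _ convex_convex_hull[of R]] \<open>L \<noteq> {}\<close> \<open>R \<noteq> {}\<close> by auto
        then have blr: "0 \<le> b" "b \<le> 1" "l \<in> convex hull L" "r \<in> convex hull R" "y = (1 - b) *\<^sub>R l + b *\<^sub>R r"
          by (auto simp: eq_diff_eq[symmetric])
        have lr: "a \<bullet> l \<le> x1" "a \<bullet> r \<ge> x2" using blr Lle Rge by auto
        \<comment> \<open>The segment from \<open>l\<close> to \<open>r\<close> meets level \<open>c\<close> in \<open>pt c\<close>, and it runs through \<open>y\<close>.\<close>
        define D where "D = a \<bullet> r - a \<bullet> l"
        have D: "D > 0" using lr x1 x2 by (simp add: D_def)
        define pt where "pt c = l + ((c - a \<bullet> l) / D) *\<^sub>R (r - l)" for c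
        have apt: "a \<bullet> pt c = c" for c using D by (simp add: pt_def inner_add_right inner_diff_right D_def)
        have lrS: "l \<in> convex hull S" "r \<in> convex hull S" using blr(3,4) SLR hull_mono[of L S] hull_mono[of R S] by auto
        have ptC: "pt c \<in> C c" if "x1 \<le> c" "c \<le> x2" for c
        proof -
          define s where "s = (c - a \<bullet> l) / D"
          have s: "0 \<le> s" "s \<le> 1" using that lr D by (auto simp: s_def divide_le_eq) (simp add: D_def)
          have "pt c = (1 - s) *\<^sub>R l + s *\<^sub>R r" unfolding pt_def s_def[symmetric] by (simp add: algebra_simps)
          also have "\<dots> \<in> convex hull S" using s lrS by (intro convexD convex_convex_hull) auto
          finally show ?thesis using apt by (simp add: C_def)
        qed
        have ax: "a \<bullet> y = x" using y by (simp add: C_def)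
        have yb: "y = l + b *\<^sub>R (r - l)" using blr(5) by (simp add: algebra_simps)
        have "b = (x - a \<bullet> l) / D" using ax D unfolding yb by (simp add: inner_add_right inner_diff_right D_def field_simps)
        then have "y = pt x" using yb by (simp add: pt_def)
        also have "pt x = (1 - \<mu>) *\<^sub>R pt x1 + \<mu> *\<^sub>R pt x2"
        proof -
          have "(x - a \<bullet> l) / D = (1 - \<mu>) * ((x1 - a \<bullet> l) / D) + \<mu> * ((x2 - a \<bullet> l) / D)"
            unfolding \<mu>(3) using D by (simp add: field_simps)
          then show ?thesis unfolding pt_def by (simp only:) (simp add: algebra_simps)
        qed
        finally have "?n t y = (1 - \<mu>) * ?n t (pt x1) + \<mu> * ?n t (pt x2)"
          by (simp add: linear_add[OF linear_rotating_functional] linear_cmul[OF linear_rotating_functional])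
        also have "\<dots> \<le> (1 - \<mu>) * ?n t (z x1) + \<mu> * ?n t (z x2)"
          using \<mu> t e(2)[OF x1(1)] e(2)[OF x2(1)] x1 x2
          by (intro add_mono mult_left_mono z(3) ptC) auto
        also have "\<dots> = ?n t w"
          by (simp add: w_def linear_add[OF linear_rotating_functional] linear_cmul[OF linear_rotating_functional])
        finally show ?thesis .
      qed
      ultimately show ?thesis by blast
    qed
  qed
qed

lemma rotating_functional_image_interval:
  assumes "convex C" "z \<in> C" "z' \<in> C"
    "\<And>y. y \<in> C \<Longrightarrow> rotating_functional u v t y \<le> rotating_functional u v t z"
    "\<And>y. y \<in> C \<Longrightarrow> rotating_functional u v t z' \<le> rotating_functional u v t y"
  shows "rotating_functional u v t ` C = {rotating_functional u v t z' .. rotating_functional u v t z}"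
proof
  show "rotating_functional u v t ` C \<subseteq> {rotating_functional u v t z' .. rotating_functional u v t z}"
    using assms by auto
  have "is_interval (rotating_functional u v t ` C)"
    using convex_linear_image[OF linear_rotating_functional assms(1)] by (simp add: is_interval_convex_1)
  then show "{rotating_functional u v t z' .. rotating_functional u v t z} \<subseteq> rotating_functional u v t ` C"
    using assms(2,3) unfolding is_interval_1 by (auto simp: image_iff)
qed

text \<open>
  With fixed extreme points \<open>z\<close> and \<open>z'\<close>, the length is the difference of the values of the
  functional, each of which satisfies the three-term relation.
\<close>
lemma slice_lengths_three_terms:
  fixes S :: "'a::euclidean_space set" and a u v :: 'a
  assumes S: "finite S"
  defines "C x \<equiv> convex hull S \<inter> {z. a \<bullet> z = x}"
  defines "len x t \<equiv> vol (rotating_functional u v t ` C x)"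
  shows "\<exists>\<epsilon>>0. \<forall>x t h. 0 < t - h \<and> 0 \<le> h \<and> t + h < \<epsilon> \<longrightarrow> len x (t + h) + len x (t - h) = 2 * cos h * len x t"
proof -
  let ?n = "rotating_functional u v"
  have neg: "rotating_functional (-u) (-v) t y = - ?n t y" for t y by (simp add: rotating_functional_def)
  obtain \<epsilon>1 where \<epsilon>1: "\<epsilon>1 > 0" "\<And>x. C x \<noteq> {} \<Longrightarrow> \<exists>z\<in>C x. \<forall>t. 0 < t \<and> t < \<epsilon>1 \<longrightarrow> (\<forall>y\<in>C x. ?n t y \<le> ?n t z)"
    using slices_rotating_maximizer[OF S, of a u v] unfolding C_def by blast
  obtain \<epsilon>2 where \<epsilon>2: "\<epsilon>2 > 0" "\<And>x. C x \<noteq> {} \<Longrightarrow> \<exists>z\<in>C x. \<forall>t. 0 < t \<and> t < \<epsilon>2 \<longrightarrow> (\<forall>y\<in>C x. ?n t z \<le> ?n t y)"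
    using slices_rotating_maximizer[OF S, of a "-u" "-v"] unfolding C_def neg neg_le_iff_le by blast
  show ?thesis
  proof (intro exI[of _ "min \<epsilon>1 \<epsilon>2"] conjI allI impI)
    fix x t h assume th: "0 < t - h \<and> 0 \<le> h \<and> t + h < min \<epsilon>1 \<epsilon>2"
    show "len x (t + h) + len x (t - h) = 2 * cos h * len x t"
    proof (cases "C x = {}")
      case True
      then show ?thesis by (simp add: len_def)
    next
      case False
      obtain z where z: "z \<in> C x" "\<And>t y. 0 < t \<Longrightarrow> t < \<epsilon>1 \<Longrightarrow> y \<in> C x \<Longrightarrow> ?n t y \<le> ?n t z"
        using \<epsilon>1(2)[OF False] by blast
      obtain z' where z': "z' \<in> C x" "\<And>t y. 0 < t \<Longrightarrow> t < \<epsilon>2 \<Longrightarrow> y \<in> C x \<Longrightarrow> ?n t z' \<le> ?n t y"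
        using \<epsilon>2(2)[OF False] by blast
      have conv: "convex (C x)" unfolding C_def by (intro convex_Int convex_convex_hull convex_hyperplane)
      have lenD: "len x s = ?n s z - ?n s z'" if "0 < s" "s < min \<epsilon>1 \<epsilon>2" for s
      proof -
        have "?n s ` C x = {?n s z' .. ?n s z}"
          using that z z' by (intro rotating_functional_image_interval conv) auto
        moreover have "?n s z' \<le> ?n s z" using that z z' by auto
        ultimately show ?thesis by (simp add: len_def)
      qed
      have "len x (t + h) + len x (t - h) = (?n (t + h) z + ?n (t - h) z) - (?n (t + h) z' + ?n (t - h) z')"
        using th by (simp add: lenD)
      also have "\<dots> = 2 * cos h * len x t"
        using th by (simp add: rotating_functional_three_terms lenD right_diff_distrib)
      finally show ?thesis .
    qed
  qed (use \<epsilon>1 \<epsilon>2 in simp)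
qed

lemma width_locally_sinusoidal:
  fixes S :: "'a::euclidean_space set"
  assumes S: "finite S"
  shows "locally_sinusoidal (\<lambda>t. vol (rotating_functional u v t ` (convex hull S)))"
proof -
  \<comment> \<open>With \<open>a = 0\<close> the slice at level 0 is the whole hull.\<close>
  have eq: "convex hull S \<inter> {z. 0 \<bullet> z = (0::real)} = convex hull S" by simp
  from slice_lengths_three_terms[OF S, where a = 0 and u = u and v = v]
  obtain \<epsilon> where \<epsilon>: "\<epsilon> > 0" "\<forall>x t h. 0 < t - h \<and> 0 \<le> h \<and> t + h < \<epsilon> \<longrightarrow>
      vol (rotating_functional u v (t + h) ` (convex hull S \<inter> {z. 0 \<bullet> z = x})) +
      vol (rotating_functional u v (t - h) ` (convex hull S \<inter> {z. 0 \<bullet> z = x})) =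
      2 * cos h * vol (rotating_functional u v t ` (convex hull S \<inter> {z. 0 \<bullet> z = x}))"
    by (elim exE conjE) (rule that)
  show ?thesis unfolding locally_sinusoidal_def
    using \<epsilon>(2)[THEN spec[of _ 0], unfolded eq] \<epsilon>(1) by (intro exI[of _ \<epsilon>] conjI)
qed

text \<open>
  The area is the integral of the slice lengths, and these satisfy the three-term relation with a common
  \<open>\<epsilon>\<close>.
\<close>
lemma area_locally_sinusoidal:
  fixes S :: "'a::euclidean_space set"
  assumes S: "finite S"
  shows "locally_sinusoidal (\<lambda>t. vol ((\<lambda>z. (a \<bullet> z, rotating_functional u v t z)) ` (convex hull S)))"
proof -
  let ?n = "rotating_functional u v"
  define C where "C x = convex hull S \<inter> {z. a \<bullet> z = x}" for x
  define A where "A t = (\<lambda>z. (a \<bullet> z, ?n t z)) ` (convex hull S)" for t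
  define slen where "slen t x = vol (?n t ` C x)" for t x
  have cptA: "compact (A t)" for t
  proof -
    have "continuous_on UNIV (\<lambda>z. (a \<bullet> z, ?n t z))"
      unfolding rotating_functional_def by (intro continuous_intros)
    then show ?thesis unfolding A_def
      using S by (intro compact_continuous_image finite_imp_compact_convex_hull) (auto intro: continuous_on_subset)
  qed
  have sA: "A t \<in> sets (lborel \<Otimes>\<^sub>M lborel)" for t
    unfolding lborel_prod sets_lborel using cptA[of t] by (rule borel_compact)
  have slice: "Pair x -` A t = ?n t ` C x" for x t by (auto simp: A_def C_def)
  have ifin: "emeasure lborel (?n t ` C x) \<noteq> \<infinity>" for x t
  proof (rule emeasure_bounded_not_infinite)
    have "?n t ` C x \<subseteq> snd ` A t" by (force simp: A_def C_def)
    then show "bounded (?n t ` C x)"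
      using cptA[of t] by (intro bounded_subset[OF bounded_snd[OF compact_imp_bounded]])
  qed
  have eslen: "emeasure lborel (?n t ` C x) = ennreal (slen t x)" for x t
    unfolding slen_def using ifin[of t x] by (simp add: emeasure_eq_ennreal_measure)
  have meas: "slen t \<in> borel_measurable lborel" for t
  proof -
    have "(\<lambda>x. emeasure lborel (Pair x -` A t)) \<in> borel_measurable lborel"
      by (rule lborel.measurable_emeasure_Pair[OF sA])
    then have "(\<lambda>x. enn2real (emeasure lborel (Pair x -` A t))) \<in> borel_measurable lborel" by measurable
    moreover have "(\<lambda>x. enn2real (emeasure lborel (Pair x -` A t))) = slen t"
      by (rule ext) (simp add: slice slen_def measure_def)
    ultimately show ?thesis by simp
  qed
  have em: "emeasure lborel (A t) = (\<integral>\<^sup>+x. ennreal (slen t x) \<partial>lborel)" for t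
  proof -
    have "emeasure lborel (A t) = emeasure (lborel \<Otimes>\<^sub>M lborel) (A t)" by (simp only: lborel_prod)
    also have "\<dots> = (\<integral>\<^sup>+x. emeasure lborel (Pair x -` A t) \<partial>lborel)"
      by (rule lborel.emeasure_pair_measure_alt[OF sA])
    finally show ?thesis by (simp only: slice eslen)
  qed
  have fin: "emeasure lborel (A t) \<noteq> \<infinity>" for t
    using cptA by (intro emeasure_bounded_not_infinite compact_imp_bounded)
  have int: "integrable lborel (slen t)" for t
    using em[of t] fin[of t] meas[of t] by (intro integrableI_nonneg) (auto simp: slen_def less_top[symmetric])
  have area: "vol (A t) = (\<integral>x. slen t x \<partial>lborel)" for t
    using em[of t] meas[of t] by (subst integral_eq_nn_integral) (auto simp: measure_def slen_def)
  have "\<exists>\<epsilon>>0. \<forall>x t h. 0 < t - h \<and> 0 \<le> h \<and> t + h < \<epsilon> \<longrightarrow> slen (t + h) x + slen (t - h) x = 2 * cos h * slen t x"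
    unfolding slen_def C_def by (rule slice_lengths_three_terms[OF S])
  then obtain \<epsilon> where \<epsilon>: "\<epsilon> > 0"
      "\<forall>x t h. 0 < t - h \<and> 0 \<le> h \<and> t + h < \<epsilon> \<longrightarrow> slen (t + h) x + slen (t - h) x = 2 * cos h * slen t x"
    by (elim exE conjE) (rule that)
  have three: "vol (A (t + h)) + vol (A (t - h)) = 2 * cos h * vol (A t)"
    if "0 < t - h \<and> 0 \<le> h \<and> t + h < \<epsilon>" for t h
  proof -
    have "vol (A (t + h)) + vol (A (t - h)) = (\<integral>x. slen (t + h) x + slen (t - h) x \<partial>lborel)"
      by (simp only: area Bochner_Integration.integral_add[OF int int])
    also have "\<dots> = (\<integral>x. 2 * cos h * slen t x \<partial>lborel)" by (simp only: \<epsilon>(2)[rule_format, OF that])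
    also have "\<dots> = 2 * cos h * vol (A t)" by (simp only: area integral_mult_right_zero)
    finally show ?thesis .
  qed
  have "locally_sinusoidal (\<lambda>t. vol (A t))"
    unfolding locally_sinusoidal_def
  proof (intro exI[of _ \<epsilon>] conjI \<epsilon>(1) allI impI)
    fix t h assume "0 < t - h \<and> 0 \<le> h \<and> t + h < \<epsilon>"
    then show "vol (A (t + h)) + vol (A (t - h)) = 2 * cos h * vol (A t)"
      by (rule three)
  qed
  then show ?thesis unfolding A_def .
qed

section \<open>Averages over the cell of the lattice\<close>

text \<open>
  The linear isomorphism that takes the standard lattice and cube to the given lattice and cell.
\<close>
definition from_coords :: "('d::finite \<Rightarrow> real ^ 'd) \<Rightarrow> real ^ 'd \<Rightarrow> real ^ 'd" where
  "from_coords \<xi> x = (\<Sum>i\<in>UNIV. x $ i *\<^sub>R \<xi> i)"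

lemma linear_from_coords: "linear (from_coords \<xi>)"
  unfolding from_coords_def by (intro linearI) (simp_all add: scaleR_add_left sum.distrib scaleR_sum_right)

lemma from_coords_inverse:
  assumes "positively_oriented_basis \<xi>"
  obtains N where "linear N" "\<And>x. N (from_coords \<xi> x) = x" "\<And>x. from_coords \<xi> (N x) = x"
proof -
  have "matrix (from_coords \<xi>) = transpose (\<chi> i. \<xi> i)"
    unfolding matrix_def transpose_def
    by (simp add: vec_eq_iff from_coords_def axis_def if_distrib if_distribR cong: if_cong)
  then have "det (matrix (from_coords \<xi>)) \<noteq> 0"
    using assms by (simp add: positively_oriented_basis_def)
  then have "invertible (matrix (from_coords \<xi>))" by (simp add: invertible_det_nz)
  then obtain N where "linear N" "from_coords \<xi> \<circ> N = id" "N \<circ> from_coords \<xi> = id"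
    using matrix_invertible[OF linear_from_coords] by blast
  then show thesis by (intro that[of N]) (auto simp: fun_eq_iff)
qed

lemma lattice_of_eq_from_coords: "lattice_of \<xi> = range (\<lambda>k. from_coords \<xi> (\<chi> i. of_int (k i)))"
  by (simp add: lattice_of_def from_coords_def)

lemma unit_cell_eq_coords:
  assumes "\<And>x. N (from_coords \<xi> x) = x" "\<And>x. from_coords \<xi> (N x) = x"
  shows "unit_cell \<xi> = {x. \<forall>i. 0 \<le> N x $ i \<and> N x $ i \<le> 1}"
proof (intro equalityI subsetI)
  fix x assume "x \<in> unit_cell \<xi>"
  then obtain t where t: "x = (\<Sum>i\<in>UNIV. t i *\<^sub>R \<xi> i)" "\<forall>i. 0 \<le> t i \<and> t i \<le> 1" by (auto simp: unit_cell_def)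
  then have "x = from_coords \<xi> (\<chi> i. t i)" by (simp add: from_coords_def)
  then show "x \<in> {x. \<forall>i. 0 \<le> N x $ i \<and> N x $ i \<le> 1}" using t(2) by (simp add: assms(1))
next
  fix x assume x: "x \<in> {x. \<forall>i. 0 \<le> N x $ i \<and> N x $ i \<le> 1}"
  have "x = (\<Sum>i\<in>UNIV. N x $ i *\<^sub>R \<xi> i)" using assms(2)[of x] by (simp add: from_coords_def)
  then show "x \<in> unit_cell \<xi>" using x unfolding unit_cell_def by blast
qed

lemma countable_lattice: "countable (lattice_of \<xi>)"
proof -
  have "countable (UNIV :: ('d::finite \<Rightarrow> int) set)"
  proof -
    have "countable (PiE (UNIV :: 'd set) (\<lambda>_. UNIV :: int set))" by (intro countable_PiE) auto
    then show ?thesis by simp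
  qed
  then show ?thesis unfolding lattice_of_def by (rule countable_image)
qed

lemma finite_lattice_bounded:
  assumes \<xi>: "positively_oriented_basis \<xi>" and S: "bounded S"
  shows "finite (lattice_of \<xi> \<inter> S)"
proof -
  obtain N where N: "linear N" "\<And>x. N (from_coords \<xi> x) = x" "\<And>x. from_coords \<xi> (N x) = x"
    by (rule from_coords_inverse[OF \<xi>]) (rule that)
  have "bounded (N ` S)" using S N(1) by (intro bounded_linear_image) (simp_all add: linear_conv_bounded_linear)
  then obtain C where C: "\<And>x. x \<in> S \<Longrightarrow> norm (N x) \<le> C" unfolding bounded_iff by blast
  let ?K = "PiE (UNIV :: 'a set) (\<lambda>_. {-\<lceil>C\<rceil>..\<lceil>C\<rceil>})"
  have "lattice_of \<xi> \<inter> S \<subseteq> (\<lambda>k. from_coords \<xi> (\<chi> i. of_int (k i))) ` ?K"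
  proof
    fix z assume z: "z \<in> lattice_of \<xi> \<inter> S"
    then obtain k where k: "z = from_coords \<xi> (\<chi> i. of_int (k i))" by (auto simp: lattice_of_eq_from_coords)
    have "k i \<in> {-\<lceil>C\<rceil>..\<lceil>C\<rceil>}" for i
    proof -
      have "\<bar>real_of_int (k i)\<bar> \<le> norm (N z)"
        using component_le_norm_cart[of "N z" i] k N(2) by simp
      also have "\<dots> \<le> C" using C z by auto
      finally show ?thesis by (auto simp: abs_le_iff) linarith+
    qed
    then show "z \<in> (\<lambda>k. from_coords \<xi> (\<chi> i. of_int (k i))) ` ?K" using k by (intro image_eqI[of _ _ k]) auto
  qed
  moreover have "finite ?K" by (intro finite_PiE) auto
  ultimately show ?thesis using finite_subset by blast
qed

lemma compact_unit_cell: "compact (unit_cell \<xi>)"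
proof -
  have "unit_cell \<xi> = from_coords \<xi> ` cbox 0 (\<chi> i. 1)"
  proof (intro equalityI subsetI)
    fix x assume "x \<in> unit_cell \<xi>"
    then obtain t where "x = (\<Sum>i\<in>UNIV. t i *\<^sub>R \<xi> i)" "\<forall>i. 0 \<le> t i \<and> t i \<le> 1" by (auto simp: unit_cell_def)
    then show "x \<in> from_coords \<xi> ` cbox 0 (\<chi> i. 1)"
      by (intro image_eqI[of _ _ "\<chi> i. t i"]) (auto simp: from_coords_def mem_box_cart)
  next
    fix x assume "x \<in> from_coords \<xi> ` cbox 0 (\<chi> i. 1)"
    then obtain y where "y \<in> cbox 0 (\<chi> i. 1)" "x = from_coords \<xi> y" by blast
    then show "x \<in> unit_cell \<xi>" unfolding unit_cell_def from_coords_def mem_box_cart by auto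
  qed
  then show ?thesis
    by (simp add: compact_continuous_image linear_continuous_on linear_conv_bounded_linear[symmetric] linear_from_coords)
qed

lemma card_integer_translates:
  fixes y :: "'d::finite \<Rightarrow> real"
  shows "card {k :: 'd \<Rightarrow> int. \<forall>i. 0 \<le> y i - of_int (k i) \<and> y i - of_int (k i) < real m} = m ^ CARD('d)"
proof -
  have "{k :: 'd \<Rightarrow> int. \<forall>i. 0 \<le> y i - of_int (k i) \<and> y i - of_int (k i) < real m}
      = PiE UNIV (\<lambda>i. {\<lfloor>y i\<rfloor> - int m + 1..\<lfloor>y i\<rfloor>})"
  proof -
    have "0 \<le> y i - of_int j \<and> y i - of_int j < real m \<longleftrightarrow> j \<in> {\<lfloor>y i\<rfloor> - int m + 1..\<lfloor>y i\<rfloor>}" for i j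
    proof -
      have "0 \<le> y i - of_int j \<longleftrightarrow> j \<le> \<lfloor>y i\<rfloor>" by (simp add: le_floor_iff)
      moreover have "y i - of_int j < real m \<longleftrightarrow> \<lfloor>y i\<rfloor> < j + int m"
        unfolding floor_less_iff by auto
      ultimately show ?thesis by auto
    qed
    then show ?thesis by (auto simp: PiE_UNIV_domain Pi_def)
  qed
  also have "card \<dots> = (\<Prod>i\<in>(UNIV :: 'd set). card {\<lfloor>y i\<rfloor> - int m + 1..\<lfloor>y i\<rfloor>})" by (rule card_PiE) simp
  also have "\<dots> = m ^ CARD('d)" by simp
  finally show ?thesis .
qed

lemma borel_measurable_nn_integral_count_space:
  fixes f :: "'i \<Rightarrow> 'a \<Rightarrow> ennreal"
  assumes I: "countable I" and [measurable]: "\<And>i. i \<in> I \<Longrightarrow> f i \<in> borel_measurable M"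
  shows "(\<lambda>x. \<integral>\<^sup>+i. f i x \<partial>count_space I) \<in> borel_measurable M"
proof (cases "finite I")
  case True
  then show ?thesis by (simp add: nn_integral_count_space_finite)
next
  case False
  then have [simp]: "I \<noteq> {}" by auto
  note * = bij_betw_from_nat_into[OF I False]
  have "(\<integral>\<^sup>+i. f i x \<partial>count_space I) = (\<Sum>n. f (from_nat_into I n) x)" for x
    by (simp add: nn_integral_bij_count_space[symmetric, OF *] nn_integral_count_space_nat)
  then show ?thesis by (simp add: from_nat_into)
qed

text \<open>
  The translates of the cell by \<open>z / m\<close> with \<open>z\<close> in the lattice cover every point
  \<open>m ^ d\<close> times, up to a null set. The case \<open>m = 1\<close> is the average over a uniformly
  random translation of the lattice; larger \<open>m\<close> is the average over a translation of \<open>X\<close>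
  that is large compared to the mesh \<open>1 / m\<close>.
\<close>
lemma cell_average:
  fixes \<xi> :: "'d::finite \<Rightarrow> real ^ 'd"
  assumes \<xi>: "positively_oriented_basis \<xi>" and m: "0 < m" and Q: "Q \<in> sets borel" "bounded Q"
  defines "f \<equiv> \<lambda>y. real (card {z \<in> lattice_of \<xi>. (1 / real m) *\<^sub>R z + y \<in> Q})"
  shows "integrable lborel (\<lambda>y. indicator (unit_cell \<xi>) y * f y)"
    and "(\<integral>y. indicator (unit_cell \<xi>) y * f y \<partial>lborel) = real m ^ CARD('d) * vol Q"
    and "f \<in> borel_measurable borel"
proof -
  obtain N where N: "linear N" "\<And>x. N (from_coords \<xi> x) = x" "\<And>x. from_coords \<xi> (N x) = x"
    by (rule from_coords_inverse[OF \<xi>]) (rule that)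
  let ?L = "lattice_of \<xi>" and ?C = "unit_cell \<xi>"
  \<comment> \<open>The half-open cell covers without overlap and differs from the closed cell by a null set.\<close>
  define C0 where "C0 = {x. \<forall>i. 0 \<le> N x $ i \<and> N x $ i < 1}"
  have contN: "continuous_on UNIV N" using N(1) by (simp add: linear_continuous_on linear_conv_bounded_linear)
  have C0_meas[measurable]: "C0 \<in> sets borel"
  proof -
    have "C0 = (\<Inter>i. {x. 0 \<le> N x $ i} \<inter> {x. N x $ i < 1})" by (auto simp: C0_def)
    also have "\<dots> \<in> sets borel"
      by (intro sets.countable_INT'' sets.Int borel_closed borel_open closed_Collect_le open_Collect_less continuous_intros contN) auto
    finally show ?thesis .
  qed
  have C_eq: "?C = {x. \<forall>i. 0 \<le> N x $ i \<and> N x $ i \<le> 1}" by (rule unit_cell_eq_coords[OF N(2,3)])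
  have null: "AE x in lborel. x \<in> ?C \<longleftrightarrow> x \<in> C0"
  proof -
    define H where "H = (\<Union>i. {x. adjoint N (axis i 1) \<bullet> x = 1})"
    have "negligible H"
      unfolding H_def by (intro negligible_Union) (auto intro: negligible_hyperplane)
    moreover have "closed H"
      unfolding H_def by (intro closed_UN ballI closed_hyperplane) auto
    ultimately have "H \<in> null_sets lborel"
      by (simp add: negligible_iff_null_sets null_sets_completion_iff borel_closed)
    then have "AE x in lborel. x \<notin> H" by (rule AE_not_in)
    moreover have "adjoint N (axis i 1) \<bullet> x = N x $ i" for i x
      using adjoint_works[OF N(1), of x "axis i 1"] by (simp add: inner_commute cart_eq_inner_axis)
    ultimately have "AE x in lborel. \<forall>i. N x $ i \<noteq> 1" by (simp add: H_def)
    then show ?thesis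
    proof eventually_elim
      case (elim x)
      then show ?case unfolding C_eq C0_def by (auto simp: less_le)
    qed
  qed
  have cL: "countable ?L" by (rule countable_lattice)
  note [measurable] = Q(1)
  have fin: "finite {z \<in> ?L. (1 / real m) *\<^sub>R z + y \<in> Q}" for y
  proof -
    have "{z \<in> ?L. (1 / real m) *\<^sub>R z + y \<in> Q} \<subseteq> ?L \<inter> (\<lambda>x. real m *\<^sub>R (x - y)) ` Q"
      using m by (auto intro!: image_eqI[of _ _ "(1 / real m) *\<^sub>R _ + y"])
    moreover have "bounded ((\<lambda>x. real m *\<^sub>R (x - y)) ` Q)"
    proof -
      have "bounded ((\<lambda>x. real m *\<^sub>R x) ` ((\<lambda>x. x - y) ` Q))"
        using Q(2) by (intro bounded_scaling bounded_translation_minus)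
      then show ?thesis by (simp add: image_image)
    qed
    ultimately show ?thesis using finite_lattice_bounded[OF \<xi>] finite_subset by blast
  qed
  have ef: "ennreal (f y) = (\<integral>\<^sup>+z. indicator Q ((1 / real m) *\<^sub>R z + y) \<partial>count_space ?L)" for y
  proof -
    have "(\<integral>\<^sup>+z. indicator Q ((1 / real m) *\<^sub>R z + y) \<partial>count_space ?L)
       = (\<integral>\<^sup>+z. indicator {z \<in> ?L. (1 / real m) *\<^sub>R z + y \<in> Q} z \<partial>count_space ?L)"
      by (intro nn_integral_cong) (auto simp: indicator_def)
    also have "\<dots> = emeasure (count_space ?L) {z \<in> ?L. (1 / real m) *\<^sub>R z + y \<in> Q}"
      by (intro nn_integral_indicator) auto
    also have "\<dots> = of_nat (card {z \<in> ?L. (1 / real m) *\<^sub>R z + y \<in> Q})"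
      using fin by (intro emeasure_count_space_finite) auto
    finally show ?thesis by (simp add: f_def ennreal_of_nat_eq_real_of_nat)
  qed
  have covering: "(\<integral>\<^sup>+z. indicator C0 (x - (1 / real m) *\<^sub>R z) \<partial>count_space ?L) = ennreal (real m ^ CARD('d))" for x
  proof -
    let ?K = "{k :: 'd \<Rightarrow> int. \<forall>i. 0 \<le> real m * N x $ i - of_int (k i) \<and> real m * N x $ i - of_int (k i) < real m}"
    let ?F = "\<lambda>k. from_coords \<xi> (\<chi> i. of_int (k i))"
    have injF: "inj ?F"
    proof (rule injI)
      fix k k' assume "?F k = ?F k'"
      then have "(\<chi> i. real_of_int (k i)) = (\<chi> i. of_int (k' i))" by (metis N(2))
      then show "k = k'" by (simp add: vec_eq_iff fun_eq_iff)
    qed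
    have mem: "x - (1 / real m) *\<^sub>R ?F k \<in> C0 \<longleftrightarrow> k \<in> ?K" for k
    proof -
      have "N (x - (1 / real m) *\<^sub>R ?F k) $ i = N x $ i - of_int (k i) / real m" for i
        by (simp add: linear_diff[OF N(1)] linear_cmul[OF N(1)] N(2))
      moreover have "0 \<le> N x $ i - of_int (k i) / real m \<longleftrightarrow> 0 \<le> real m * N x $ i - of_int (k i)"
        "N x $ i - of_int (k i) / real m < 1 \<longleftrightarrow> real m * N x $ i - of_int (k i) < real m" for i
        using m by (auto simp: field_simps)
      ultimately show ?thesis by (simp add: C0_def)
    qed
    have set_eq: "{z \<in> ?L. x - (1 / real m) *\<^sub>R z \<in> C0} = ?F ` ?K"
      unfolding lattice_of_eq_from_coords using mem by blast
    have cK: "card (?F ` ?K) = m ^ CARD('d)"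
      using card_integer_translates[of "\<lambda>i. real m * N x $ i" m] injF by (subst card_image) (auto intro: inj_on_subset)
    then have fK: "finite (?F ` ?K)" using m by (intro card_ge_0_finite) simp
    have "(\<integral>\<^sup>+z. indicator C0 (x - (1 / real m) *\<^sub>R z) \<partial>count_space ?L)
       = (\<integral>\<^sup>+z. indicator {z \<in> ?L. x - (1 / real m) *\<^sub>R z \<in> C0} z \<partial>count_space ?L)"
      by (intro nn_integral_cong) (auto simp: indicator_def)
    also have "\<dots> = emeasure (count_space ?L) {z \<in> ?L. x - (1 / real m) *\<^sub>R z \<in> C0}"
      by (intro nn_integral_indicator) auto
    also have "\<dots> = of_nat (card (?F ` ?K))"
      unfolding set_eq using fK by (intro emeasure_count_space_finite) (auto simp: lattice_of_eq_from_coords)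
    finally show ?thesis unfolding cK by (simp add: ennreal_of_nat_eq_real_of_nat)
  qed
  have fmeas: "(\<lambda>y. ennreal (f y)) \<in> borel_measurable borel"
    unfolding ef using cL by (intro borel_measurable_nn_integral_count_space) auto
  then have "(\<lambda>y. enn2real (ennreal (f y))) \<in> borel_measurable borel" by measurable
  then show f_meas[measurable]: "f \<in> borel_measurable borel" by (simp add: f_def)
  have "(\<integral>\<^sup>+y. ennreal (indicator ?C y * f y) \<partial>lborel) = (\<integral>\<^sup>+y. indicator C0 y * ennreal (f y) \<partial>lborel)"
    using null by (intro nn_integral_cong_AE) (auto elim!: eventually_mono simp: indicator_def)
  also have "\<dots> = (\<integral>\<^sup>+y. (\<integral>\<^sup>+z. indicator C0 y * indicator Q ((1 / real m) *\<^sub>R z + y) \<partial>count_space ?L) \<partial>lborel)"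
    unfolding ef by (subst nn_integral_cmult) auto
  also have "\<dots> = (\<integral>\<^sup>+z. (\<integral>\<^sup>+y. indicator C0 y * indicator Q ((1 / real m) *\<^sub>R z + y) \<partial>lborel) \<partial>count_space ?L)"
    by (rule nn_integral_count_space_nn_integral[OF cL]) measurable
  also have "\<dots> = (\<integral>\<^sup>+z. (\<integral>\<^sup>+x. indicator Q x * indicator C0 (x - (1 / real m) *\<^sub>R z) \<partial>lborel) \<partial>count_space ?L)"
  proof (rule nn_integral_cong)
    fix z :: "real ^ 'd"
    let ?v = "(1 / real m) *\<^sub>R z"
    have "(\<integral>\<^sup>+x. (indicator Q x * indicator C0 (x - ?v) :: ennreal) \<partial>lborel)
        = (\<integral>\<^sup>+x. indicator Q x * indicator C0 (x - ?v) \<partial>distr lborel borel ((+) ?v))"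
      by (simp add: lborel_distr_plus)
    also have "\<dots> = (\<integral>\<^sup>+y. indicator C0 y * indicator Q (?v + y) \<partial>lborel)"
      by (subst nn_integral_distr) (auto simp: mult.commute)
    finally show "(\<integral>\<^sup>+y. (indicator C0 y * indicator Q (?v + y) :: ennreal) \<partial>lborel)
      = (\<integral>\<^sup>+x. indicator Q x * indicator C0 (x - ?v) \<partial>lborel)" by simp
  qed
  also have "\<dots> = (\<integral>\<^sup>+x. (\<integral>\<^sup>+z. indicator Q x * indicator C0 (x - (1 / real m) *\<^sub>R z) \<partial>count_space ?L) \<partial>lborel)"
    by (rule nn_integral_count_space_nn_integral[OF cL, symmetric]) measurable
  also have "\<dots> = (\<integral>\<^sup>+x. indicator Q x * ennreal (real m ^ CARD('d)) \<partial>lborel)"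
    by (subst nn_integral_cmult) (simp_all add: covering)
  also have "\<dots> = emeasure lborel Q * ennreal (real m ^ CARD('d))"
    by (subst nn_integral_multc) auto
  also have "\<dots> = ennreal (real m ^ CARD('d) * vol Q)"
    using emeasure_bounded_not_infinite[OF Q(2)] by (simp add: emeasure_eq_ennreal_measure ennreal_mult mult.commute)
  finally have main: "(\<integral>\<^sup>+y. ennreal (indicator ?C y * f y) \<partial>lborel) = ennreal (real m ^ CARD('d) * vol Q)" .
  have [measurable]: "?C \<in> sets borel" by (rule borel_compact[OF compact_unit_cell])
  have nonneg: "0 \<le> indicator ?C y * f y" for y by (simp add: f_def indicator_def)
  have meas: "(\<lambda>y. indicator ?C y * f y) \<in> borel_measurable lborel" by measurable
  show "integrable lborel (\<lambda>y. indicator ?C y * f y)"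
    using main nonneg by (intro integrableI_nonneg meas) auto
  show "(\<integral>y. indicator ?C y * f y \<partial>lborel) = real m ^ CARD('d) * vol Q"
    using main nonneg by (subst integral_eq_nn_integral[OF meas]) auto
qed

lemma measure_unit_cell_pos:
  assumes \<xi>: "positively_oriented_basis \<xi>" shows "0 < vol (unit_cell \<xi>)"
proof -
  obtain N where N: "linear N" "\<And>x. N (from_coords \<xi> x) = x" "\<And>x. from_coords \<xi> (N x) = x"
    by (rule from_coords_inverse[OF \<xi>]) (rule that)
  let ?U = "{x. \<forall>i. 0 < N x $ i \<and> N x $ i < 1}"
  have contN: "continuous_on UNIV N" using N(1) by (simp add: linear_continuous_on linear_conv_bounded_linear)
  have "?U = (\<Inter>i. {x. 0 < N x $ i} \<inter> {x. N x $ i < 1})" by auto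
  also have "open \<dots>" by (intro open_INT ballI open_Int open_Collect_less continuous_intros contN) auto
  finally have "open ?U" .
  moreover have "from_coords \<xi> (\<chi> i. 1 / 2) \<in> ?U" by (simp add: N(2))
  ultimately obtain e where e: "e > 0" "ball (from_coords \<xi> (\<chi> i. 1 / 2)) e \<subseteq> ?U"
    using open_contains_ball by blast
  moreover have "?U \<subseteq> unit_cell \<xi>" unfolding unit_cell_eq_coords[OF N(2,3)] by (auto simp: less_imp_le)
  ultimately have "ball (from_coords \<xi> (\<chi> i. 1 / 2)) e \<subseteq> unit_cell \<xi>" by blast
  then have "vol (ball (from_coords \<xi> (\<chi> i. 1 / 2)) e) \<le> vol (unit_cell \<xi>)"
    by (intro measure_mono_fmeasurable fmeasurable_compact compact_unit_cell) auto
  moreover have "0 < vol (ball (from_coords \<xi> (\<chi> i. 1 / 2)) e)" using e(1) by (rule content_ball_pos)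
  ultimately show ?thesis by linarith
qed

section \<open>Inclusion-exclusion for configurations\<close>

lemma alternating_Pow_sum:
  assumes "finite A" shows "(\<Sum>T\<in>Pow A. (-1 :: real) ^ card T) = (if A = {} then 1 else 0)"
  using assms
proof (induction A)
  case (insert x A)
  have "(\<Sum>T\<in>Pow (insert x A). (-1 :: real) ^ card T) = (\<Sum>T\<in>Pow A. (-1) ^ card T) + (\<Sum>T\<in>insert x ` Pow A. (-1) ^ card T)"
    unfolding Pow_insert using insert by (intro sum.union_disjoint) auto
  also have "(\<Sum>T\<in>insert x ` Pow A. (-1 :: real) ^ card T) = (\<Sum>T\<in>Pow A. (-1) ^ card (insert x T))"
    using insert by (subst sum.reindex) (auto simp: inj_on_def)
  also have "\<dots> = (\<Sum>T\<in>Pow A. - ((-1) ^ card T))"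
  proof (rule sum.cong[OF refl])
    fix T assume "T \<in> Pow A"
    then have "x \<notin> T" "finite T" using insert finite_subset[of T A] by auto
    then show "(-1 :: real) ^ card (insert x T) = - ((-1) ^ card T)" by simp
  qed
  finally show ?case by (simp add: sum_negf)
qed simp

definition hit_set :: "'a::real_vector set \<Rightarrow> real \<Rightarrow> 'a set \<Rightarrow> 'a set" where
  "hit_set X a S = {x. \<exists>p\<in>S. x + a *\<^sub>R p \<in> X}"

definition fit_set :: "'a::real_vector set \<Rightarrow> real \<Rightarrow> 'a set \<Rightarrow> 'a set \<Rightarrow> 'a set" where
  "fit_set X a B W = {x. (\<forall>b\<in>B. x + a *\<^sub>R b \<in> X) \<and> (\<forall>p\<in>W. x + a *\<^sub>R p \<notin> X)}"

lemma closed_translate_vimage: "closed X \<Longrightarrow> closed {x. x + v \<in> X}" for X :: "'a::real_normed_vector set"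
  using continuous_closed_vimage[of X "\<lambda>x. x + v"] by (simp add: vimage_def continuous_intros)

lemma sets_hit_set: "finite S \<Longrightarrow> closed X \<Longrightarrow> hit_set X a S \<in> sets borel" for X :: "'a::euclidean_space set"
proof -
  assume "finite S" "closed X"
  moreover have "hit_set X a S = (\<Union>p\<in>S. {x. x + a *\<^sub>R p \<in> X})" by (auto simp: hit_set_def)
  ultimately show ?thesis by (simp add: borel_closed closed_UN closed_translate_vimage)
qed

lemma bounded_hit_set:
  fixes X :: "'a::euclidean_space set"
  assumes "finite S" "bounded X" shows "bounded (hit_set X a S)"
proof -
  have "hit_set X a S = (\<Union>p\<in>S. (\<lambda>x. x - a *\<^sub>R p) ` X)"
    by (force simp: hit_set_def image_iff intro: exI[of _ "_ + a *\<^sub>R _"])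
  then show ?thesis using assms by (simp add: bounded_UN bounded_translation_minus)
qed

lemma sets_fit_set:
  fixes X :: "'a::euclidean_space set"
  assumes "finite B" "finite W" "closed X" shows "fit_set X a B W \<in> sets borel"
proof -
  have "fit_set X a B W = (\<Inter>b\<in>B. {x. x + a *\<^sub>R b \<in> X}) - hit_set X a W" by (auto simp: fit_set_def hit_set_def)
  moreover have "closed (\<Inter>b\<in>B. {x. x + a *\<^sub>R b \<in> X})" using assms by (intro closed_INT ballI closed_translate_vimage)
  ultimately show ?thesis using assms by (simp add: borel_closed sets_hit_set sets.Diff)
qed

lemma fit_set_subset_hit_set: "B \<noteq> {} \<Longrightarrow> fit_set X a B W \<subseteq> hit_set X a B"
  by (auto simp: fit_set_def hit_set_def)

text \<open>
  Let \<open>M\<close> be the set of black points that miss \<open>X\<close> at the position \<open>x\<close>. A set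
  \<open>T \<union> W\<close> fails to hit exactly if \<open>T \<subseteq> M\<close> and \<open>W\<close> does not
  hit, and the alternating sum over \<open>T \<subseteq> M\<close> vanishes unless \<open>M\<close> is empty.
  Nonemptiness of \<open>B\<close> removes the constant term.
\<close>
lemma measure_fit_set:
  fixes X :: "'a::euclidean_space set"
  assumes B: "finite B" "B \<noteq> {}" and W: "finite W" and X: "compact X"
  shows "vol (fit_set X a B W) = (\<Sum>T\<in>Pow B. (-1) ^ (card T + 1) * vol (hit_set X a (T \<union> W)))"
proof -
  have cl: "closed X" and bd: "bounded X" using X by (auto simp: compact_imp_closed compact_imp_bounded)
  have pt: "indicator (fit_set X a B W) x = (\<Sum>T\<in>Pow B. (-1) ^ (card T + 1) * indicator (hit_set X a (T \<union> W)) x :: real)" for x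
  proof -
    define M where "M = {b \<in> B. x + a *\<^sub>R b \<notin> X}"
    define hw :: real where "hw = (if \<exists>p\<in>W. x + a *\<^sub>R p \<in> X then 0 else 1)"
    have "(\<Sum>T\<in>Pow B. (-1) ^ (card T + 1) * indicator (hit_set X a (T \<union> W)) x :: real)
       = (\<Sum>T\<in>Pow B. (-1) ^ (card T + 1) + hw * (if T \<in> Pow M then (-1) ^ card T else 0))"
      by (rule sum.cong) (auto simp: hit_set_def indicator_def M_def hw_def)
    also have "\<dots> = - (\<Sum>T\<in>Pow B. (-1) ^ card T) + hw * (\<Sum>T\<in>Pow B. if T \<in> Pow M then (-1) ^ card T else 0)"
      by (simp add: sum.distrib sum_subtractf sum_negf sum_distrib_left)
    also have "(\<Sum>T\<in>Pow B. if T \<in> Pow M then (-1 :: real) ^ card T else 0) = (\<Sum>T\<in>Pow M. (-1) ^ card T)"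
    proof -
      have "Pow B \<inter> Pow M = Pow M" by (auto simp: M_def)
      then show ?thesis using B(1) by (simp add: sum.inter_restrict[symmetric] del: Pow_iff)
    qed
    also have "\<dots> = (if M = {} then 1 else 0)" using B by (intro alternating_Pow_sum) (auto simp: M_def)
    also have "(\<Sum>T\<in>Pow B. (-1 :: real) ^ card T) = 0" using B alternating_Pow_sum[of B] by simp
    finally show ?thesis by (auto simp: indicator_def fit_set_def M_def hw_def)
  qed
  have fin: "finite (T \<union> W)" if "T \<in> Pow B" for T using that B W by (auto intro: finite_subset)
  have int: "integrable lborel (\<lambda>x. indicator (hit_set X a (T \<union> W)) x :: real)" if "T \<in> Pow B" for T
    using sets_hit_set[OF fin[OF that] cl] emeasure_bounded_finite[OF bounded_hit_set[OF fin[OF that] bd]]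
    by (intro integrable_real_indicator) auto
  have "vol (fit_set X a B W) = (\<integral>x. indicator (fit_set X a B W) x \<partial>lborel)" by simp
  also have "\<dots> = (\<Sum>T\<in>Pow B. (\<integral>x. (-1) ^ (card T + 1) * indicator (hit_set X a (T \<union> W)) x \<partial>lborel))"
    unfolding pt using int by (intro Bochner_Integration.integral_sum) auto
  also have "\<dots> = (\<Sum>T\<in>Pow B. (-1) ^ (card T + 1) * vol (hit_set X a (T \<union> W)))"
    using int by (intro sum.cong) auto
  finally show ?thesis .
qed

section \<open>From multigrid convergence to convergence of the mean\<close>

lemma lattice_add:
  assumes "z \<in> lattice_of \<xi>" "z' \<in> lattice_of \<xi>" shows "z + z' \<in> lattice_of \<xi>"
proof -
  obtain k k' :: "'a \<Rightarrow> int" where "z = (\<Sum>i\<in>UNIV. of_int (k i) *\<^sub>R \<xi> i)" "z' = (\<Sum>i\<in>UNIV. of_int (k' i) *\<^sub>R \<xi> i)"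
    using assms by (auto simp: lattice_of_def)
  then have "z + z' = (\<Sum>i\<in>UNIV. of_int (k i + k' i) *\<^sub>R \<xi> i)" by (simp add: sum.distrib scaleR_add_left)
  then show ?thesis unfolding lattice_of_def by (intro image_eqI[of _ _ "\<lambda>i. k i + k' i"]) auto
qed

lemma lattice_uminus:
  assumes "z \<in> lattice_of \<xi>" shows "- z \<in> lattice_of \<xi>"
proof -
  obtain k :: "'a \<Rightarrow> int" where "z = (\<Sum>i\<in>UNIV. of_int (k i) *\<^sub>R \<xi> i)"
    using assms by (auto simp: lattice_of_def)
  then have "- z = (\<Sum>i\<in>UNIV. of_int (- k i) *\<^sub>R \<xi> i)" by (simp add: sum_negf)
  then show ?thesis unfolding lattice_of_def by (intro image_eqI[of _ _ "\<lambda>i. - k i"]) auto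
qed

lemma config_cell_subset_lattice: "config_cell \<xi> n \<subseteq> lattice_of \<xi>"
proof
  fix z assume "z \<in> config_cell \<xi> n"
  then obtain k :: "'a \<Rightarrow> nat" where "z = (\<Sum>i\<in>UNIV. real (k i) *\<^sub>R \<xi> i)" by (auto simp: config_cell_def)
  then show "z \<in> lattice_of \<xi>" unfolding lattice_of_def by (intro image_eqI[of _ _ "\<lambda>i. int (k i)"]) auto
qed

lemma finite_config_cell: "finite (config_cell \<xi> n)"
proof -
  have "config_cell \<xi> n = (\<lambda>k. \<Sum>i\<in>UNIV. real (k i) *\<^sub>R \<xi> i) ` PiE (UNIV :: 'a set) (\<lambda>_. {..<n})"
    by (auto simp: config_cell_def PiE_UNIV_domain Pi_def image_def)
  then show ?thesis by (simp add: finite_PiE)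
qed

lemma lattice_covering_radius:
  assumes \<xi>: "positively_oriented_basis \<xi>"
  obtains R where "\<And>x. \<exists>z\<in>lattice_of \<xi>. norm (x - z) \<le> R"
proof -
  obtain N where N: "linear N" "\<And>x. N (from_coords \<xi> x) = x" "\<And>x. from_coords \<xi> (N x) = x"
    by (rule from_coords_inverse[OF \<xi>]) (rule that)
  obtain R where R: "\<And>x. x \<in> unit_cell \<xi> \<Longrightarrow> norm x \<le> R"
    using compact_imp_bounded[OF compact_unit_cell[of \<xi>]] unfolding bounded_iff by blast
  have "\<exists>z\<in>lattice_of \<xi>. norm (x - z) \<le> R" for x
  proof -
    define z where "z = from_coords \<xi> (\<chi> i. of_int \<lfloor>N x $ i\<rfloor>)"
    have "N (x - z) $ i = N x $ i - of_int \<lfloor>N x $ i\<rfloor>" for i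
      by (simp add: z_def linear_diff[OF N(1)] N(2))
    then have "x - z \<in> unit_cell \<xi>" unfolding unit_cell_eq_coords[OF N(2,3)]
      by simp linarith
    moreover have "z \<in> lattice_of \<xi>" by (auto simp: z_def lattice_of_eq_from_coords)
    ultimately show ?thesis using R by blast
  qed
  then show thesis by (rule that)
qed

text \<open>
  By Baire, for some \<open>M\<close> the set on which all \<open>f m\<close> with \<open>m \<ge> M\<close> are
  within 1 of the limit is dense in a ball. Once the mesh \<open>1 / m\<close> is small, every point has a lattice
  translate in this ball, and local constancy carries the bound from the dense set to that translate.
\<close>
lemma eventually_uniformly_bounded_of_pointwise_limit:
  fixes f :: "nat \<Rightarrow> real ^ 'd::finite \<Rightarrow> real"
  assumes \<xi>: "positively_oriented_basis \<xi>"
    and lim: "\<And>y. (\<lambda>m. f m y) \<longlonglongrightarrow> V"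
    and locconst: "\<And>m y. 0 < m \<Longrightarrow> y \<notin> Bad m \<Longrightarrow> \<forall>\<^sub>F y' in nhds y. f m y' = f m y"
    and period: "\<And>m y z. 0 < m \<Longrightarrow> z \<in> lattice_of \<xi> \<Longrightarrow> f m (y + (1 / real m) *\<^sub>R z) = f m y"
    and bperiod: "\<And>m y z. 0 < m \<Longrightarrow> z \<in> lattice_of \<xi> \<Longrightarrow> y \<notin> Bad m \<Longrightarrow> y + (1 / real m) *\<^sub>R z \<notin> Bad m"
  shows "\<exists>M>0. \<forall>m\<ge>M. \<forall>y. y \<notin> Bad m \<longrightarrow> \<bar>f m y - V\<bar> \<le> 1"
proof -
  define E where "E M = {y. \<forall>m\<ge>M. \<bar>f m y - V\<bar> \<le> 1}" for M
  have cover: "\<exists>M. y \<in> E M" for y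
  proof -
    have "\<forall>\<^sub>F m in sequentially. dist (f m y) V < 1" using tendstoD[OF lim[of y], of 1] by simp
    then show ?thesis unfolding E_def eventually_sequentially by (auto simp: dist_real_def intro: less_imp_le)
  qed
  have "\<exists>M. interior (closure (E M)) \<noteq> {}"
  proof (rule ccontr)
    assume no: "\<not> ?thesis"
    have "UNIV \<subseteq> closure (\<Inter>M. - closure (E M))"
    proof (rule Baire)
      fix T assume "T \<in> range (\<lambda>M. - closure (E M))"
      then obtain M where T: "T = - closure (E M)" by blast
      have "closure T = UNIV" unfolding T closure_complement using no by simp
      then show "openin (top_of_set UNIV) T \<and> UNIV \<subseteq> closure T" by (simp add: T open_Compl)
    qed auto
    moreover have "(\<Inter>M. - closure (E M)) = {}"
    proof -
      have "\<exists>M. y \<in> closure (E M)" for y using cover[of y] closure_subset by blast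
      then show ?thesis by blast
    qed
    ultimately show False by simp
  qed
  then obtain M y0 where "y0 \<in> interior (closure (E M))" by blast
  then obtain \<epsilon> where \<epsilon>: "\<epsilon> > 0" "ball y0 \<epsilon> \<subseteq> closure (E M)" unfolding mem_interior by blast
  obtain R where R: "\<And>x. \<exists>z\<in>lattice_of \<xi>. norm (x - z) \<le> R" by (rule lattice_covering_radius[OF \<xi>]) (rule that)
  obtain M' :: nat where M': "R / \<epsilon> < real M'" using reals_Archimedean2 by blast
  show ?thesis
  proof (intro exI[of _ "Suc (max M M')"] conjI allI impI)
    fix m y assume m: "Suc (max M M') \<le> m" and y: "y \<notin> Bad m"
    have m0: "0 < m" using m by simp
    obtain z where z: "z \<in> lattice_of \<xi>" "norm (real m *\<^sub>R (y0 - y) - z) \<le> R" using R by blast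
    \<comment> \<open>The lattice translate of \<open>y\<close> that lies in the ball.\<close>
    define y1 where "y1 = y + (1 / real m) *\<^sub>R z"
    have "real m *\<^sub>R (y0 - y) - z = real m *\<^sub>R (y0 - y1)" using m0 by (simp add: y1_def algebra_simps)
    then have "real m * dist y0 y1 \<le> R" using z(2) by (simp add: dist_norm)
    moreover have "R < real M' * \<epsilon>" using M' \<epsilon>(1) by (simp add: divide_less_eq)
    moreover have "real M' * \<epsilon> \<le> real m * \<epsilon>" using m \<epsilon>(1) by (intro mult_right_mono) auto
    ultimately have "real m * dist y0 y1 < real m * \<epsilon>" by linarith
    then have "dist y0 y1 < \<epsilon>" using m0 by simp
    then have y1cl: "y1 \<in> closure (E M)" using \<epsilon>(2) by auto
    have "y1 \<notin> Bad m" unfolding y1_def using bperiod[OF m0 z(1) y] .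
    then have "\<forall>\<^sub>F y' in nhds y1. f m y' = f m y1" by (rule locconst[OF m0])
    then obtain S where S: "open S" "y1 \<in> S" "\<And>y'. y' \<in> S \<Longrightarrow> f m y' = f m y1"
      unfolding eventually_nhds by blast
    then obtain y2 where "y2 \<in> S" "y2 \<in> E M" using y1cl open_Int_closure_eq_empty[of S "E M"] by blast
    moreover have "M \<le> m" using m by simp
    ultimately have "\<bar>f m y1 - V\<bar> \<le> 1" using S(3)[of y2] unfolding E_def by auto
    then show "\<bar>f m y - V\<bar> \<le> 1" unfolding y1_def using period[OF m0 z(1)] by simp
  qed simp
qed

text \<open>
  Only finitely many lattice points can meet \<open>X\<close> for \<open>y'\<close> near \<open>y\<close>, and each of
  them keeps its side of the frontier under small translations.
\<close>
lemma eventually_same_lattice_trace: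
  fixes X :: "(real ^ 'd::finite) set"
  assumes \<xi>: "positively_oriented_basis \<xi>" and X: "compact X" and m: "0 < m"
    and y: "\<And>z. z \<in> lattice_of \<xi> \<Longrightarrow> (1 / real m) *\<^sub>R z + y \<notin> frontier X"
  shows "\<forall>\<^sub>F y' in nhds y. \<forall>z\<in>lattice_of \<xi>. (1 / real m) *\<^sub>R z + y' \<in> X \<longleftrightarrow> (1 / real m) *\<^sub>R z + y \<in> X"
proof -
  obtain C where C: "\<And>x. x \<in> X \<Longrightarrow> norm x \<le> C" using compact_imp_bounded[OF X] unfolding bounded_iff by blast
  define F where "F = lattice_of \<xi> \<inter> cball 0 (real m * (C + norm y + 1))"
  have "finite F" unfolding F_def by (intro finite_lattice_bounded \<xi>) simp
  have outside: "(1 / real m) *\<^sub>R z + y' \<notin> X" if "z \<in> lattice_of \<xi>" "z \<notin> F" "dist y' y < 1" for z y'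
  proof
    assume "(1 / real m) *\<^sub>R z + y' \<in> X"
    then have "norm ((1 / real m) *\<^sub>R z + y') \<le> C" by (rule C)
    moreover have "norm ((1 / real m) *\<^sub>R z) \<le> norm ((1 / real m) *\<^sub>R z + y') + norm y'"
      using norm_triangle_ineq4[of "(1 / real m) *\<^sub>R z + y'" y'] by simp
    moreover have "norm y' \<le> norm y + 1"
      using norm_triangle_ineq2[of y' y] that(3) by (simp add: dist_norm)
    ultimately have "norm ((1 / real m) *\<^sub>R z) \<le> C + norm y + 1" by linarith
    then have "norm z \<le> real m * (C + norm y + 1)" using m by (simp add: divide_le_eq mult.commute)
    then show False using that by (simp add: F_def)
  qed
  have "\<forall>z\<in>F. \<forall>\<^sub>F y' in nhds y. (1 / real m) *\<^sub>R z + y' \<in> X \<longleftrightarrow> (1 / real m) *\<^sub>R z + y \<in> X"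
  proof
    fix z assume "z \<in> F"
    then have nf: "(1 / real m) *\<^sub>R z + y \<notin> frontier X" by (intro y) (simp add: F_def)
    have t: "((\<lambda>y'. (1 / real m) *\<^sub>R z + y') \<longlongrightarrow> (1 / real m) *\<^sub>R z + y) (nhds y)"
      by (intro tendsto_intros filterlim_ident)
    show "\<forall>\<^sub>F y' in nhds y. (1 / real m) *\<^sub>R z + y' \<in> X \<longleftrightarrow> (1 / real m) *\<^sub>R z + y \<in> X"
    proof (cases "(1 / real m) *\<^sub>R z + y \<in> X")
      case True
      then have "(1 / real m) *\<^sub>R z + y \<in> interior X" using nf closure_subset[of X] by (auto simp: frontier_def)
      then have "\<forall>\<^sub>F y' in nhds y. (1 / real m) *\<^sub>R z + y' \<in> interior X" by (rule topological_tendstoD[OF t open_interior])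
      then show ?thesis by eventually_elim (use True interior_subset in auto)
    next
      case False
      have "open (- X)" using X by (simp add: compact_imp_closed open_Compl)
      then have "\<forall>\<^sub>F y' in nhds y. (1 / real m) *\<^sub>R z + y' \<in> - X" using False by (intro topological_tendstoD[OF t]) auto
      then show ?thesis by eventually_elim (use False in auto)
    qed
  qed
  then have "\<forall>\<^sub>F y' in nhds y. \<forall>z\<in>F. (1 / real m) *\<^sub>R z + y' \<in> X \<longleftrightarrow> (1 / real m) *\<^sub>R z + y \<in> X"
    by (rule eventually_ball_finite[OF \<open>finite F\<close>])
  moreover have "\<forall>\<^sub>F y' in nhds y. dist y' y < 1" by (rule eventually_nhds_metric[THEN iffD2]) (intro exI[of _ 1], simp)
  ultimately show ?thesis
  proof eventually_elim
    case (elim y')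
    show ?case
    proof
      fix z assume z: "z \<in> lattice_of \<xi>"
      show "(1 / real m) *\<^sub>R z + y' \<in> X \<longleftrightarrow> (1 / real m) *\<^sub>R z + y \<in> X"
      proof (cases "z \<in> F")
        case True then show ?thesis using elim(1) by blast
      next
        case False
        then show ?thesis using outside[OF z False elim(2)] outside[OF z False, of y] by simp
      qed
    qed
  qed
qed

lemma AE_lattice_avoids_frontier:
  fixes X :: "(real ^ 'd::finite) set"
  assumes "compact X" "convex X"
  shows "AE y in lborel. \<forall>z\<in>lattice_of \<xi>. a *\<^sub>R z + y \<notin> frontier X"
proof -
  have "AE y in lborel. a *\<^sub>R z + y \<notin> frontier X" for z
  proof -
    have "negligible ((\<lambda>x. - (a *\<^sub>R z) + x) ` frontier X)"
      by (intro negligible_translation negligible_convex_frontier assms(2))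
    moreover have "closed ((\<lambda>x. - (a *\<^sub>R z) + x) ` frontier X)" by (rule closed_translation) simp
    ultimately have "(\<lambda>x. - (a *\<^sub>R z) + x) ` frontier X \<in> null_sets lborel"
      by (simp add: negligible_iff_null_sets null_sets_completion_iff borel_closed)
    then have "AE y in lborel. y \<notin> (\<lambda>x. - (a *\<^sub>R z) + x) ` frontier X" by (rule AE_not_in)
    then show ?thesis
    proof eventually_elim
      case (elim y)
      show ?case
      proof
        assume "a *\<^sub>R z + y \<in> frontier X"
        then have "y \<in> (\<lambda>x. - (a *\<^sub>R z) + x) ` frontier X" by (intro image_eqI[of _ _ "a *\<^sub>R z + y"]) auto
        then show False using elim by simp
      qed
    qed
  qed
  then show ?thesis by (simp add: AE_ball_countable countable_lattice)
qed

lemma config_count_eq_fit_set: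
  "config_count \<xi> n B X a c l = card {z \<in> lattice_of \<xi>. a *\<^sub>R (z + c) \<in> fit_set X a (B l) (white_part \<xi> n B l)}"
  unfolding config_count_def fit_set_def
  by (intro arg_cong[where f = card] Collect_cong) auto

lemma bounded_fit_set:
  fixes X :: "'a::euclidean_space set"
  assumes "finite B" "B \<noteq> {}" "bounded X" shows "bounded (fit_set X a B W)"
  by (rule bounded_subset[OF bounded_hit_set[OF assms(1,3)] fit_set_subset_hit_set[OF assms(2)]])

lemma config_enumeration_parts:
  assumes B: "config_enumeration \<xi> n B" and l: "l \<in> {1..2 ^ (n ^ CARD('d::finite)) - 1}"
  shows "B l \<noteq> {}" "B l \<subseteq> config_cell (\<xi> :: 'd \<Rightarrow> real ^ 'd) n" "finite (B l)" "finite (white_part \<xi> n B l)"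
proof -
  have bij: "bij_betw B {0..2 ^ (n ^ CARD('d)) - 1} (Pow (config_cell \<xi> n))" and B0: "B 0 = {}"
    using B by (auto simp: config_enumeration_def)
  have "B l \<noteq> B 0" using inj_on_eq_iff[OF bij_betw_imp_inj_on[OF bij], of l 0] l by auto
  then show "B l \<noteq> {}" using B0 by simp
  show sub: "B l \<subseteq> config_cell \<xi> n" using bij_betwE[OF bij] l by auto
  then show "finite (B l)" using finite_config_cell finite_subset by blast
  show "finite (white_part \<xi> n B l)" unfolding white_part_def using finite_config_cell by blast
qed

text \<open>
  Rescaled by \<open>1 / a\<close>, the count of a configuration is the number of lattice points in a translate of a
  bounded set, whose average is given by \<open>cell_average\<close>.
\<close>
lemma mean_estimator_eq_fit_volumes:
  fixes \<xi> :: "'d::finite \<Rightarrow> real ^ 'd"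
  assumes \<xi>: "positively_oriented_basis \<xi>" and B: "config_enumeration \<xi> n B" and X: "compact X" and a: "0 < a"
  shows "mean_estimator \<xi> n B w X a = (\<Sum>l = 1..2 ^ (n ^ CARD('d)) - 1.
     w l a * ((1 / a) ^ CARD('d) * vol (fit_set X a (B l) (white_part \<xi> n B l)))) / vol (unit_cell \<xi>)"
proof -
  let ?I = "{1..2 ^ (n ^ CARD('d)) - 1 :: nat}" and ?C = "unit_cell \<xi>"
  let ?\<delta> = "vol ?C"
  have \<delta>: "?\<delta> > 0" by (rule measure_unit_cell_pos[OF \<xi>])
  have [measurable]: "?C \<in> sets borel" by (rule borel_compact[OF compact_unit_cell])
  define Q where "Q l = {y. a *\<^sub>R y \<in> fit_set X a (B l) (white_part \<xi> n B l)}" for l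
  define N where "N l c = real (card {z \<in> lattice_of \<xi>. (1 / real 1) *\<^sub>R z + c \<in> Q l})" for l c
  have fit: "fit_set X a (B l) (white_part \<xi> n B l) \<in> sets borel" "bounded (fit_set X a (B l) (white_part \<xi> n B l))"
    if "l \<in> ?I" for l
    using config_enumeration_parts[OF B that] X
    by (intro sets_fit_set bounded_fit_set compact_imp_closed compact_imp_bounded; simp)+
  have Q: "Q l \<in> sets borel" "bounded (Q l)" "vol (Q l) = (1 / a) ^ CARD('d) * vol (fit_set X a (B l) (white_part \<xi> n B l))"
    if l: "l \<in> ?I" for l
  proof -
    have "(\<lambda>y. a *\<^sub>R y) -` fit_set X a (B l) (white_part \<xi> n B l) \<in> sets borel"
      by (rule measurable_sets_borel[OF _ fit(1)[OF l]]) measurable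
    then show "Q l \<in> sets borel" by (simp add: Q_def vimage_def)
    have "Q l = (\<lambda>x. (1 / a) *\<^sub>R x) ` fit_set X a (B l) (white_part \<xi> n B l)"
    proof (intro equalityI subsetI)
      fix y assume "y \<in> Q l"
      then show "y \<in> (\<lambda>x. (1 / a) *\<^sub>R x) ` fit_set X a (B l) (white_part \<xi> n B l)"
        using a by (intro image_eqI[of _ _ "a *\<^sub>R y"]) (auto simp: Q_def)
    qed (use a in \<open>auto simp: Q_def\<close>)
    then show "bounded (Q l)" using fit(2)[OF l] by (simp add: bounded_scaling)
    show "vol (Q l) = (1 / a) ^ CARD('d) * vol (fit_set X a (B l) (white_part \<xi> n B l))"
      using measure_lborel_dilation[OF fit(1)[OF l], of "1 / a" 0] a by (simp add: Q_def)
  qed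
  have le: "local_estimator \<xi> n B w X a c = (\<Sum>l\<in>?I. w l a * N l c)" for c
    unfolding local_estimator_def config_count_eq_fit_set N_def Q_def by simp
  have Nint: "integrable lborel (\<lambda>c. indicator ?C c * N l c)"
    "(\<integral>c. indicator ?C c * N l c \<partial>lborel) = vol (Q l)" "N l \<in> borel_measurable borel" if "l \<in> ?I" for l
    using cell_average[OF \<xi> _ Q(1)[OF that] Q(2)[OF that], of 1] by (simp_all add: N_def[abs_def])
  have um: "uniform_measure lborel ?C = density lborel (\<lambda>x. ennreal (indicator ?C x / ?\<delta>))"
  proof -
    have "emeasure lborel ?C = ennreal ?\<delta>"
      using emeasure_bounded_not_infinite[OF compact_imp_bounded[OF compact_unit_cell[of \<xi>]]] by (simp add: emeasure_eq_ennreal_measure)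
    then have "indicator ?C x / emeasure lborel ?C = ennreal (indicator ?C x / ?\<delta>)" for x
      using \<delta> by (auto simp: indicator_def divide_ennreal[symmetric])
    then show ?thesis by (simp add: uniform_measure_def)
  qed
  have lm: "(\<lambda>c. \<Sum>l\<in>?I. w l a * N l c) \<in> borel_measurable lborel"
    using Nint(3) by (intro borel_measurable_sum borel_measurable_times) auto
  have "mean_estimator \<xi> n B w X a = (\<integral>c. (\<Sum>l\<in>?I. w l a * N l c) \<partial>density lborel (\<lambda>x. ennreal (indicator ?C x / ?\<delta>)))"
    unfolding mean_estimator_def um le ..
  also have "\<dots> = (\<integral>c. (indicator ?C c / ?\<delta>) *\<^sub>R (\<Sum>l\<in>?I. w l a * N l c) \<partial>lborel)"
    using \<delta> by (intro integral_density lm) auto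
  also have "\<dots> = (\<integral>c. (\<Sum>l\<in>?I. w l a * (indicator ?C c * N l c)) / ?\<delta> \<partial>lborel)"
    by (simp add: sum_distrib_left sum_divide_distrib mult_ac)
  also have "\<dots> = (\<integral>c. (\<Sum>l\<in>?I. w l a * (indicator ?C c * N l c)) \<partial>lborel) / ?\<delta>"
    by (rule integral_divide_zero)
  also have "(\<integral>c. (\<Sum>l\<in>?I. w l a * (indicator ?C c * N l c)) \<partial>lborel) = (\<Sum>l\<in>?I. w l a * vol (Q l))"
  proof (subst Bochner_Integration.integral_sum)
    show "(\<Sum>l\<in>?I. \<integral>c. w l a * (indicator ?C c * N l c) \<partial>lborel) = (\<Sum>l\<in>?I. w l a * vol (Q l))"
      by (rule sum.cong) (simp_all only: integral_mult_right_zero Nint)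
  qed (intro integrable_mult_right Nint)
  also have "\<dots> = (\<Sum>l\<in>?I. w l a * ((1 / a) ^ CARD('d) * vol (fit_set X a (B l) (white_part \<xi> n B l))))"
    by (rule sum.cong) (simp_all only: Q)
  finally show ?thesis .
qed

text \<open>
  The estimator of the translate \<open>X - y\<close> is a function \<open>f m y\<close> of \<open>y\<close> whose
  average over the cell is the mean of the estimator at mesh \<open>1 / m\<close>. Off the null set of those
  \<open>y\<close> for which a lattice point lies on the frontier, it is locally constant, so the functions are
  dominated by a constant and the averages converge.
\<close>
lemma multigrid_limit_imp_mean_limit:
  fixes \<xi> :: "'d::finite \<Rightarrow> real ^ 'd"
  assumes \<xi>: "positively_oriented_basis \<xi>" and B: "config_enumeration \<xi> n B" and X: "compact X" "convex X"
    and lim: "\<And>y. (\<lambda>m. local_estimator \<xi> n B w ((\<lambda>x. x - y) ` X) (1 / real m) 0) \<longlonglongrightarrow> V"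
  shows "(\<lambda>m. mean_estimator \<xi> n B w X (1 / real m)) \<longlonglongrightarrow> V"
proof -
  let ?I = "{1..2 ^ (n ^ CARD('d)) - 1 :: nat}" and ?C = "unit_cell \<xi>" and ?L = "lattice_of \<xi>"
  let ?\<delta> = "vol ?C"
  have \<delta>: "?\<delta> > 0" by (rule measure_unit_cell_pos[OF \<xi>])
  have [measurable]: "?C \<in> sets borel" by (rule borel_compact[OF compact_unit_cell])
  define Q where "Q m l = fit_set X (1 / real m) (B l) (white_part \<xi> n B l)" for m l
  define N where "N m l y = real (card {z \<in> ?L. (1 / real m) *\<^sub>R z + y \<in> Q m l})" for m l y
  define f where "f m y = (\<Sum>l\<in>?I. w l (1 / real m) * N m l y)" for m y
  have Q: "Q m l \<in> sets borel" "bounded (Q m l)" if "l \<in> ?I" for m l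
    unfolding Q_def using config_enumeration_parts[OF B that] X
    by (intro sets_fit_set bounded_fit_set compact_imp_closed compact_imp_bounded; simp)+
  have fle: "local_estimator \<xi> n B w ((\<lambda>x. x - y) ` X) (1 / real m) 0 = f m y" for m y
  proof -
    have mem: "x \<in> (\<lambda>x. x - y) ` X \<longleftrightarrow> x + y \<in> X" for x by (auto intro!: image_eqI[of _ _ "x + y"])
    have "(1 / real m) *\<^sub>R (z + 0) \<in> fit_set ((\<lambda>x. x - y) ` X) (1 / real m) (B l) (white_part \<xi> n B l)
        \<longleftrightarrow> (1 / real m) *\<^sub>R z + y \<in> Q m l" for z l
      unfolding fit_set_def Q_def mem by (simp add: add_ac)
    then show ?thesis
      unfolding local_estimator_def config_count_eq_fit_set f_def N_def by simp
  qed
  define Bad where "Bad m = {y. \<exists>z\<in>?L. (1 / real m) *\<^sub>R z + y \<in> frontier X}" for m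
  have "\<exists>M>0. \<forall>m\<ge>M. \<forall>y. y \<notin> Bad m \<longrightarrow> \<bar>f m y - V\<bar> \<le> 1"
  proof (rule eventually_uniformly_bounded_of_pointwise_limit[OF \<xi>])
    show "(\<lambda>m. f m y) \<longlonglongrightarrow> V" for y using lim[of y] unfolding fle .
  next
    fix m :: nat and y assume m: "0 < m" and y: "y \<notin> Bad m"
    have "\<forall>\<^sub>F y' in nhds y. \<forall>z\<in>?L. (1 / real m) *\<^sub>R z + y' \<in> X \<longleftrightarrow> (1 / real m) *\<^sub>R z + y \<in> X"
      using y by (intro eventually_same_lattice_trace[OF \<xi> X(1) m]) (auto simp: Bad_def)
    then show "\<forall>\<^sub>F y' in nhds y. f m y' = f m y"
    proof eventually_elim
      case (elim y')
      have "N m l y' = N m l y" if l: "l \<in> ?I" for l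
      proof -
        have "(1 / real m) *\<^sub>R z + y' + (1 / real m) *\<^sub>R p \<in> X \<longleftrightarrow> (1 / real m) *\<^sub>R z + y + (1 / real m) *\<^sub>R p \<in> X"
          if "z \<in> ?L" "p \<in> config_cell \<xi> n" for z p
        proof -
          have "z + p \<in> ?L" using that config_cell_subset_lattice by (intro lattice_add) auto
          from bspec[OF elim this] show ?thesis by (simp add: scaleR_add_right add_ac)
        qed
        then have "{z \<in> ?L. (1 / real m) *\<^sub>R z + y' \<in> Q m l} = {z \<in> ?L. (1 / real m) *\<^sub>R z + y \<in> Q m l}"
          unfolding Q_def fit_set_def white_part_def using config_enumeration_parts(2)[OF B l] by blast
        then show ?thesis by (simp add: N_def)
      qed
      then show ?case unfolding f_def by (intro sum.cong) auto
    qed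
  next
    fix m :: nat and y z assume m: "0 < m" and z: "z \<in> ?L"
    have eq: "(1 / real m) *\<^sub>R z' + (y + (1 / real m) *\<^sub>R z) = (1 / real m) *\<^sub>R (z' + z) + y" for z'
      by (simp add: scaleR_add_right)
    have "N m l (y + (1 / real m) *\<^sub>R z) = N m l y" for l
    proof -
      have "bij_betw (\<lambda>z'. z' + z) {z' \<in> ?L. (1 / real m) *\<^sub>R (z' + z) + y \<in> Q m l} {z' \<in> ?L. (1 / real m) *\<^sub>R z' + y \<in> Q m l}"
      proof (rule bij_betw_byWitness[where f' = "\<lambda>z'. z' - z"])
        show "(\<lambda>z'. z' - z) ` {z' \<in> ?L. (1 / real m) *\<^sub>R z' + y \<in> Q m l} \<subseteq> {z' \<in> ?L. (1 / real m) *\<^sub>R (z' + z) + y \<in> Q m l}"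
          using lattice_add[OF _ lattice_uminus[OF z]] by auto
      qed (use z in \<open>auto intro: lattice_add\<close>)
      then show ?thesis unfolding N_def eq by (simp add: bij_betw_same_card)
    qed
    then show "f m (y + (1 / real m) *\<^sub>R z) = f m y" by (simp add: f_def)
    assume "y \<notin> Bad m"
    then show "y + (1 / real m) *\<^sub>R z \<notin> Bad m" unfolding Bad_def using lattice_add[OF _ z] by (auto simp only: eq mem_Collect_eq)
  qed
  then obtain M where M: "M > 0" "\<And>m y. M \<le> m \<Longrightarrow> y \<notin> Bad m \<Longrightarrow> \<bar>f m y - V\<bar> \<le> 1" by blast
  have Nint: "integrable lborel (\<lambda>c. indicator ?C c * N m l c)"
    "(\<integral>c. indicator ?C c * N m l c \<partial>lborel) = real m ^ CARD('d) * vol (Q m l)" "N m l \<in> borel_measurable borel"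
    if "0 < m" "l \<in> ?I" for m l
    using cell_average[OF \<xi> that(1) Q(1)[OF that(2)] Q(2)[OF that(2)], of m] by (simp_all add: N_def[abs_def])
  have mean: "mean_estimator \<xi> n B w X (1 / real m) = (\<integral>y. indicator ?C y * f m y \<partial>lborel) / ?\<delta>" if m: "0 < m" for m
  proof -
    have "(\<integral>y. indicator ?C y * f m y \<partial>lborel) = (\<integral>y. (\<Sum>l\<in>?I. w l (1 / real m) * (indicator ?C y * N m l y)) \<partial>lborel)"
      unfolding f_def by (simp add: sum_distrib_left mult_ac)
    also have "\<dots> = (\<Sum>l\<in>?I. w l (1 / real m) * (real m ^ CARD('d) * vol (Q m l)))"
    proof (subst Bochner_Integration.integral_sum)
      show "(\<Sum>l\<in>?I. \<integral>c. w l (1 / real m) * (indicator ?C c * N m l c) \<partial>lborel) = (\<Sum>l\<in>?I. w l (1 / real m) * (real m ^ CARD('d) * vol (Q m l)))"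
        by (rule sum.cong) (simp_all only: integral_mult_right_zero Nint[OF m])
    qed (intro integrable_mult_right Nint[OF m])
    finally show ?thesis
      using m by (simp add: mean_estimator_eq_fit_volumes[OF \<xi> B X(1)] Q_def)
  qed
  have "(\<lambda>m. \<integral>y. indicator ?C y * f (m + M) y \<partial>lborel) \<longlonglongrightarrow> (\<integral>y. indicator ?C y * V \<partial>lborel)"
  proof (rule integral_dominated_convergence[where w = "\<lambda>y. indicator ?C y * (\<bar>V\<bar> + 1)"])
    show "(\<lambda>y. indicator ?C y * V) \<in> borel_measurable lborel" by measurable
    show "(\<lambda>y. indicator ?C y * f (m + M) y) \<in> borel_measurable lborel" for m
    proof -
      have "f (m + M) \<in> borel_measurable borel"
        unfolding f_def using Nint(3)[of "m + M"] M(1) by (intro borel_measurable_sum borel_measurable_times) auto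
      then show ?thesis by simp
    qed
    show "integrable lborel (\<lambda>y. indicator ?C y * (\<bar>V\<bar> + 1))"
      using emeasure_bounded_finite[OF compact_imp_bounded[OF compact_unit_cell[of \<xi>]]]
      by (intro integrable_mult_left integrable_real_indicator) auto
    show "AE y in lborel. (\<lambda>m. indicator ?C y * f (m + M) y) \<longlonglongrightarrow> indicator ?C y * V"
    proof (intro AE_I2 tendsto_mult tendsto_const)
      fix y show "(\<lambda>m. f (m + M) y) \<longlonglongrightarrow> V"
        using lim[of y] unfolding fle by (rule LIMSEQ_ignore_initial_segment)
    qed
    show "AE y in lborel. norm (indicator ?C y * f (m + M) y) \<le> indicator ?C y * (\<bar>V\<bar> + 1)" for m
    proof -
      have "AE y in lborel. y \<notin> Bad (m + M)"
        using AE_lattice_avoids_frontier[OF X, of \<xi> "1 / real (m + M)"] by (simp add: Bad_def)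
      then show ?thesis
      proof eventually_elim
        case (elim y)
        have "\<bar>f (m + M) y\<bar> \<le> \<bar>V\<bar> + 1" using M(2)[OF _ elim] by fastforce
        then show ?case by (simp add: indicator_def)
      qed
    qed
  qed
  also have "(\<integral>y. indicator ?C y * V \<partial>lborel) = ?\<delta> * V" by simp
  finally have "(\<lambda>m. (\<integral>y. indicator ?C y * f (m + M) y \<partial>lborel) / ?\<delta>) \<longlonglongrightarrow> ?\<delta> * V / ?\<delta>"
    using \<delta> by (intro tendsto_divide tendsto_const) auto
  moreover have "?\<delta> * V / ?\<delta> = V" by (rule nonzero_mult_div_cancel_left[OF less_imp_neq[OF \<delta>, symmetric]])
  moreover have "mean_estimator \<xi> n B w X (1 / real (m + M)) = (\<integral>y. indicator ?C y * f (m + M) y \<partial>lborel) / ?\<delta>" for m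
    using M(1) by (intro mean) simp
  ultimately have "(\<lambda>m. mean_estimator \<xi> n B w X (1 / real (m + M))) \<longlonglongrightarrow> V"
    by (simp only:)
  then show ?thesis by (rule LIMSEQ_offset)
qed

section \<open>Consequences of convergence on rounded boxes\<close>

text \<open>
  The test bodies: they are \<open>r\<close>-regular, their isometric images are of the same kind, and their frontiers
  have measure zero because they are convex.
\<close>
definition rounded_bodies :: "(real ^ 'd::finite) set set" where
  "rounded_bodies = {{p + b | p b. p \<in> P \<and> b \<in> cball 0 1} | P. compact P \<and> convex P}"

lemma rounded_bodies_r_regular: "rounded_bodies \<subseteq> r_regular_sets"
  unfolding rounded_bodies_def using parallel_body_r_regular[of _ 1] by auto

lemma rounded_bodies_compact_convex:
  assumes "X \<in> rounded_bodies" shows "compact X" "convex X"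
proof -
  obtain P where P: "compact P" "convex P" "X = {p + b | p b. p \<in> P \<and> b \<in> cball 0 1}"
    using assms unfolding rounded_bodies_def by blast
  show "compact X" unfolding P(3) by (intro compact_sums P(1) compact_cball)
  show "convex X" unfolding P(3) by (intro convex_set_sums P(2) convex_cball)
qed

lemma rounded_bodies_isometry:
  fixes T :: "real ^ 'd::finite \<Rightarrow> real ^ 'd"
  assumes T: "orthogonal_transformation T" and X: "X \<in> rounded_bodies"
  shows "(\<lambda>x. T x + v) ` X \<in> rounded_bodies"
proof -
  obtain P where P: "compact P" "convex P" "X = {p + b | p b. p \<in> P \<and> b \<in> cball 0 1}"
    using X unfolding rounded_bodies_def by blast
  have lin: "linear T" using T by (rule orthogonal_transformation_linear)
  have ball: "T ` cball 0 1 = cball 0 1"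
    using image_orthogonal_transformation_cball[OF T, of 0 1] by (simp add: linear_0[OF lin])
  let ?P = "(\<lambda>x. v + x) ` (T ` P)"
  have "(\<lambda>x. T x + v) ` X = {p + b | p b. p \<in> ?P \<and> b \<in> cball 0 1}"
  proof (intro equalityI subsetI)
    fix x assume "x \<in> (\<lambda>x. T x + v) ` X"
    then obtain p b where pb: "p \<in> P" "b \<in> cball 0 1" "x = T (p + b) + v" unfolding P(3) by blast
    have "x = (v + T p) + T b" using pb(3) by (simp add: linear_add[OF lin] add_ac)
    moreover have "v + T p \<in> ?P" using pb(1) by blast
    moreover have "T b \<in> cball 0 1" using pb(2) ball by blast
    ultimately show "x \<in> {p + b | p b. p \<in> ?P \<and> b \<in> cball 0 1}" by blast
  next
    fix x assume "x \<in> {p + b | p b. p \<in> ?P \<and> b \<in> cball 0 1}"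
    then obtain p b where pb: "p \<in> P" "b \<in> cball 0 1" "x = (v + T p) + b" by blast
    then obtain b' where b': "b' \<in> cball 0 1" "b = T b'" using ball by blast
    have "x = T (p + b') + v" using pb(3) b'(2) by (simp add: linear_add[OF lin] add_ac)
    moreover have "p + b' \<in> X" unfolding P(3) using pb(1) b'(1) by blast
    ultimately show "x \<in> (\<lambda>x. T x + v) ` X" by blast
  qed
  moreover have "compact (T ` P)"
    using P(1) lin by (intro compact_continuous_image linear_continuous_on) (simp_all add: linear_conv_bounded_linear)
  then have "compact ?P" by (rule compact_translation)
  moreover have "convex ?P" by (intro convex_translation convex_linear_image lin P(2))
  ultimately show ?thesis unfolding rounded_bodies_def by blast
qed

lemma rounded_box_in_rounded_bodies:
  fixes \<tau> :: "'d::finite \<Rightarrow> real"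
  assumes "\<And>i. 0 \<le> \<tau> i" shows "rounded_box \<tau> {} 1 \<in> rounded_bodies"
  unfolding rounded_bodies_def rounded_box_eq_parallel_body[OF assms zero_le_one]
proof (intro CollectI exI[of _ "coordinate_box \<tau>"] conjI refl)
  show "compact (coordinate_box \<tau>)" "convex (coordinate_box \<tau>)"
    unfolding coordinate_box_eq_cbox by (rule compact_cbox, rule convex_box(1))
qed

text \<open>
  The hypothesis is applied to rotated boxes with side lengths 1 and 2, combined in an alternating sum. On the
  right-hand side this leaves \<open>\<delta>\<close>; on the left it leaves the hits of the cylinder.
\<close>
lemma projected_ball_unions_limit:
  fixes \<beta> :: "'d::finite \<Rightarrow> 'b::euclidean_space" and K :: "'d set"
    and S :: "'i \<Rightarrow> (real ^ 'd) set" and G :: "real ^ 'd \<Rightarrow> real ^ 'd"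
  assumes \<beta>: "bij_betw \<beta> (-K) Basis" and I: "finite I" and S: "\<And>i. i \<in> I \<Longrightarrow> finite (S i)"
    and lim: "\<And>X. X \<in> rounded_bodies \<Longrightarrow>
      (\<lambda>m. real m ^ DIM('b) * (\<Sum>i\<in>I. \<mu> i * vol (hit_set X (1 / real m) (S i)))) \<longlonglongrightarrow> \<delta> * intrinsic_volume (card K) X"
    and G: "orthogonal_transformation G"
  shows "(\<lambda>m. \<Sum>i\<in>I. \<mu> i * vol (\<Union>c\<in>(\<lambda>p. slab_projection \<beta> K (G p)) ` S i. cball c (real m))) \<longlonglongrightarrow> \<delta>"
proof -
  let ?e = "DIM('b)" and ?\<pi> = "slab_projection \<beta> K :: real ^ 'd \<Rightarrow> 'b"
  define \<tau> where "\<tau> A = (\<lambda>i. if i \<in> A then 2 else if i \<in> K then 1 else (0 :: real))" for A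
  \<comment> \<open>Hits of \<open>X\<close> by \<open>S\<close> are balls about the points of \<open>- S\<close>; the sign in \<open>H\<close> undoes this.\<close>
  define H where "H = (\<lambda>x. - G x)"
  have H: "orthogonal_transformation H" unfolding H_def using G by (rule orthogonal_transformation_neg[THEN iffD2])
  define T where "T = inv H"
  have T: "orthogonal_transformation T" unfolding T_def by (rule orthogonal_transformation_inv[OF H])
  have TH: "T (H x) = x" for x unfolding T_def by (rule inv_f_f[OF orthogonal_transformation_inj[OF H]])
  have linT: "linear T" and linH: "linear H" using T H by (auto intro: orthogonal_transformation_linear)
  define X where "X A = (\<lambda>x. T x + 0) ` rounded_box (\<tau> A) {} 1" for A
  have \<tau>0: "0 \<le> \<tau> A i" for A i by (simp add: \<tau>_def)
  have XR: "X A \<in> rounded_bodies" for A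
    unfolding X_def by (rule rounded_bodies_isometry[OF T rounded_box_in_rounded_bodies[OF \<tau>0]])
  have Vsum: "(\<Sum>A\<in>Pow K. (-1) ^ card (K - A) * intrinsic_volume (card K) (X A)) = 1"
    unfolding X_def intrinsic_volume_isometry[OF T compact_rounded_box]
    using intrinsic_volume_mixed_difference[OF \<beta>] by (simp add: \<tau>_def)
  let ?F = "\<lambda>A m. real m ^ ?e * (\<Sum>i\<in>I. \<mu> i * vol (hit_set (X A) (1 / real m) (S i)))"
  have "(\<lambda>m. \<Sum>A\<in>Pow K. (-1) ^ card (K - A) * ?F A m) \<longlonglongrightarrow> (\<Sum>A\<in>Pow K. (-1) ^ card (K - A) * (\<delta> * intrinsic_volume (card K) (X A)))"
    by (intro tendsto_sum tendsto_mult tendsto_const lim[OF XR])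
  also have "(\<Sum>A\<in>Pow K. (-1) ^ card (K - A) * (\<delta> * intrinsic_volume (card K) (X A)))
      = \<delta> * (\<Sum>A\<in>Pow K. (-1) ^ card (K - A) * intrinsic_volume (card K) (X A))"
    by (simp add: sum_distrib_left mult_ac)
  also have "\<dots> = \<delta>" unfolding Vsum by simp
  finally have L: "(\<lambda>m. \<Sum>A\<in>Pow K. (-1) ^ card (K - A) * ?F A m) \<longlonglongrightarrow> \<delta>" .
  obtain C where C: "\<And>i p. i \<in> I \<Longrightarrow> p \<in> S i \<Longrightarrow> norm p \<le> C"
  proof -
    have "bounded (\<Union>i\<in>I. S i)" using I S by (intro finite_imp_bounded) auto
    then show thesis using that unfolding bounded_iff by blast
  qed
  \<comment> \<open>From \<open>M\<close> on, the scaled configurations satisfy the size bound of \<open>mixed_difference_hits\<close>.\<close>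
  obtain M :: nat where M: "2 * C < real M" using reals_Archimedean2 by blast
  have "(\<Sum>A\<in>Pow K. (-1) ^ card (K - A) * ?F A m) = (\<Sum>i\<in>I. \<mu> i * vol (\<Union>c\<in>(\<lambda>p. ?\<pi> (G p)) ` S i. cball c (real m)))"
    if m: "Suc M \<le> m" for m
  proof -
    have m0: "0 < real m" using m by simp
    define S' where "S' i = (\<lambda>p. (1 / real m) *\<^sub>R H p) ` S i" for i
    have finS': "finite (S' i)" if "i \<in> I" for i using S[OF that] by (simp add: S'_def)
    have small: "norm p \<le> 1 / 2" if ip: "i \<in> I" "p \<in> S' i" for i p
    proof -
      obtain p' where p': "p' \<in> S i" "p = (1 / real m) *\<^sub>R H p'" using ip(2) unfolding S'_def by blast
      have "norm (H p') \<le> C" using C[OF ip(1) p'(1)] by (simp add: orthogonal_transformation_norm[OF H])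
      moreover have "2 * C \<le> real m" using M m by linarith
      ultimately have "2 * norm (H p') \<le> real m" by linarith
      then show ?thesis using m0 p'(2) by (simp add: divide_le_eq)
    qed
    have hits: "vol (hit_set (X A) (1 / real m) (S i)) = vol (slab_hits (\<tau> A) {} 1 (S' i))" if i: "i \<in> I" for A i
    proof -
      have "hit_set (X A) (1 / real m) (S i) = T ` slab_hits (\<tau> A) {} 1 (S' i)"
      proof (intro equalityI subsetI)
        fix x assume "x \<in> hit_set (X A) (1 / real m) (S i)"
        then obtain p where p: "p \<in> S i" "x + (1 / real m) *\<^sub>R p \<in> X A" unfolding hit_set_def by blast
        then obtain r where pr: "p \<in> S i" "x + (1 / real m) *\<^sub>R p = T r" "r \<in> rounded_box (\<tau> A) {} 1"
          unfolding X_def by fastforce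
        define y where "y = r - (1 / real m) *\<^sub>R H p"
        have "x = T r - (1 / real m) *\<^sub>R p" using pr(2) by (simp add: eq_diff_eq)
        then have "x = T y" by (simp add: y_def linear_diff[OF linT] linear_cmul[OF linT] TH)
        moreover have "y \<in> slab_hits (\<tau> A) {} 1 (S' i)"
          using pr unfolding slab_hits_def S'_def y_def by (auto simp: unit_slab_def intro!: bexI[of _ p])
        ultimately show "x \<in> T ` slab_hits (\<tau> A) {} 1 (S' i)" by blast
      next
        fix x assume "x \<in> T ` slab_hits (\<tau> A) {} 1 (S' i)"
        then obtain y p where yp: "x = T y" "p \<in> S i" "y + (1 / real m) *\<^sub>R H p \<in> rounded_box (\<tau> A) {} 1"
          unfolding slab_hits_def S'_def by auto
        have "x + (1 / real m) *\<^sub>R p = T (y + (1 / real m) *\<^sub>R H p)"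
          by (simp add: yp(1) linear_add[OF linT] linear_cmul[OF linT] TH)
        then show "x \<in> hit_set (X A) (1 / real m) (S i)"
          unfolding hit_set_def X_def using yp by auto
      qed
      moreover have "slab_hits (\<tau> A) {} 1 (S' i) \<in> sets borel" by (rule sets_slab_hits[OF finS'[OF i]])
      moreover have "hit_set (X A) (1 / real m) (S i) \<in> sets borel"
        by (rule sets_hit_set[OF S[OF i] compact_imp_closed[OF rounded_bodies_compact_convex(1)[OF XR]]])
      ultimately show ?thesis using measure_lborel_orthogonal_image[OF T] by metis
    qed
    have "(\<Sum>A\<in>Pow K. (-1) ^ card (K - A) * ?F A m)
      = (\<Sum>A\<in>Pow K. \<Sum>i\<in>I. (-1) ^ card (K - A) * (real m ^ ?e * (\<mu> i * vol (slab_hits (\<tau> A) {} 1 (S' i)))))"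
      unfolding sum_distrib_left by (intro sum.cong refl) (simp only: hits)
    also have "\<dots> = (\<Sum>i\<in>I. \<Sum>A\<in>Pow K. (-1) ^ card (K - A) * (real m ^ ?e * (\<mu> i * vol (slab_hits (\<tau> A) {} 1 (S' i)))))"
      by (rule sum.swap)
    also have "\<dots> = (\<Sum>i\<in>I. \<mu> i * vol (\<Union>c\<in>(\<lambda>p. ?\<pi> (G p)) ` S i. cball c (real m)))"
    proof (rule sum.cong[OF refl])
      fix i assume i: "i \<in> I"
      let ?U = "\<Union>p\<in>S' i. cball (- ?\<pi> p) 1"
      have "(\<Sum>A\<in>Pow K. (-1) ^ card (K - A) * (real m ^ ?e * (\<mu> i * vol (slab_hits (\<tau> A) {} 1 (S' i)))))
         = \<mu> i * (real m ^ ?e * (\<Sum>A\<in>Pow K. (-1) ^ card (K - A) * vol (slab_hits (\<tau> A) {} 1 (S' i))))"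
        unfolding sum_distrib_left by (intro sum.cong refl) (simp add: mult_ac)
      also have "(\<Sum>A\<in>Pow K. (-1) ^ card (K - A) * vol (slab_hits (\<tau> A) {} 1 (S' i))) = vol ?U"
        unfolding \<tau>_def by (rule mixed_difference_hits[OF \<beta> finS'[OF i] small[OF i] zero_le_one])
      also have "real m ^ ?e * vol ?U = vol {x. (1 / real m) *\<^sub>R (x - 0) \<in> ?U}"
        using finS'[OF i] by (intro measure_lborel_dilation[symmetric] m0 borel_closed closed_UN) auto
      also have "{x. (1 / real m) *\<^sub>R (x - 0) \<in> ?U} = (\<Union>c\<in>(\<lambda>p. ?\<pi> (G p)) ` S i. cball c (real m))"
      proof -
        have "(1 / real m) *\<^sub>R x \<in> cball (- ?\<pi> ((1 / real m) *\<^sub>R H p)) 1 \<longleftrightarrow> x \<in> cball (?\<pi> (G p)) (real m)" for x p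
        proof -
          have "- ?\<pi> ((1 / real m) *\<^sub>R H p) = (1 / real m) *\<^sub>R ?\<pi> (G p)"
            by (simp add: H_def linear_cmul[OF linear_slab_projection] linear_neg[OF linear_slab_projection])
          then have "dist (- ?\<pi> ((1 / real m) *\<^sub>R H p)) ((1 / real m) *\<^sub>R x) = (1 / real m) * dist (?\<pi> (G p)) x"
            using m0 by (simp add: dist_norm flip: scaleR_diff_right)
          then show ?thesis using m0 by (simp add: divide_le_eq)
        qed
        then show ?thesis by (auto simp: S'_def)
      qed
      finally show "(\<Sum>A\<in>Pow K. (-1) ^ card (K - A) * (real m ^ ?e * (\<mu> i * vol (slab_hits (\<tau> A) {} 1 (S' i)))))
         = \<mu> i * vol (\<Union>c\<in>(\<lambda>p. ?\<pi> (G p)) ` S i. cball c (real m))" .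
    qed
    finally show ?thesis .
  qed
  then have "\<forall>\<^sub>F m in sequentially. (\<Sum>A\<in>Pow K. (-1) ^ card (K - A) * ?F A m)
      = (\<Sum>i\<in>I. \<mu> i * vol (\<Union>c\<in>(\<lambda>p. ?\<pi> (G p)) ` S i. cball c (real m)))"
    unfolding eventually_sequentially by blast
  then show ?thesis using L by (rule Lim_transform_eventually[rotated])
qed

text \<open>
  The second difference of the sequence is the constant \<open>2 * c\<close>, and after that the first difference is
  \<open>b\<close>.
\<close>
lemma quadratic_limit_constant_term:
  fixes a b c L :: real
  assumes "(\<lambda>m. a + b * real m + c * (real m)\<^sup>2) \<longlonglongrightarrow> L"
  shows "a = L"
proof -
  let ?s = "\<lambda>m. a + b * real m + c * (real m)\<^sup>2"
  have s1: "(\<lambda>m. ?s (Suc m)) \<longlonglongrightarrow> L" using assms by (rule LIMSEQ_Suc)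
  then have s2: "(\<lambda>m. ?s (Suc (Suc m))) \<longlonglongrightarrow> L" by (rule LIMSEQ_Suc)
  have "(\<lambda>m. ?s (Suc (Suc m)) - 2 * ?s (Suc m) + ?s m) \<longlonglongrightarrow> L - 2 * L + L"
    by (intro tendsto_intros s1 s2 assms)
  moreover have "?s (Suc (Suc m)) - 2 * ?s (Suc m) + ?s m = 2 * c" for m
    by (simp add: power2_eq_square algebra_simps)
  ultimately have c: "c = 0" by (simp add: LIMSEQ_const_iff)
  have "(\<lambda>m. ?s (Suc m) - ?s m) \<longlonglongrightarrow> L - L" by (intro tendsto_intros s1 assms)
  then have b: "b = 0" using c by (simp add: LIMSEQ_const_iff algebra_simps)
  show ?thesis using assms c b by (simp add: LIMSEQ_const_iff)
qed

text \<open>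
  By \<open>ball_union_volume_expansion\<close>, the sequence in \<open>projected_ball_unions_limit\<close> is a
  polynomial in \<open>m\<close> of degree at most 2 up to an error that tends to 0, so its limit is the constant
  term.
\<close>
lemma projected_hull_volumes_constant:
  fixes \<beta> :: "'d::finite \<Rightarrow> 'b::euclidean_space" and K :: "'d set"
    and S :: "'i \<Rightarrow> (real ^ 'd) set" and G :: "real ^ 'd \<Rightarrow> real ^ 'd"
  assumes \<beta>: "bij_betw \<beta> (-K) Basis" and I: "finite I" and S: "\<And>i. i \<in> I \<Longrightarrow> finite (S i)"
    and lim: "\<And>X. X \<in> rounded_bodies \<Longrightarrow>
      (\<lambda>m. real m ^ DIM('b) * (\<Sum>i\<in>I. \<mu> i * vol (hit_set X (1 / real m) (S i)))) \<longlonglongrightarrow> \<delta> * intrinsic_volume (card K) X"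
    and G: "orthogonal_transformation G"
    and dim: "DIM('b) = 1 \<or> DIM('b) = 2"
    and orth: "\<And>w :: 'b. w \<noteq> 0 \<Longrightarrow> finite {u. norm u = 1 \<and> u \<bullet> w = 0}"
  shows "(\<Sum>i\<in>I. \<mu> i * vol ((\<lambda>z. slab_projection \<beta> K (G z)) ` (convex hull (S i)))) = \<delta>"
proof -
  let ?f = "\<lambda>z. slab_projection \<beta> K (G z) :: 'b"
  have "linear (slab_projection \<beta> K \<circ> G)"
    by (intro linear_compose orthogonal_transformation_linear[OF G] linear_slab_projection)
  then have hull: "convex hull (?f ` A) = ?f ` (convex hull A)" for A
    using convex_hull_linear_image[of ?f A] by (simp add: o_def)
  let ?U = "\<lambda>i \<rho>. vol (\<Union>c\<in>?f ` S i. cball c \<rho>)"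
  let ?A = "\<lambda>i. vol (?f ` (convex hull (S i)))"
  have "\<forall>i\<in>I. \<exists>W. ((\<lambda>\<rho>. ?U i \<rho> - (?A i + fst W * \<rho> ^ DIM('b) + snd W * \<rho>)) \<longlongrightarrow> 0) at_top"
  proof
    fix i assume "i \<in> I"
    then have "finite (?f ` S i)" using S by simp
    then obtain V P where "((\<lambda>\<rho>. ?U i \<rho> - (vol (convex hull (?f ` S i)) + V * \<rho> ^ DIM('b) + P * \<rho>)) \<longlongrightarrow> 0) at_top"
      by (rule ball_union_volume_expansion[OF _ orth]) (assumption, rule that)
    then show "\<exists>W. ((\<lambda>\<rho>. ?U i \<rho> - (?A i + fst W * \<rho> ^ DIM('b) + snd W * \<rho>)) \<longlongrightarrow> 0) at_top"
      unfolding hull by (intro exI[of _ "(V, P)"]) simp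
  qed
  then obtain W where W: "\<forall>i\<in>I. ((\<lambda>\<rho>. ?U i \<rho> - (?A i + fst (W i) * \<rho> ^ DIM('b) + snd (W i) * \<rho>)) \<longlongrightarrow> 0) at_top"
    by (rule bchoice[THEN exE])
  define V where "V i = fst (W i)" for i
  define P where "P i = snd (W i)" for i
  have VP: "((\<lambda>\<rho>. ?U i \<rho> - (?A i + V i * \<rho> ^ DIM('b) + P i * \<rho>)) \<longlongrightarrow> 0) at_top" if "i \<in> I" for i
    unfolding V_def P_def by (rule bspec[OF W that])
  have "(\<lambda>m. \<Sum>i\<in>I. \<mu> i * (?U i (real m) - (?A i + V i * real m ^ DIM('b) + P i * real m))) \<longlonglongrightarrow> (\<Sum>i\<in>I. \<mu> i * 0)"
    by (intro tendsto_sum tendsto_mult tendsto_const filterlim_compose[OF VP filterlim_real_sequentially])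
  with projected_ball_unions_limit[OF \<beta> I S lim G]
  have "(\<lambda>m. (\<Sum>i\<in>I. \<mu> i * ?U i (real m))
      - (\<Sum>i\<in>I. \<mu> i * (?U i (real m) - (?A i + V i * real m ^ DIM('b) + P i * real m)))) \<longlonglongrightarrow> \<delta> - (\<Sum>i\<in>I. \<mu> i * 0)"
    by (rule tendsto_diff)
  moreover have "(\<Sum>i\<in>I. \<mu> i * ?U i (real m))
      - (\<Sum>i\<in>I. \<mu> i * (?U i (real m) - (?A i + V i * real m ^ DIM('b) + P i * real m)))
      = (\<Sum>i\<in>I. \<mu> i * ?A i) + (\<Sum>i\<in>I. \<mu> i * V i) * real m ^ DIM('b) + (\<Sum>i\<in>I. \<mu> i * P i) * real m" for m
    unfolding sum_subtractf[symmetric] sum_distrib_right sum.distrib[symmetric]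
    by (intro sum.cong refl) (simp add: algebra_simps)
  ultimately have lim': "(\<lambda>m. (\<Sum>i\<in>I. \<mu> i * ?A i) + (\<Sum>i\<in>I. \<mu> i * V i) * real m ^ DIM('b) + (\<Sum>i\<in>I. \<mu> i * P i) * real m) \<longlonglongrightarrow> \<delta>"
    by simp
  from dim show ?thesis
  proof
    assume d: "DIM('b) = 1"
    have "(\<lambda>m. (\<Sum>i\<in>I. \<mu> i * ?A i) + ((\<Sum>i\<in>I. \<mu> i * V i) + (\<Sum>i\<in>I. \<mu> i * P i)) * real m + 0 * (real m)\<^sup>2) \<longlonglongrightarrow> \<delta>"
      using lim' unfolding d by (simp add: distrib_right add.assoc)
    then show ?thesis by (rule quadratic_limit_constant_term)
  next
    assume d: "DIM('b) = 2"
    have "(\<lambda>m. (\<Sum>i\<in>I. \<mu> i * ?A i) + (\<Sum>i\<in>I. \<mu> i * P i) * real m + (\<Sum>i\<in>I. \<mu> i * V i) * (real m)\<^sup>2) \<longlonglongrightarrow> \<delta>"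
      using lim' unfolding d by (simp add: add_ac)
    then show ?thesis by (rule quadratic_limit_constant_term)
  qed
qed

definition coordinate_rotation :: "'d \<Rightarrow> 'd \<Rightarrow> real \<Rightarrow> real ^ 'd::finite \<Rightarrow> real ^ 'd" where
  "coordinate_rotation i j t z = (\<chi> k. if k = i then cos t * z $ i + sin t * z $ j
     else if k = j then cos t * z $ j - sin t * z $ i else z $ k)"

lemma orthogonal_coordinate_rotation:
  assumes "i \<noteq> j" shows "orthogonal_transformation (coordinate_rotation i j t)"
  unfolding orthogonal_transformation
proof (intro conjI allI)
  show "linear (coordinate_rotation i j t)"
    by (intro linearI) (auto simp: coordinate_rotation_def vec_eq_iff algebra_simps)
  fix v :: "real ^ 'a"
  let ?w = "coordinate_rotation i j t v"
  have split: "(\<Sum>k\<in>UNIV. (x $ k)\<^sup>2) = (x $ i)\<^sup>2 + ((x $ j)\<^sup>2 + (\<Sum>k\<in>UNIV - {i} - {j}. (x $ k)\<^sup>2))" for x :: "real ^ 'a"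
    using assms by (simp add: sum.remove[of UNIV i] sum.remove[of "UNIV - {i}" j])
  have "(cos t * v $ i + sin t * v $ j)\<^sup>2 + (cos t * v $ j - sin t * v $ i)\<^sup>2
      = ((sin t)\<^sup>2 + (cos t)\<^sup>2) * ((v $ i)\<^sup>2 + (v $ j)\<^sup>2)" by algebra
  then have "(?w $ i)\<^sup>2 + (?w $ j)\<^sup>2 = (v $ i)\<^sup>2 + (v $ j)\<^sup>2"
    using assms by (simp add: coordinate_rotation_def)
  moreover have "(\<Sum>k\<in>UNIV - {i} - {j}. (?w $ k)\<^sup>2) = (\<Sum>k\<in>UNIV - {i} - {j}. (v $ k)\<^sup>2)"
    by (rule sum.cong) (auto simp: coordinate_rotation_def)
  ultimately have "(\<Sum>k\<in>UNIV. (?w $ k)\<^sup>2) = (\<Sum>k\<in>UNIV. (v $ k)\<^sup>2)" unfolding split by simp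
  then show "norm ?w = norm v" by (simp add: norm_vec_def L2_set_def)
qed

text \<open>
  In codimension 1 the projected hulls are the intervals of values of a rotating functional.
\<close>
lemma no_flat_limit:
  fixes S :: "'i \<Rightarrow> (real ^ 'd::finite) set"
  assumes d: "CARD('d) \<ge> 2" and I: "finite I" and S: "\<And>i. i \<in> I \<Longrightarrow> finite (S i)"
    and lim: "\<And>X. X \<in> rounded_bodies \<Longrightarrow>
      (\<lambda>m. real m * (\<Sum>i\<in>I. \<mu> i * vol (hit_set X (1 / real m) (S i)))) \<longlonglongrightarrow> \<delta> * intrinsic_volume (CARD('d) - 1) X"
  shows "\<delta> = 0"
proof -
  obtain i j :: 'd where ij: "i \<noteq> j" using d by (metis card_2_iff' card_le_Suc0_iff_eq finite numeral_2_eq_2 not_less_eq_eq UNIV_I)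
  let ?K = "UNIV - {i}" and ?\<beta> = "\<lambda>_ :: 'd. 1 :: real"
  have mK: "- ?K = {i}" by auto
  have \<beta>: "bij_betw ?\<beta> (- ?K) Basis" by (auto simp: mK bij_betw_def)
  have cK: "card ?K = CARD('d) - 1" by simp
  have proj: "slab_projection ?\<beta> ?K (coordinate_rotation i j t z) = rotating_functional (axis i 1) (axis j 1) t z" for t z
    by (simp add: slab_projection_def mK coordinate_rotation_def rotating_functional_def inner_axis')
  have const: "(\<Sum>k\<in>I. \<mu> k * vol (rotating_functional (axis i 1) (axis j 1) t ` (convex hull (S k)))) = \<delta>" for t
    using projected_hull_volumes_constant[OF \<beta> I S _ orthogonal_coordinate_rotation[OF ij, of t] _ finite_unit_normals_real, of "\<lambda>k. k" \<mu> \<delta>] lim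
    unfolding proj by (simp add: cK power2_eq_square)
  have "locally_sinusoidal (\<lambda>t. \<Sum>k\<in>I. \<mu> k * vol (rotating_functional (axis i 1) (axis j 1) t ` (convex hull (S k))))"
    by (intro locally_sinusoidal_sum I width_locally_sinusoidal S)
  then show "\<delta> = 0" unfolding const by (rule locally_sinusoidal_const)
qed

text \<open>
  In codimension 2 a coordinate \<open>h\<close> outside the plane of rotation is available, and the hulls are
  projected to the plane spanned by it and the rotating direction.
\<close>
lemma no_cylindrical_limit:
  fixes S :: "'i \<Rightarrow> (real ^ 'd::finite) set"
  assumes d: "CARD('d) \<ge> 3" and I: "finite I" and S: "\<And>i. i \<in> I \<Longrightarrow> finite (S i)"
    and lim: "\<And>X. X \<in> rounded_bodies \<Longrightarrow>
      (\<lambda>m. (real m)\<^sup>2 * (\<Sum>i\<in>I. \<mu> i * vol (hit_set X (1 / real m) (S i)))) \<longlonglongrightarrow> \<delta> * intrinsic_volume (CARD('d) - 2) X"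
  shows "\<delta> = 0"
proof -
  obtain T :: "'d set" where "T \<subseteq> UNIV" "card T = 3" using d by (metis obtain_subset_with_card_n)
  then obtain h i j :: 'd where hij: "h \<noteq> i" "i \<noteq> j" "h \<noteq> j" unfolding card_3_iff by blast
  let ?K = "UNIV - {h, i}" and ?\<beta> = "\<lambda>k. if k = h then (1, 0) else (0, 1 :: real) :: real \<times> real"
  have mK: "- ?K = {h, i}" by auto
  have \<beta>: "bij_betw ?\<beta> (- ?K) Basis" using hij by (auto simp: mK bij_betw_def Basis_prod_def)
  have cK: "card ?K = CARD('d) - 2" using hij by (simp add: card_Diff_subset)
  have proj: "slab_projection ?\<beta> ?K (coordinate_rotation i j t z) = (axis h 1 \<bullet> z, rotating_functional (axis i 1) (axis j 1) t z)" for t z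
    using hij by (simp add: slab_projection_def mK coordinate_rotation_def rotating_functional_def inner_axis')
  let ?F = "\<lambda>t z. (axis h 1 \<bullet> z, rotating_functional (axis i 1) (axis j 1) t z)"
  have const: "(\<Sum>k\<in>I. \<mu> k * vol (?F t ` (convex hull (S k)))) = \<delta>" for t
    using projected_hull_volumes_constant[OF \<beta> I S _ orthogonal_coordinate_rotation[OF hij(2), of t] _ finite_unit_normals_real_prod, of "\<lambda>k. k" \<mu> \<delta>] lim
    unfolding proj by (simp add: cK power2_eq_square)
  have "locally_sinusoidal (\<lambda>t. \<Sum>k\<in>I. \<mu> k * vol (?F t ` (convex hull (S k))))"
    by (intro locally_sinusoidal_sum I area_locally_sinusoidal S)
  then show "\<delta> = 0" unfolding const by (rule locally_sinusoidal_const)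
qed

section \<open>Local algorithms with homogeneous weights\<close>

lemma fit_volume_sum_eq_hit_volume_sum:
  fixes \<xi> :: "'d::finite \<Rightarrow> real ^ 'd"
  assumes B: "config_enumeration \<xi> n B" and X: "compact X"
  shows "(\<Sum>l = 1..2 ^ (n ^ CARD('d)) - 1. w l * vol (fit_set X a (B l) (white_part \<xi> n B l)))
    = (\<Sum>(l, T)\<in>Sigma {1..2 ^ (n ^ CARD('d)) - 1} (\<lambda>l. Pow (B l)).
        (w l * (-1) ^ (card T + 1)) * vol (hit_set X a (T \<union> white_part \<xi> n B l)))"
proof -
  let ?I = "{1..2 ^ (n ^ CARD('d)) - 1 :: nat}"
  have "(\<Sum>l\<in>?I. w l * vol (fit_set X a (B l) (white_part \<xi> n B l)))
     = (\<Sum>l\<in>?I. \<Sum>T\<in>Pow (B l). (w l * (-1) ^ (card T + 1)) * vol (hit_set X a (T \<union> white_part \<xi> n B l)))"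
  proof (rule sum.cong[OF refl])
    fix l assume l: "l \<in> ?I"
    show "w l * vol (fit_set X a (B l) (white_part \<xi> n B l))
      = (\<Sum>T\<in>Pow (B l). (w l * (-1) ^ (card T + 1)) * vol (hit_set X a (T \<union> white_part \<xi> n B l)))"
      unfolding measure_fit_set[OF config_enumeration_parts(3)[OF B l] config_enumeration_parts(1)[OF B l]
          config_enumeration_parts(4)[OF B l] X, of a]
      by (simp only: sum_distrib_left mult.assoc)
  qed
  also have "\<dots> = (\<Sum>(l, T)\<in>Sigma ?I (\<lambda>l. Pow (B l)). (w l * (-1) ^ (card T + 1)) * vol (hit_set X a (T \<union> white_part \<xi> n B l)))"
    using config_enumeration_parts(3)[OF B] by (intro sum.Sigma) auto
  finally show ?thesis .
qed

text \<open>
  By homogeneity the weight at mesh \<open>1 / m\<close> is \<open>m\<close> to the power \<open>- q\<close> times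
  the weight at 1, while the number of lattice points per unit of volume is \<open>m\<close> to the power
  \<open>d\<close> divided by the volume of the cell.
\<close>
lemma mean_limit_imp_hit_volume_limit:
  fixes \<xi> :: "'d::finite \<Rightarrow> real ^ 'd"
  assumes \<xi>: "positively_oriented_basis \<xi>" and B: "config_enumeration \<xi> n B"
    and w: "homogeneous_weights CARD('d) n q w" and q: "q \<le> CARD('d)" and X: "compact X"
    and lim: "(\<lambda>m. mean_estimator \<xi> n B w X (1 / real m)) \<longlonglongrightarrow> V"
  shows "(\<lambda>m. real m ^ (CARD('d) - q) * (\<Sum>(l, T)\<in>Sigma {1..2 ^ (n ^ CARD('d)) - 1} (\<lambda>l. Pow (B l)).
        (w l 1 * (-1) ^ (card T + 1)) * vol (hit_set X (1 / real m) (T \<union> white_part \<xi> n B l))))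
    \<longlonglongrightarrow> vol (unit_cell \<xi>) * V"
proof -
  let ?I = "{1..2 ^ (n ^ CARD('d)) - 1 :: nat}" and ?\<delta> = "vol (unit_cell \<xi>)"
  let ?fit = "\<lambda>m l. vol (fit_set X (1 / real m) (B l) (white_part \<xi> n B l))"
  have \<delta>: "?\<delta> > 0" by (rule measure_unit_cell_pos[OF \<xi>])
  have "?\<delta> * mean_estimator \<xi> n B w X (1 / real m) = real m ^ (CARD('d) - q) * (\<Sum>l\<in>?I. w l 1 * ?fit m l)"
    if m: "0 < m" for m
  proof -
    have "?\<delta> * mean_estimator \<xi> n B w X (1 / real m)
        = (\<Sum>l\<in>?I. w l (1 / real m) * ((1 / (1 / real m)) ^ CARD('d) * ?fit m l))"
      using m \<delta> by (subst mean_estimator_eq_fit_volumes[OF \<xi> B X]) auto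
    also have "\<dots> = (\<Sum>l\<in>?I. real m ^ (CARD('d) - q) * (w l 1 * ?fit m l))"
    proof (rule sum.cong[OF refl])
      fix l assume l: "l \<in> ?I"
      have hom: "\<forall>a>0. w l a = a ^ q * w l 1"
        using w[unfolded homogeneous_weights_def] l by (rule bspec)
      have wl: "w l (1 / real m) = (1 / real m) ^ q * w l 1"
        by (rule hom[rule_format]) (use m in simp)
      have inv: "1 / (1 / real m) = real m" by simp
      have pow: "(1 / real m) ^ q * real m ^ CARD('d) = real m ^ (CARD('d) - q)"
        using m q by (simp add: power_diff power_one_over)
      have "w l (1 / real m) * ((1 / (1 / real m)) ^ CARD('d) * ?fit m l)
          = ((1 / real m) ^ q * real m ^ CARD('d)) * (w l 1 * ?fit m l)"
        unfolding wl inv by (simp only: mult_ac)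
      then show "w l (1 / real m) * ((1 / (1 / real m)) ^ CARD('d) * ?fit m l) = real m ^ (CARD('d) - q) * (w l 1 * ?fit m l)"
        unfolding pow .
    qed
    also have "\<dots> = real m ^ (CARD('d) - q) * (\<Sum>l\<in>?I. w l 1 * ?fit m l)" by (rule sum_distrib_left[symmetric])
    finally show ?thesis .
  qed
  then have "\<forall>\<^sub>F m in sequentially. ?\<delta> * mean_estimator \<xi> n B w X (1 / real m)
      = real m ^ (CARD('d) - q) * (\<Sum>l\<in>?I. w l 1 * ?fit m l)"
    unfolding eventually_sequentially by (intro exI[of _ 1]) simp
  moreover have "(\<lambda>m. ?\<delta> * mean_estimator \<xi> n B w X (1 / real m)) \<longlonglongrightarrow> ?\<delta> * V"
    by (intro tendsto_mult tendsto_const lim)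
  ultimately have "(\<lambda>m. real m ^ (CARD('d) - q) * (\<Sum>l\<in>?I. w l 1 * ?fit m l)) \<longlonglongrightarrow> ?\<delta> * V"
    by (rule Lim_transform_eventually[rotated])
  then show ?thesis unfolding fit_volume_sum_eq_hit_volume_sum[OF B X] .
qed

text \<open>
  The signed sum of hit volumes is indexed by the pairs of a configuration \<open>l\<close> and a subset
  \<open>T\<close> of its black part.
\<close>
lemma not_mean_convergent_along_rounded_bodies:
  fixes \<xi> :: "'d::finite \<Rightarrow> real ^ 'd"
  assumes d: "CARD('d) \<ge> 2" and q: "q = CARD('d) - 1 \<or> (CARD('d) \<ge> 3 \<and> q = CARD('d) - 2)"
    and \<xi>: "positively_oriented_basis \<xi>" and B: "config_enumeration \<xi> n B"
    and w: "homogeneous_weights CARD('d) n q w"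
  shows "\<exists>X\<in>rounded_bodies. \<not> (\<lambda>m. mean_estimator \<xi> n B w X (1 / real m)) \<longlonglongrightarrow> intrinsic_volume q X"
proof (rule ccontr)
  assume no: "\<not> ?thesis"
  let ?I = "Sigma {1..2 ^ (n ^ CARD('d)) - 1} (\<lambda>l. Pow (B l))" and ?\<delta> = "vol (unit_cell \<xi>)"
  define \<mu> where "\<mu> = (\<lambda>(l, T :: (real ^ 'd) set). w l 1 * (-1) ^ (card T + 1))"
  define S where "S = (\<lambda>(l, T). T \<union> white_part \<xi> n B l)"
  have finI: "finite ?I" using config_enumeration_parts(3)[OF B] by (intro finite_SigmaI) auto
  have finS: "finite (S i)" if i: "i \<in> ?I" for i :: "nat \<times> (real ^ 'd) set"
  proof -
    obtain l T where lT: "i = (l, T)" "l \<in> {1..2 ^ (n ^ CARD('d)) - 1}" "T \<subseteq> B l" using i by auto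
    have "finite T" using config_enumeration_parts(3)[OF B lT(2)] lT(3) by (rule rev_finite_subset)
    then show ?thesis using config_enumeration_parts(4)[OF B lT(2)] lT(1) by (simp add: S_def)
  qed
  have qd: "q \<le> CARD('d)" using q by auto
  have lim: "(\<lambda>m. real m ^ (CARD('d) - q) * (\<Sum>i\<in>?I. \<mu> i * vol (hit_set X (1 / real m) (S i))))
      \<longlonglongrightarrow> ?\<delta> * intrinsic_volume q X" if X: "X \<in> rounded_bodies" for X
  proof -
    have "(\<lambda>m. mean_estimator \<xi> n B w X (1 / real m)) \<longlonglongrightarrow> intrinsic_volume q X" using no X by blast
    from mean_limit_imp_hit_volume_limit[OF \<xi> B w qd rounded_bodies_compact_convex(1)[OF X] this]
    show ?thesis unfolding \<mu>_def S_def by (simp add: case_prod_beta)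
  qed
  have "?\<delta> = 0"
    using q
  proof
    assume q1: "q = CARD('d) - 1"
    then have "CARD('d) - q = 1" using d by simp
    then show ?thesis using lim unfolding q1 by (intro no_flat_limit[OF d finI finS]) simp_all
  next
    assume q2: "CARD('d) \<ge> 3 \<and> q = CARD('d) - 2"
    then have "CARD('d) - q = 2" by simp
    then show ?thesis using lim q2 by (intro no_cylindrical_limit[OF _ finI finS]) simp_all
  qed
  then show False using measure_unit_cell_pos[OF \<xi>] by simp
qed

theorem theorem1p4:
  fixes \<xi> :: "'d::finite \<Rightarrow> real ^ 'd"
    and n q :: nat
    and B :: "nat \<Rightarrow> (real ^ 'd) set"
    and w :: "nat \<Rightarrow> real \<Rightarrow> real"
  assumes "CARD('d) \<ge> 2"
    and "q = CARD('d) - 1 \<or> (CARD('d) \<ge> 3 \<and> q = CARD('d) - 2)"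
    and "positively_oriented_basis \<xi>"
    and "config_enumeration \<xi> n B"
    and "motion_reflection_invariant \<xi> n B w"
    and "homogeneous_weights CARD('d) n q w"
  shows "asymptotically_biased_on r_regular_sets q \<xi> n B w \<and>
         \<not> multigrid_convergent_on r_regular_sets q \<xi> n B w"
proof
  obtain X where X: "X \<in> rounded_bodies" and
    no: "\<not> (\<lambda>m. mean_estimator \<xi> n B w X (1 / real m)) \<longlonglongrightarrow> intrinsic_volume q X"
    using not_mean_convergent_along_rounded_bodies[OF assms(1-4,6)] by blast
  have Xc: "compact X" "convex X" by (rule rounded_bodies_compact_convex[OF X])+
  have right: "filterlim (\<lambda>m. 1 / real m) (at_right 0) sequentially"
    by (rule tendsto_imp_filterlim_at_right[OF lim_1_over_n])
       (auto simp: eventually_sequentially intro!: exI[of _ 1])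
  show "asymptotically_biased_on r_regular_sets q \<xi> n B w"
    unfolding asymptotically_biased_on_def asymptotically_unbiased_on_def
  proof
    assume "\<forall>X\<in>r_regular_sets. (mean_estimator \<xi> n B w X \<longlongrightarrow> intrinsic_volume q X) (at_right 0)"
    then have "(mean_estimator \<xi> n B w X \<longlongrightarrow> intrinsic_volume q X) (at_right 0)"
      using X rounded_bodies_r_regular by blast
    from filterlim_compose[OF this right] no show False by simp
  qed
  show "\<not> multigrid_convergent_on r_regular_sets q \<xi> n B w"
  proof
    assume conv: "multigrid_convergent_on r_regular_sets q \<xi> n B w"
    have "(\<lambda>m. local_estimator \<xi> n B w ((\<lambda>x. x - y) ` X) (1 / real m) 0) \<longlonglongrightarrow> intrinsic_volume q X" for y
    proof -
      have eq: "(\<lambda>x. x - y) ` X = (\<lambda>x. id x + (- y)) ` X" by simp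
      have "(\<lambda>x. x - y) ` X \<in> rounded_bodies"
        unfolding eq by (intro rounded_bodies_isometry X) (simp add: id_def)
      then have "((\<lambda>a. local_estimator \<xi> n B w ((\<lambda>x. x - y) ` X) a 0) \<longlongrightarrow> intrinsic_volume q ((\<lambda>x. x - y) ` X)) (at_right 0)"
        using conv rounded_bodies_r_regular unfolding multigrid_convergent_on_def by blast
      moreover have "intrinsic_volume q ((\<lambda>x. x - y) ` X) = intrinsic_volume q X"
        unfolding eq by (intro intrinsic_volume_isometry Xc) (simp add: id_def)
      ultimately have "((\<lambda>a. local_estimator \<xi> n B w ((\<lambda>x. x - y) ` X) a 0) \<longlongrightarrow> intrinsic_volume q X) (at_right 0)"
        by (simp only:)
      from filterlim_compose[OF this right] show ?thesis .
    qed
    then have "(\<lambda>m. mean_estimator \<xi> n B w X (1 / real m)) \<longlonglongrightarrow> intrinsic_volume q X"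
      by (rule multigrid_limit_imp_mean_limit[OF assms(3,4) Xc])
    then show False using no by simp
  qed
qed

end
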